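(* Let $\mathcal{H}$ be a separable real Hilbert space, $f:\mathcal{H}\to\mathbb{R}$ convex and differentiable with $L_{\nabla f}$-Lipschitz continuous gradient and $\operatorname{argmin} f\neq\emptyset$. Let $t_0\ge 0$, $\lambda>0$, let $b:[t_0,+\infty)\to(0,+\infty)$ be continuously differentiable and nondecreasing, and let $\sigma_Y:[t_0,+\infty)\to\mathcal{L}(\mathcal{H},\mathcal{H})$ be measurable. Consider on $[t_0,+\infty)$ the system $$\begin{cases} dY(t)=X(t)\,dt\\ dX(t)=\big(-\lambda X(t)-b(t)\nabla f(Y(t))\big)dt+\sigma_Y(t)\,dW(t)\\ Y(t_0)=Y_0,\quad X(t_0)=X_0.\end{cases}$$ If there is a constant $\sigma_*$ with $\|\sigma_Y(t)\|_{HS}\le\sigma_*$ for every $t\ge t_0$, then this system has a unique strong solution $(Y,X)$. In addition, $(Y,X)\in S^{\nu}_{\mathcal{H}\times\mathcal{H}}$ for every $\nu\ge 2$.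
   Context: The system is defined on a filtered probability space $(\Omega,\mathcal{F},\{\mathcal{F}_t\}_{t\ge t_0},\mathbb{P})$, $W$ is an $\mathcal{H}$-valued Brownian motion, and the initial data are $Y_0,X_0\in\mathcal{H}$. $\|\cdot\|_{HS}$ is the Hilbert–Schmidt norm on $\mathcal{L}(\mathcal{H},\mathcal{H})$. Strong solution: for a stochastic differential equation $dX(t)=F(t,X(t))dt+G(t,X(t))dW(t)$, $X(t_0)=X_0$ on $[t_0,+\infty)$ in a Hilbert space, a stochastic process $X$ is a strong solution if (i) $X$ is continuous on $[t_0,+\infty)$ almost surely; (ii) for every $t\ge t_0$, $\int_{t_0}^t(\|F(s,X(s))\|+\|G(s,X(s))\|_{HS}^2)ds<+\infty$ almost surely; (iii) for every $t\ge t_0$, $X(t)=X(t_0)+\int_{t_0}^tF(s,X(s))ds+\int_{t_0}^tG(s,X(s))dW(s)$ almost surely. Here this is applied to the pair $(Y,X)$ in $\mathcal{H}\times\mathcal{H}$. Uniqueness is in the usual pathwise sense. For a Hilbert space $\mathcal{K}$ and $\nu>0$, $S^\nu_{\mathcal{K}}$ is the class of progressively measurable continuous $\mathcal{K}$-valued processes $X$ on $[t_0,+\infty)$ (up to the usual identification of processes) such that $\mathbb{E}\big(\sup_{t\in[t_0,T]}\|X(t)\|^\nu\big)<+\infty$ for every $T\ge t_0$. *)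

theory Defs
  imports "HOL-Probability.Probability"
begin

text \<open>
  A separable real Hilbert space is a type of sort
  \<open>{real_inner, banach, second_countable_topology}\<close>.
\<close>

section \<open>Hilbert--Schmidt norm\<close>

definition orthonormal_basis :: "'a::real_inner set \<Rightarrow> bool" where
  "orthonormal_basis B \<longleftrightarrow>
     pairwise orthogonal B \<and> (\<forall>e\<in>B. norm e = 1) \<and> closure (span B) = UNIV"

text \<open>
  The sum does not depend on the orthonormal basis. The norm is extended-valued:
  it is \<open>\<infinity>\<close> exactly for the operators that are not Hilbert--Schmidt.
\<close>

definition hs_norm ::
  "('u::{real_inner, banach, second_countable_topology} \<Rightarrow>\<^sub>L
    'k::{real_inner, banach, second_countable_topology}) \<Rightarrow> ennreal" where
  "hs_norm A =
     (let S = (\<Sum>\<^sub>\<infinity>e\<in>(SOME B. orthonormal_basis B). ennreal ((norm (A e))\<^sup>2))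
      in if S = \<infinity> then \<infinity> else ennreal (sqrt (enn2real S)))"


section \<open>Filtered probability spaces and Brownian motion\<close>

text \<open>
  The filtration is indexed by \<open>[t0, \<infinity>)\<close>; \<open>F t\<close> for \<open>t < t0\<close> is junk. Neither completeness nor
  right-continuity is required.
\<close>

locale filtered_prob_space = prob_space M for M :: "'w measure" +
  fixes F :: "real \<Rightarrow> 'w measure" and t0 :: real
  assumes subalg: "t0 \<le> t \<Longrightarrow> subalgebra M (F t)"
    and filtration_mono: "t0 \<le> s \<Longrightarrow> s \<le> t \<Longrightarrow> sets (F s) \<subseteq> sets (F t)"

text \<open>
  Brownian motion in \<open>'u\<close> with identity covariance, relative to the filtration \<open>F\<close>. In infinite
  dimension it is cylindrical (the covariance is not of trace class, which is why integrands have
  to be Hilbert--Schmidt), so it is given by its coordinates: \<open>W t h\<close> stands for \<open>\<langle>W(t), h\<rangle>\<close>. In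
  finite dimension this is a standard Brownian motion. Only increments enter the stochastic
  integral, so no value is prescribed at \<open>t0\<close>.
\<close>

locale brownian_motion = filtered_prob_space M F t0
  for M :: "'w measure" and F :: "real \<Rightarrow> 'w measure" and t0 :: real +
  fixes W :: "real \<Rightarrow> 'u::{real_inner, banach, second_countable_topology} \<Rightarrow> 'w \<Rightarrow> real"
  assumes W_add: "t0 \<le> t \<Longrightarrow> AE \<omega> in M. W t (h + k) \<omega> = W t h \<omega> + W t k \<omega>"
    and W_scale: "t0 \<le> t \<Longrightarrow> AE \<omega> in M. W t (c *\<^sub>R h) \<omega> = c * W t h \<omega>"
    and W_adapted: "t0 \<le> t \<Longrightarrow> W t h \<in> borel_measurable (F t)"
    and W_continuous: "AE \<omega> in M. continuous_on {t0..} (\<lambda>t. W t h \<omega>)"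
    and W_normal: "t0 \<le> s \<Longrightarrow> s < t \<Longrightarrow> h \<noteq> 0 \<Longrightarrow>
      distributed M lborel (\<lambda>\<omega>. W t h \<omega> - W s h \<omega>) (normal_density 0 (sqrt (t - s) * norm h))"
    and W_indep: "t0 \<le> s \<Longrightarrow> s < t \<Longrightarrow>
      indep_set (sets (F s)) {(\<lambda>\<omega>. W t h \<omega> - W s h \<omega>) -` A \<inter> space M |A. A \<in> sets borel}"

definition progressively_measurable ::
  "(real \<Rightarrow> 'w measure) \<Rightarrow> real \<Rightarrow> (real \<Rightarrow> 'w \<Rightarrow> 'k::topological_space) \<Rightarrow> bool" where
  "progressively_measurable F t0 X \<longleftrightarrow>
     (\<forall>T\<ge>t0. (\<lambda>(s, \<omega>). X s \<omega>) \<in> borel_measurable (restrict_space borel {t0..T} \<Otimes>\<^sub>M F T))"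


section \<open>Stochastic integral\<close>

text \<open>
  A list with entries \<open>(a, b, \<xi>, h, y)\<close> stands for the elementary process
  \<open>\<Sum> \<xi>(\<omega>) 1_(a,b](s) \<langle>h, \<cdot>\<rangle> y\<close> of finite-rank operators.
\<close>

type_synonym ('w, 'u, 'k) elementary = "(real \<times> real \<times> ('w \<Rightarrow> real) \<times> 'u \<times> 'k) list"

definition elementary_process ::
  "'w measure \<Rightarrow> (real \<Rightarrow> 'w measure) \<Rightarrow> real \<Rightarrow> ('w, 'u, 'k) elementary \<Rightarrow> bool" where
  "elementary_process M F t0 P \<longleftrightarrow>
     (\<forall>(a, b, \<xi>, h, y) \<in> set P. t0 \<le> a \<and> a \<le> b \<and>
        \<xi> \<in> borel_measurable (F a) \<and> (\<exists>C. \<forall>\<omega>\<in>space M. \<bar>\<xi> \<omega>\<bar> \<le> C))"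

definition elementary_value ::
  "('w, 'u::real_inner, 'k::real_normed_vector) elementary \<Rightarrow> real \<Rightarrow> 'w \<Rightarrow> ('u \<Rightarrow>\<^sub>L 'k)" where
  "elementary_value P s \<omega> =
     (\<Sum>(a, b, \<xi>, h, y)\<leftarrow>P. (indicator {a<..b} s * \<xi> \<omega>) *\<^sub>R Blinfun (\<lambda>x. (h \<bullet> x) *\<^sub>R y))"

definition elementary_integral ::
  "(real \<Rightarrow> 'u \<Rightarrow> 'w \<Rightarrow> real) \<Rightarrow> ('w, 'u, 'k::real_normed_vector) elementary \<Rightarrow>
    real \<Rightarrow> 'w \<Rightarrow> 'k" where
  "elementary_integral W P t \<omega> =
     (\<Sum>(a, b, \<xi>, h, y)\<leftarrow>P. (\<xi> \<omega> * (W (min t b) h \<omega> - W (min t a) h \<omega>)) *\<^sub>R y)"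

text \<open>
  \<open>I\<close> is (a version of) the It\^o integral of \<open>\<Phi>\<close> over \<open>[t0, t]\<close>: for elementary processes \<open>P n\<close> with
  \<open>\<integral> \<parallel>P n - \<Phi>\<parallel>\<^sub>H\<^sub>S\<^sup>2 ds \<rightarrow> 0\<close> in probability, \<open>I\<close> is the limit in probability of their integrals.
  This covers all progressively measurable \<open>\<Phi>\<close> with \<open>\<integral> \<parallel>\<Phi>\<parallel>\<^sub>H\<^sub>S\<^sup>2 ds < \<infinity>\<close> almost surely. The required
  measurability of \<open>\<Phi>\<close> is in the strong operator sense.
\<close>

definition has_ito_integral ::
  "'w measure \<Rightarrow> (real \<Rightarrow> 'w measure) \<Rightarrow> real \<Rightarrow>
    (real \<Rightarrow> 'u::{real_inner, banach, second_countable_topology} \<Rightarrow> 'w \<Rightarrow> real) \<Rightarrow> real \<Rightarrow>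
    (real \<Rightarrow> 'w \<Rightarrow> ('u \<Rightarrow>\<^sub>L 'k::{real_inner, banach, second_countable_topology})) \<Rightarrow>
    ('w \<Rightarrow> 'k) \<Rightarrow> bool" where
  "has_ito_integral M F t0 W t \<Phi> I \<longleftrightarrow>
     (\<forall>u. progressively_measurable F t0 (\<lambda>s \<omega>. \<Phi> s \<omega> u)) \<and>
     I \<in> borel_measurable M \<and>
     (\<exists>P :: nat \<Rightarrow> ('w, 'u, 'k) elementary.
        (\<forall>n. elementary_process M F t0 (P n)) \<and>
        (\<forall>\<epsilon>>0. (\<lambda>n. measure M {\<omega> \<in> space M.
            ennreal \<epsilon> < (\<integral>\<^sup>+s\<in>{t0..t}. (hs_norm (elementary_value (P n) s \<omega> - \<Phi> s \<omega>))\<^sup>2 \<partial>lborel)})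
          \<longlonglongrightarrow> 0) \<and>
        (\<forall>\<epsilon>>0. (\<lambda>n. measure M {\<omega> \<in> space M.
            \<epsilon> < norm (elementary_integral W (P n) t \<omega> - I \<omega>)}) \<longlonglongrightarrow> 0))"


section \<open>Strong solutions\<close>

text \<open>
  \<open>X\<close> is a strong solution of \<open>dX = f(t, X) dt + g(t, X) dW\<close>, \<open>X(t0) = X0\<close>. The only measurability
  imposed on \<open>X\<close> itself is that each \<open>X t\<close> is a random variable; progressive measurability is
  imposed on the integrand \<open>g(s, X s)\<close> by \<open>has_ito_integral\<close>.
\<close>

definition strong_solution ::
  "'w measure \<Rightarrow> (real \<Rightarrow> 'w measure) \<Rightarrow> real \<Rightarrow>
    (real \<Rightarrow> 'u::{real_inner, banach, second_countable_topology} \<Rightarrow> 'w \<Rightarrow> real) \<Rightarrow>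
    (real \<Rightarrow> 'k \<Rightarrow> 'k) \<Rightarrow>
    (real \<Rightarrow> 'k \<Rightarrow> ('u \<Rightarrow>\<^sub>L 'k::{real_inner, banach, second_countable_topology})) \<Rightarrow>
    'k \<Rightarrow> (real \<Rightarrow> 'w \<Rightarrow> 'k) \<Rightarrow> bool" where
  "strong_solution M F t0 W f g X0 X \<longleftrightarrow>
     (\<forall>t\<ge>t0. X t \<in> borel_measurable M) \<and>
     (AE \<omega> in M. X t0 \<omega> = X0) \<and>
     (AE \<omega> in M. continuous_on {t0..} (\<lambda>t. X t \<omega>)) \<and>
     (\<forall>t\<ge>t0. AE \<omega> in M. set_borel_measurable lborel {t0..t} (\<lambda>s. f s (X s \<omega>)) \<and>
        (\<integral>\<^sup>+s\<in>{t0..t}. (ennreal (norm (f s (X s \<omega>))) + (hs_norm (g s (X s \<omega>)))\<^sup>2) \<partial>lborel) < \<infinity>) \<and>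
     (\<forall>t\<ge>t0. \<exists>I. has_ito_integral M F t0 W t (\<lambda>s \<omega>. g s (X s \<omega>)) I \<and>
        (AE \<omega> in M. X t \<omega> = X t0 \<omega> + (LINT s:{t0..t}|lborel. f s (X s \<omega>)) + I \<omega>))"

text \<open>
  The class \<open>S\<^sup>\<nu>\<close>. Indistinguishable processes are identified, so continuity of almost all paths is
  what is required.
\<close>

definition S_class ::
  "'w measure \<Rightarrow> (real \<Rightarrow> 'w measure) \<Rightarrow> real \<Rightarrow> real \<Rightarrow>
    (real \<Rightarrow> 'w \<Rightarrow> 'k::real_normed_vector) set" where
  "S_class M F t0 \<nu> =
     {X. progressively_measurable F t0 X \<and>
         (AE \<omega> in M. continuous_on {t0..} (\<lambda>t. X t \<omega>)) \<and>
         (\<forall>T\<ge>t0. (\<integral>\<^sup>+\<omega>. (SUP t\<in>{t0..T}. ennreal (norm (X t \<omega>) powr \<nu>)) \<partial>M) < \<infinity>)}"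


section \<open>The inertial system\<close>

text \<open>Drift and diffusion of the first-order system for the pair \<open>(Y, X)\<close>; \<open>gradf\<close> is \<open>\<nabla>f\<close>.\<close>

definition inertial_drift ::
  "real \<Rightarrow> (real \<Rightarrow> real) \<Rightarrow> ('h \<Rightarrow> 'h) \<Rightarrow> real \<Rightarrow> 'h \<times> 'h \<Rightarrow> 'h \<times> 'h::real_normed_vector" where
  "inertial_drift lam b gradf t = (\<lambda>(y, x). (x, - (lam *\<^sub>R x) - b t *\<^sub>R gradf y))"

definition inertial_diffusion ::
  "(real \<Rightarrow> ('h \<Rightarrow>\<^sub>L 'h)) \<Rightarrow> real \<Rightarrow> 'h \<times> 'h \<Rightarrow> ('h \<Rightarrow>\<^sub>L ('h \<times> 'h::real_normed_vector))" where
  "inertial_diffusion \<sigma> t = (\<lambda>(y, x). Blinfun (\<lambda>h. (0, \<sigma> t h)))"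

end

theory Submission
  imports Defs "HOL-Real_Asymp.Real_Asymp"
begin

text \<open>
  The diffusion coefficient does not depend on the solution, so the noise is the Wiener integral \<open>N\<close> of
  a deterministic operator function and the system is, path by path, the integral equation
  \<open>u(t) = u(t0) + \<integral> G(s, u(s)) ds + N(t)\<close> with a drift that is Lipschitz in \<open>u\<close>. Picard iteration solves
  it and, applied to progressively measurable \<open>N\<close>, keeps measurability; Gronwall's inequality bounds
  the solution linearly by the running maximum of \<open>N\<close> and gives uniqueness.

  Everything probabilistic concerns elementary integrals, which on a time grid are sums of martingale
  differences. Kolmogorov's maximal inequality makes approximating integrals converge uniformly almost
  surely, and a Lenglart inequality shows that the integral does not depend on the approximation, even
  if it is by random elementary processes. For deterministic integrands, restarting when the integral
  first exceeds a level gives a running maximum with geometric tails, hence with all moments.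
\<close>

section \<open>Orthonormal bases and the Hilbert--Schmidt norm\<close>

text \<open>Brownian motion is given only through its coordinates: linearity and continuity hold up
  to null sets that depend on the directions, and independence of the past is given for one
  direction at a time. Only conditional first and second moments of increments are extracted from
  this, so every estimate is a second-moment estimate. The integral is defined by convergence in
  probability, where approximants need not converge in mean square; hence its independence of the
  approximation cannot come from an isometry, and truncating the accumulated variance at a level
  restores one. Moments of order \<open>\<nu>\<close> come from repeating one estimate: if the total
  variance is at most half of the square of \<open>q\<close>, raising the level by
  \<open>2 * q\<close> halves the exceedance probability, one \<open>q\<close> paying for the jump
  across the old level and the other for the move beyond it. Since the filtration need be neither
  complete nor right-continuous, processes cannot be altered on null sets; they are defined at all
  sample points as limits of adapted expressions and only afterwards identified, almost surely, with
  the intended paths.\<close>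

fun gram_schmidt_set :: "(nat \<Rightarrow> 'a::real_inner) \<Rightarrow> nat \<Rightarrow> 'a set" where
  "gram_schmidt_set d 0 = {}"
| "gram_schmidt_set d (Suc n) =
     (let v = d n - (\<Sum>e\<in>gram_schmidt_set d n. (d n \<bullet> e) *\<^sub>R e)
      in if v = 0 then gram_schmidt_set d n else insert (v /\<^sub>R norm v) (gram_schmidt_set d n))"

text \<open>\<open>p\<close> is the orthogonal projection of \<open>d n\<close> onto the span built
  so far, so the residual \<open>v\<close> is orthogonal to that span. A \<open>d n\<close> that
  depends linearly on its predecessors has residual zero and adds nothing.\<close>

lemma gram_schmidt_set_props:
  "finite (gram_schmidt_set d n) \<and> pairwise orthogonal (gram_schmidt_set d n) \<and>
   (\<forall>e\<in>gram_schmidt_set d n. norm e = 1) \<and> (\<forall>i<n. d i \<in> span (gram_schmidt_set d n))"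
proof (induction n)
  case 0
  then show ?case by simp
next
  case (Suc n)
  define G where "G = gram_schmidt_set d n"
  define p where "p = (\<Sum>e\<in>G. (d n \<bullet> e) *\<^sub>R e)"
  define v where "v = d n - p"
  have fin: "finite G" and orth: "pairwise orthogonal G" and nrm: "\<And>e. e \<in> G \<Longrightarrow> norm e = 1"
    and sp: "\<And>i. i < n \<Longrightarrow> d i \<in> span G"
    using Suc.IH unfolding G_def by auto
  have G_Suc: "gram_schmidt_set d (Suc n) = (if v = 0 then G else insert (v /\<^sub>R norm v) G)"
    by (simp add: G_def v_def p_def Let_def)
  have p_span: "p \<in> span G"
    unfolding p_def by (intro span_sum span_scale span_base)
  have v_orth: "v \<bullet> g = 0" if "g \<in> G" for g
  proof -
    have "p \<bullet> g = (\<Sum>e\<in>G. if e = g then d n \<bullet> g else 0)"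
      unfolding p_def inner_sum_left
      using orth nrm that
      by (intro sum.cong refl) (auto simp: pairwise_def orthogonal_def dot_square_norm)
    also have "\<dots> = d n \<bullet> g" using fin that by simp
    finally show ?thesis by (simp add: v_def inner_diff_left)
  qed
  show ?case
  proof (cases "v = 0")
    case True
    have "d n \<in> span G" using True p_span by (simp add: v_def)
    then show ?thesis using True fin orth nrm sp by (auto simp: G_Suc less_Suc_eq simp del: gram_schmidt_set.simps)
  next
    case False
    let ?u = "v /\<^sub>R norm v"
    have "p \<in> span (insert ?u G)" using p_span span_mono[of G "insert ?u G"] by auto
    then have "norm v *\<^sub>R ?u + p \<in> span (insert ?u G)"
      by (rule span_add[OF span_scale[OF span_base[OF insertI1]]])
    then have dn: "d n \<in> span (insert ?u G)" using False by (simp add: v_def)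
    have "pairwise orthogonal (insert ?u G)"
      using orth v_orth by (auto simp: pairwise_insert orthogonal_def inner_commute)
    then show ?thesis
      using False fin nrm sp dn
      by (auto simp: G_Suc less_Suc_eq simp del: gram_schmidt_set.simps intro: set_mp[OF span_mono[OF subset_insertI]])
  qed
qed

lemma gram_schmidt_set_mono: "m \<le> n \<Longrightarrow> gram_schmidt_set d m \<subseteq> gram_schmidt_set d n"
  by (rule lift_Suc_mono_le[of "gram_schmidt_set d"]) (simp_all add: Let_def subset_insertI)

text \<open>Gram-Schmidt along an enumeration of a countable dense set; two members of the union are
  compared inside a common finite stage. This makes the choice in \<open>hs_norm\<close> a choice of
  an actual basis.\<close>

lemma orthonormal_basis_exists:
  "\<exists>B :: 'a::{real_inner, second_countable_topology} set. orthonormal_basis B"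
proof -
  obtain D :: "'a set" where D: "countable D" "\<And>X. open X \<Longrightarrow> X \<noteq> {} \<Longrightarrow> \<exists>d\<in>D. d \<in> X"
    using countable_dense_setE by blast
  have "D \<noteq> {}" using D(2)[of UNIV] by auto
  then obtain d :: "nat \<Rightarrow> 'a" where d: "range d = D"
    using D(1) by (metis range_from_nat_into)
  define B where "B = (\<Union>n. gram_schmidt_set d n)"
  have "pairwise orthogonal B"
    unfolding pairwise_def
  proof (intro ballI impI)
    fix x y assume "x \<in> B" "y \<in> B" "x \<noteq> y"
    then obtain m n where "x \<in> gram_schmidt_set d m" "y \<in> gram_schmidt_set d n"
      by (auto simp: B_def)
    then have "x \<in> gram_schmidt_set d (max m n)" "y \<in> gram_schmidt_set d (max m n)"
      using gram_schmidt_set_mono[of m "max m n" d] gram_schmidt_set_mono[of n "max m n" d] by auto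
    then show "orthogonal x y"
      using gram_schmidt_set_props[of d "max m n"] \<open>x \<noteq> y\<close> by (auto simp: pairwise_def)
  qed
  moreover have "\<forall>e\<in>B. norm e = 1"
    using gram_schmidt_set_props[of d] by (auto simp: B_def)
  moreover have "closure (span B) = UNIV"
  proof -
    have "d i \<in> span B" for i
      using gram_schmidt_set_props[of d "Suc i"] span_mono[of "gram_schmidt_set d (Suc i)" B]
      unfolding B_def by blast
    then have "D \<subseteq> span B" using d by auto
    moreover have "closure D = UNIV"
    proof (intro set_eqI iffI UNIV_I)
      fix x
      show "x \<in> closure D"
        unfolding closure_approachable
      proof (intro allI impI)
        fix r :: real assume "0 < r"
        then obtain y where "y \<in> D" "y \<in> ball x r" using D(2)[of "ball x r"] by auto
        then show "\<exists>y\<in>D. dist y x < r" by (auto simp: dist_commute)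
      qed
    qed
    ultimately show ?thesis using closure_mono[of D "span B"] by auto
  qed
  ultimately show ?thesis unfolding orthonormal_basis_def by blast
qed

text \<open>Distinct members have distance the square root of 2, so balls of radius one half around
  them are disjoint, and a second countable space has only countably many disjoint nonempty open
  sets.\<close>

lemma orthonormal_basis_countable:
  fixes B :: "'a::{real_inner, second_countable_topology} set"
  assumes "orthonormal_basis B"
  shows "countable B"
proof -
  have dist: "1 < dist x y" if "x \<in> B" "y \<in> B" "x \<noteq> y" for x y
  proof -
    have "x \<bullet> y = 0" "x \<bullet> x = 1" "y \<bullet> y = 1"
      using assms that by (auto simp: orthonormal_basis_def pairwise_def orthogonal_def dot_square_norm)
    then have "(dist x y)\<^sup>2 = 2"
      by (simp add: dist_norm power2_norm_eq_inner inner_diff_left inner_diff_right inner_commute)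
    then have "1\<^sup>2 < (dist x y)\<^sup>2" by simp
    then show ?thesis by (rule power2_less_imp_less) simp
  qed
  have "countable ((\<lambda>x. ball x (1/2)) ` B)"
  proof (rule countable_disjoint_open_subsets)
    have "ball x (1/2) \<inter> ball y (1/2) = {}" if xy: "x \<in> B" "y \<in> B" "x \<noteq> y" for x y
    proof (rule ccontr)
      assume "ball x (1/2) \<inter> ball y (1/2) \<noteq> {}"
      then obtain z where "z \<in> ball x (1/2)" "z \<in> ball y (1/2)" by auto
      then have "dist x y < 1"
        using dist_triangle_half_r[of z x 1 y] by (simp add: dist_commute)
      then show False using dist[OF xy] by simp
    qed
    then show "disjoint ((\<lambda>x. ball x (1/2)) ` B)"
      unfolding disjoint_def by (metis (no_types, lifting) imageE)
  qed auto
  moreover have "inj_on (\<lambda>x. ball x (1/2)) B"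
  proof (rule inj_onI, rule ccontr)
    fix x y assume xy: "x \<in> B" "y \<in> B" "ball x (1/2) = ball y (1/2)" "x \<noteq> y"
    then have "x \<in> ball y (1/2)" by (metis centre_in_ball half_gt_zero zero_less_one)
    then show False using dist[OF xy(1,2,4)] by (simp add: dist_commute)
  qed
  ultimately show ?thesis by (rule countable_image_inj_on)
qed

text \<open>Zero entries pad the sequence when the space is finite-dimensional.\<close>

definition orthonormal_seq :: "(nat \<Rightarrow> 'a::real_inner) \<Rightarrow> bool" where
  "orthonormal_seq e \<longleftrightarrow> (\<forall>m n. m \<noteq> n \<longrightarrow> e m \<bullet> e n = 0) \<and> (\<forall>n. e n = 0 \<or> norm (e n) = 1) \<and>
     closure (span (range e)) = UNIV"

lemma hs_norm_suminf:
  obtains e :: "nat \<Rightarrow> 'u::{real_inner, banach, second_countable_topology}"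
  where "orthonormal_seq e"
    and "\<And>A :: 'u \<Rightarrow>\<^sub>L 'k::{real_inner, banach, second_countable_topology}.
           (hs_norm A)\<^sup>2 = (\<Sum>n. ennreal ((norm (A (e n)))\<^sup>2))"
proof -
  define B :: "'u set" where "B = (SOME B. orthonormal_basis B)"
  have B: "orthonormal_basis B"
    unfolding B_def by (rule someI_ex) (rule orthonormal_basis_exists)
  have countB: "countable B" using orthonormal_basis_countable[OF B] .
  define e :: "nat \<Rightarrow> 'u" where
    "e n = (if n \<in> to_nat_on B ` B then from_nat_into B n else 0)" for n
  have e_to_nat: "e (to_nat_on B x) = x" if "x \<in> B" for x
    using that countB by (auto simp: e_def)
  have e_cases: "e n = 0 \<or> (e n \<in> B \<and> n = to_nat_on B (e n))" for n
    using countB by (auto simp: e_def)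
  have nrm: "norm x = 1" if "x \<in> B" for x using B that by (auto simp: orthonormal_basis_def)
  have range: "range e - {0} = B"
  proof (intro set_eqI iffI)
    fix x assume "x \<in> B"
    moreover from this have "x \<noteq> 0" using nrm[of x] by auto
    ultimately show "x \<in> range e - {0}" using e_to_nat[of x] by (metis DiffI rangeI singletonD)
  qed (use e_cases in force)
  have "orthonormal_seq e"
    unfolding orthonormal_seq_def
  proof (intro conjI allI impI)
    fix m n :: nat assume "m \<noteq> n"
    then have "e m = 0 \<or> e n = 0 \<or> (e m \<in> B \<and> e n \<in> B \<and> e m \<noteq> e n)"
      using e_cases[of m] e_cases[of n] by metis
    then show "e m \<bullet> e n = 0"
      using B by (auto simp: orthonormal_basis_def pairwise_def orthogonal_def)
  next
    show "e n = 0 \<or> norm (e n) = 1" for n using e_cases[of n] nrm by auto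
    have "span B \<subseteq> span (range e)" using range by (intro span_mono) auto
    then show "closure (span (range e)) = UNIV"
      using B closure_mono unfolding orthonormal_basis_def by blast
  qed
  moreover have "(hs_norm A)\<^sup>2 = (\<Sum>n. ennreal ((norm (A (e n)))\<^sup>2))" for A :: "'u \<Rightarrow>\<^sub>L 'k"
  proof -
    define S where "S = (\<Sum>\<^sub>\<infinity>x\<in>B. ennreal ((norm (A x))\<^sup>2))"
    have sq: "(hs_norm A)\<^sup>2 = S"
    proof (cases "S = \<infinity>")
      case True
      then show ?thesis by (simp add: hs_norm_def S_def B_def Let_def)
    next
      case False
      then have "(hs_norm A)\<^sup>2 = (ennreal (sqrt (enn2real S)))\<^sup>2"
        by (simp add: hs_norm_def S_def B_def Let_def)
      also have "\<dots> = ennreal (enn2real S)"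
        by (simp add: ennreal_power)
      finally show ?thesis using False by (simp add: less_top)
    qed
    have inj: "inj_on (to_nat_on B) B" using countB by (rule inj_on_to_nat_on)
    have "S = (\<Sum>\<^sub>\<infinity>n\<in>to_nat_on B ` B. ennreal ((norm (A (e n)))\<^sup>2))"
      unfolding S_def infsum_reindex[OF inj] by (intro infsum_cong) (simp add: e_to_nat)
    also have "\<dots> = (\<Sum>\<^sub>\<infinity>n. ennreal ((norm (A (e n)))\<^sup>2))"
      by (intro infsum_cong_neutral) (auto simp: e_def)
    also have "\<dots> = (\<Sum>n. ennreal ((norm (A (e n)))\<^sup>2))"
      by (intro sums_unique has_sum_imp_sums has_sum_infsum nonneg_summable_on_complete) auto
    finally show ?thesis using sq by simp
  qed
  ultimately show ?thesis by (rule that)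
qed

section \<open>Parseval's identity and finite-rank operators\<close>

text \<open>The partial sum \<open>p n\<close> is the best approximation of \<open>x\<close> in the
  span of the first \<open>n\<close> vectors, and each element of the dense span lies in one of
  these spans, so the residual tends to zero; \<open>bessel\<close> turns this into convergence of
  the sums of squared coefficients.\<close>

lemma orthonormal_seq_norm_square_sums:
  fixes e :: "nat \<Rightarrow> 'a::real_inner"
  assumes "orthonormal_seq e"
  shows "(\<lambda>n. (x \<bullet> e n)\<^sup>2) sums (norm x)\<^sup>2"
proof -
  have orth: "e m \<bullet> e n = 0" if "m \<noteq> n" for m n
    using assms that by (simp add: orthonormal_seq_def)
  \<comment> \<open>Holds for unit vectors and for the zero padding alike, so the sums below need no
    case distinction.\<close>
  have coef: "(x \<bullet> e n) * (e n \<bullet> e n) = x \<bullet> e n" for x n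
  proof -
    have "e n = 0 \<or> norm (e n) = 1" using assms by (simp add: orthonormal_seq_def)
    then show ?thesis by (auto simp: dot_square_norm)
  qed
  define p where "p n = (\<Sum>i<n. (x \<bullet> e i) *\<^sub>R e i)" for n
  have p_e: "p n \<bullet> e j = (if j < n then x \<bullet> e j else 0)" for n j
  proof -
    have "p n \<bullet> e j = (\<Sum>i<n. if i = j then x \<bullet> e j else 0)"
      unfolding p_def inner_sum_left using orth coef by (intro sum.cong) auto
    then show ?thesis by simp
  qed
  have p_p: "p n \<bullet> p n = (\<Sum>i<n. (x \<bullet> e i)\<^sup>2)" for n
    by (subst (2) p_def) (simp add: inner_sum_right p_e power2_eq_square)
  have p_x: "x \<bullet> p n = (\<Sum>i<n. (x \<bullet> e i)\<^sup>2)" for n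
    by (simp add: p_def inner_sum_right power2_eq_square)
  have bessel: "(norm (x - p n))\<^sup>2 = (norm x)\<^sup>2 - (\<Sum>i<n. (x \<bullet> e i)\<^sup>2)" for n
    unfolding power2_norm_eq_inner
    by (simp add: inner_diff_left inner_diff_right p_p p_x inner_commute[of "p n" x])
  have best: "norm (x - p n) \<le> norm (x - v)" if v: "v \<in> span (e ` {..<n})" for v n
  proof -
    have "(x - p n) \<bullet> u = 0" if "u \<in> span (e ` {..<n})" for u
      using that
    proof (induction rule: span_induct_alt)
      case (step c u w)
      then show ?case by (auto simp: inner_diff_left p_e inner_add_right)
    qed simp
    moreover have "p n - v \<in> span (e ` {..<n})"
      unfolding p_def by (intro span_diff span_sum span_scale span_base v) auto
    ultimately have "orthogonal (x - p n) (p n - v)" by (simp add: orthogonal_def)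
    then have "(norm ((x - p n) + (p n - v)))\<^sup>2 = (norm (x - p n))\<^sup>2 + (norm (p n - v))\<^sup>2"
      by (rule norm_add_Pythagorean)
    then have "(norm (x - p n))\<^sup>2 \<le> (norm (x - v))\<^sup>2" by simp
    then show ?thesis by (rule power2_le_imp_le) simp
  qed
  have "(\<lambda>n. norm (x - p n)) \<longlonglongrightarrow> 0"
  proof (rule LIMSEQ_I)
    fix r :: real assume "0 < r"
    have "x \<in> closure (span (range e))" using assms by (simp add: orthonormal_seq_def)
    then obtain v where v: "v \<in> span (range e)" "dist v x < r"
      using \<open>0 < r\<close> by (meson closure_approachable)
    obtain S where S: "finite S" "S \<subseteq> range e" "v \<in> span S"
    proof -
      obtain t r where "finite t" "t \<subseteq> range e" "v = (\<Sum>a\<in>t. r a *\<^sub>R a)"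
        using v(1) by (auto simp: span_explicit)
      then show thesis using that[of t] by (simp add: span_sum span_scale span_base)
    qed
    obtain N where N: "S \<subseteq> e ` {..<N}"
    proof -
      obtain I where I: "finite I" "S = e ` I" using S(1,2) by (meson finite_subset_image)
      then have "I \<subseteq> {..<Suc (Max (insert 0 I))}" by (auto simp: less_Suc_eq_le)
      then show thesis using that I(2) by blast
    qed
    show "\<exists>no. \<forall>n\<ge>no. norm (norm (x - p n) - 0) < r"
    proof (intro exI allI impI)
      fix n assume "N \<le> n"
      then have "v \<in> span (e ` {..<n})" using S(3) N span_mono[of S "e ` {..<n}"] by force
      then show "norm (norm (x - p n) - 0) < r"
        using best[of v n] v(2) by (simp add: dist_norm norm_minus_commute)
    qed
  qed
  then have "(\<lambda>n. (norm x)\<^sup>2 - (norm (x - p n))\<^sup>2) \<longlonglongrightarrow> (norm x)\<^sup>2 - 0\<^sup>2"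
    by (intro tendsto_intros)
  then show ?thesis by (simp add: sums_def bessel)
qed

text \<open>Polarization of the norm identity.\<close>

lemma orthonormal_seq_inner_sums:
  fixes e :: "nat \<Rightarrow> 'a::real_inner"
  assumes "orthonormal_seq e"
  shows "(\<lambda>n. (x \<bullet> e n) * (y \<bullet> e n)) sums (x \<bullet> y)"
proof -
  have "(\<lambda>n. (((x + y) \<bullet> e n)\<^sup>2 - ((x - y) \<bullet> e n)\<^sup>2) / 4) sums (((norm (x + y))\<^sup>2 - (norm (x - y))\<^sup>2) / 4)"
    by (intro sums_divide sums_diff orthonormal_seq_norm_square_sums assms)
  moreover have "(((x + y) \<bullet> e n)\<^sup>2 - ((x - y) \<bullet> e n)\<^sup>2) / 4 = (x \<bullet> e n) * (y \<bullet> e n)" for n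
    by (simp add: inner_add_left inner_diff_left power2_eq_square algebra_simps)
  moreover have "((norm (x + y))\<^sup>2 - (norm (x - y))\<^sup>2) / 4 = x \<bullet> y"
    by (simp add: power2_norm_eq_inner inner_add_left inner_diff_left inner_add_right inner_diff_right inner_commute)
  ultimately show ?thesis by simp
qed

lemma Blinfun_inner_scaleR [simp]:
  "blinfun_apply (Blinfun (\<lambda>x. (h \<bullet> x) *\<^sub>R y)) x = (h \<bullet> x) *\<^sub>R y"
  by (subst bounded_linear_Blinfun_apply)
    (auto intro!: bounded_linear_intros)

text \<open>After expanding the square, the products of inner products with \<open>e n\<close> sum
  to \<open>h i \<bullet> h j\<close>. The result no longer mentions the basis and pairs the Gram
  matrices of the \<open>h i\<close> and the \<open>y i\<close>.\<close>

lemma finite_rank_norm_square_sums: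
  fixes e :: "nat \<Rightarrow> 'a::real_inner" and y :: "'i \<Rightarrow> 'k::real_inner"
  assumes "orthonormal_seq e"
  shows "(\<lambda>n. (norm (\<Sum>i\<in>I. (c i * (h i \<bullet> e n)) *\<^sub>R y i))\<^sup>2) sums
    (\<Sum>i\<in>I. \<Sum>j\<in>I. c i * c j * (h i \<bullet> h j) * (y i \<bullet> y j))"
proof -
  have "(norm (\<Sum>i\<in>I. (c i * (h i \<bullet> e n)) *\<^sub>R y i))\<^sup>2 =
      (\<Sum>i\<in>I. \<Sum>j\<in>I. c i * c j * ((h i \<bullet> e n) * (h j \<bullet> e n)) * (y i \<bullet> y j))" for n
    unfolding power2_norm_eq_inner inner_sum_left inner_sum_right
    by (subst sum.swap, intro sum.cong refl) (simp add: algebra_simps inner_commute)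
  then show ?thesis
    by (auto intro!: sums_sum sums_mult sums_mult2 orthonormal_seq_inner_sums assms)
qed

text \<open>The double sum is the value of a series of squares.\<close>

lemma finite_rank_norm_square_nonneg:
  fixes h :: "'i \<Rightarrow> 'a::{real_inner, banach, second_countable_topology}" and y :: "'i \<Rightarrow> 'k::real_inner"
  shows "0 \<le> (\<Sum>i\<in>I. \<Sum>j\<in>I. c i * c j * (h i \<bullet> h j) * (y i \<bullet> y j))"
proof -
  obtain e :: "nat \<Rightarrow> 'a" where "orthonormal_seq e"
    using hs_norm_suminf by metis
  from finite_rank_norm_square_sums[OF this] show ?thesis
    by (rule sums_le[OF _ sums_zero, rotated]) simp
qed

text \<open>The factor \<open>h i \<bullet> h j\<close> is also the covariance, per unit time, of
  the coordinates of Brownian motion in the directions \<open>h i\<close> and \<open>h j\<close>;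
  this coincidence is the source of the isometry for elementary integrals.\<close>

lemma hs_norm_finite_rank:
  fixes A :: "'u::{real_inner, banach, second_countable_topology} \<Rightarrow>\<^sub>L
    'k::{real_inner, banach, second_countable_topology}"
  assumes "\<And>x. A x = (\<Sum>i\<in>I. (c i * (h i \<bullet> x)) *\<^sub>R y i)"
  shows "(hs_norm A)\<^sup>2 = ennreal (\<Sum>i\<in>I. \<Sum>j\<in>I. c i * c j * (h i \<bullet> h j) * (y i \<bullet> y j))"
proof -
  obtain e :: "nat \<Rightarrow> 'u" where e: "orthonormal_seq e"
    and hs: "\<And>A :: 'u \<Rightarrow>\<^sub>L 'k. (hs_norm A)\<^sup>2 = (\<Sum>n. ennreal ((norm (A (e n)))\<^sup>2))"
    using hs_norm_suminf by metis
  show ?thesis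
    unfolding hs assms using finite_rank_norm_square_sums[OF e] by (intro suminf_ennreal_eq) auto
qed

lemma norm_add_square_le: "(norm (x + y))\<^sup>2 \<le> 2 * (norm x)\<^sup>2 + 2 * (norm y)\<^sup>2"
  for x y :: "'k::real_normed_vector"
proof -
  have "(norm (x + y))\<^sup>2 \<le> (norm x + norm y)\<^sup>2" by (intro power_mono norm_triangle_ineq) auto
  also have "\<dots> \<le> 2 * (norm x)\<^sup>2 + 2 * (norm y)\<^sup>2"
    using sum_squares_bound[of "norm x" "norm y"] by (simp add: power2_sum)
  finally show ?thesis .
qed

lemma hs_norm_add_square_le:
  fixes A B C :: "'u::{real_inner, banach, second_countable_topology} \<Rightarrow>\<^sub>L
    'k::{real_inner, banach, second_countable_topology}"
  assumes "\<And>x. C x = A x + B x"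
  shows "(hs_norm C)\<^sup>2 \<le> 2 * (hs_norm A)\<^sup>2 + 2 * (hs_norm B)\<^sup>2"
proof -
  obtain e :: "nat \<Rightarrow> 'u" where
    hs: "\<And>A :: 'u \<Rightarrow>\<^sub>L 'k. (hs_norm A)\<^sup>2 = (\<Sum>n. ennreal ((norm (A (e n)))\<^sup>2))"
    using hs_norm_suminf by metis
  have "ennreal ((norm (C (e n)))\<^sup>2) \<le> 2 * ennreal ((norm (A (e n)))\<^sup>2) + 2 * ennreal ((norm (B (e n)))\<^sup>2)" for n
    by (subst (1 2) ennreal_numeral[symmetric]) (simp add: assms norm_add_square_le ennreal_mult[symmetric] ennreal_plus[symmetric] del: ennreal_numeral ennreal_plus)
  then have "(hs_norm C)\<^sup>2 \<le> (\<Sum>n. 2 * ennreal ((norm (A (e n)))\<^sup>2) + 2 * ennreal ((norm (B (e n)))\<^sup>2))"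
    unfolding hs by (intro suminf_le) auto
  also have "\<dots> = 2 * (hs_norm A)\<^sup>2 + 2 * (hs_norm B)\<^sup>2"
    unfolding hs by (subst suminf_add[symmetric]) auto
  finally show ?thesis .
qed

lemma hs_norm_uminus_square:
  fixes A B :: "'u::{real_inner, banach, second_countable_topology} \<Rightarrow>\<^sub>L
    'k::{real_inner, banach, second_countable_topology}"
  assumes "\<And>x. B x = - A x"
  shows "(hs_norm B)\<^sup>2 = (hs_norm A)\<^sup>2"
proof -
  obtain e :: "nat \<Rightarrow> 'u" where
    hs: "\<And>A :: 'u \<Rightarrow>\<^sub>L 'k. (hs_norm A)\<^sup>2 = (\<Sum>n. ennreal ((norm (A (e n)))\<^sup>2))"
    using hs_norm_suminf by metis
  show ?thesis unfolding hs by (simp add: assms)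
qed

text \<open>The squared norm is a countable series in the vectors \<open>A x (e n)\<close>, so
  measurability in the strong operator sense is enough.\<close>

lemma borel_measurable_hs_norm_square:
  fixes A :: "'a \<Rightarrow> ('u::{real_inner, banach, second_countable_topology} \<Rightarrow>\<^sub>L
    'k::{real_inner, banach, second_countable_topology})"
  assumes "\<And>u. (\<lambda>x. A x u) \<in> borel_measurable N"
  shows "(\<lambda>x. (hs_norm (A x))\<^sup>2) \<in> borel_measurable N"
proof -
  obtain e :: "nat \<Rightarrow> 'u" where
    hs: "\<And>A :: 'u \<Rightarrow>\<^sub>L 'k. (hs_norm A)\<^sup>2 = (\<Sum>n. ennreal ((norm (A (e n)))\<^sup>2))"
    using hs_norm_suminf by metis
  note [measurable] = assms
  show ?thesis unfolding hs by measurable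
qed

section \<open>Martingale difference sequences\<close>

locale discrete_filtration = prob_space M for M :: "'w measure" +
  fixes G :: "nat \<Rightarrow> 'w measure"
  assumes subalgebra_G: "subalgebra M (G k)"
    and sets_G_Suc: "sets (G k) \<subseteq> sets (G (Suc k))"
begin

lemma space_G [simp]: "space (G k) = space M"
  using subalgebra_G[of k] by (simp add: subalgebra_def)

lemma sets_G_mono: "i \<le> j \<Longrightarrow> sets (G i) \<subseteq> sets (G j)"
  using lift_Suc_mono_le[of "\<lambda>k. sets (G k)" i j] sets_G_Suc by auto

lemma sets_G_M: "A \<in> sets (G k) \<Longrightarrow> A \<in> sets M"
  using subalgebra_G[of k] by (auto simp: subalgebra_def)

lemma measurable_G_mono: "f \<in> measurable (G i) N \<Longrightarrow> i \<le> j \<Longrightarrow> f \<in> measurable (G j) N"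
  using sets_G_mono[of i j] by (auto simp: measurable_def)

lemma measurable_G_M: "f \<in> measurable (G i) N \<Longrightarrow> f \<in> measurable M N"
  using measurable_from_subalg[OF subalgebra_G] by auto

text \<open>Vector-valued martingale differences expressed without conditional expectations:
  orthogonality in mean square to every square-integrable vector known at time \<open>k\<close> is
  what the second-moment arguments use.\<close>

definition mart_diff ::
  "(nat \<Rightarrow> 'w \<Rightarrow> 'k::{real_inner, banach, second_countable_topology}) \<Rightarrow> nat \<Rightarrow> bool" where
  "mart_diff D n \<longleftrightarrow> (\<forall>k<n. D k \<in> borel_measurable (G (Suc k)) \<and>
     integrable M (\<lambda>\<omega>. (norm (D k \<omega>))\<^sup>2) \<and>
     (\<forall>U\<in>borel_measurable (G k). integrable M (\<lambda>\<omega>. (norm (U \<omega>))\<^sup>2) \<longrightarrow>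
        (\<integral>\<omega>. U \<omega> \<bullet> D k \<omega> \<partial>M) = 0))"

lemma mart_diffD:
  assumes "mart_diff D n" "k < n"
  shows "D k \<in> borel_measurable (G (Suc k))" "D k \<in> borel_measurable M"
    "integrable M (\<lambda>\<omega>. (norm (D k \<omega>))\<^sup>2)"
    "\<And>U. U \<in> borel_measurable (G k) \<Longrightarrow> integrable M (\<lambda>\<omega>. (norm (U \<omega>))\<^sup>2) \<Longrightarrow>
      (\<integral>\<omega>. U \<omega> \<bullet> D k \<omega> \<partial>M) = 0"
  using assms measurable_G_M unfolding mart_diff_def by blast+

lemma mart_diff_sum_measurable:
  assumes "mart_diff D n" "m \<le> n" "m \<le> k"
  shows "(\<lambda>\<omega>. \<Sum>i<m. D i \<omega>) \<in> borel_measurable (G k)"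
proof (intro borel_measurable_sum)
  fix i assume "i \<in> {..<m}"
  then show "D i \<in> borel_measurable (G k)"
    using assms(2,3) by (intro measurable_G_mono[OF mart_diffD(1)[OF assms(1)]]) auto
qed

lemma integrable_inner_square_integrable:
  fixes U V :: "'w \<Rightarrow> 'k::{real_inner, banach, second_countable_topology}"
  assumes [measurable]: "U \<in> borel_measurable M" "V \<in> borel_measurable M"
    and "integrable M (\<lambda>\<omega>. (norm (U \<omega>))\<^sup>2)" "integrable M (\<lambda>\<omega>. (norm (V \<omega>))\<^sup>2)"
  shows "integrable M (\<lambda>\<omega>. U \<omega> \<bullet> V \<omega>)"
proof (rule Bochner_Integration.integrable_bound)
  show "integrable M (\<lambda>\<omega>. (norm (U \<omega>))\<^sup>2 + (norm (V \<omega>))\<^sup>2)" using assms(3,4) by auto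
  show "AE \<omega> in M. norm (U \<omega> \<bullet> V \<omega>) \<le> norm ((norm (U \<omega>))\<^sup>2 + (norm (V \<omega>))\<^sup>2)"
  proof (intro AE_I2)
    fix \<omega>
    have "norm (U \<omega> \<bullet> V \<omega>) \<le> norm (U \<omega>) * norm (V \<omega>)"
      by (simp add: Cauchy_Schwarz_ineq2)
    also have "\<dots> \<le> 2 * norm (U \<omega>) * norm (V \<omega>)" by simp
    also have "\<dots> \<le> (norm (U \<omega>))\<^sup>2 + (norm (V \<omega>))\<^sup>2" by (rule sum_squares_bound)
    finally show "norm (U \<omega> \<bullet> V \<omega>) \<le> norm ((norm (U \<omega>))\<^sup>2 + (norm (V \<omega>))\<^sup>2)" by simp
  qed
qed measurable

text \<open>The sum of the first \<open>m\<close> differences is itself an admissible test vector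
  for \<open>D m\<close>, so the cross term vanishes.\<close>

lemma mart_diff_second_moment:
  assumes D: "mart_diff D n" and "m \<le> n"
  shows "integrable M (\<lambda>\<omega>. (norm (\<Sum>k<m. D k \<omega>))\<^sup>2) \<and>
    (\<integral>\<omega>. (norm (\<Sum>k<m. D k \<omega>))\<^sup>2 \<partial>M) = (\<Sum>k<m. \<integral>\<omega>. (norm (D k \<omega>))\<^sup>2 \<partial>M)"
  using \<open>m \<le> n\<close>
proof (induction m)
  case (Suc m)
  let ?S = "\<lambda>\<omega>. \<Sum>k<m. D k \<omega>"
  have "m < n" using Suc.prems by simp
  note Dm = mart_diffD[OF D this]
  have S: "?S \<in> borel_measurable (G m)" "integrable M (\<lambda>\<omega>. (norm (?S \<omega>))\<^sup>2)"
    using mart_diff_sum_measurable[OF D] Suc by auto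
  note SM = measurable_G_M[OF S(1)]
  have eq: "(norm (\<Sum>k<Suc m. D k \<omega>))\<^sup>2 = (norm (?S \<omega>))\<^sup>2 + 2 * (?S \<omega> \<bullet> D m \<omega>) + (norm (D m \<omega>))\<^sup>2" for \<omega>
    by (simp add: power2_norm_eq_inner inner_add_left inner_add_right inner_commute)
  have int: "integrable M (\<lambda>\<omega>. ?S \<omega> \<bullet> D m \<omega>)"
    by (rule integrable_inner_square_integrable[OF SM Dm(2) S(2) Dm(3)])
  show ?case
    unfolding eq using Suc int S(2) Dm(3) Dm(4)[OF S] by simp
qed simp

text \<open>The indicator can be moved across the inner product onto the test vector. Stopping,
  truncating and restarting are all instances of this with a suitable \<open>A\<close>.\<close>

lemma mart_diff_indicator:
  assumes D: "mart_diff D n" and A: "\<And>k. k < n \<Longrightarrow> A k \<in> sets (G k)"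
  shows "mart_diff (\<lambda>k \<omega>. indicator (A k) \<omega> *\<^sub>R D k \<omega>) n"
  unfolding mart_diff_def
proof (intro allI impI conjI ballI)
  fix k assume k: "k < n"
  note Dk = mart_diffD[OF D k] and Ak = A[OF k]
  have ind: "indicator (A k) \<in> borel_measurable (G k)" using Ak by simp
  show "(\<lambda>\<omega>. indicator (A k) \<omega> *\<^sub>R D k \<omega>) \<in> borel_measurable (G (Suc k))"
    using Dk(1) measurable_G_mono[OF ind, of "Suc k"] by (intro borel_measurable_scaleR) auto
  have "(norm (indicator (A k) \<omega> *\<^sub>R D k \<omega>))\<^sup>2 = indicator (A k) \<omega> *\<^sub>R (norm (D k \<omega>))\<^sup>2" for \<omega>
    by (auto simp: indicator_def)
  then show "integrable M (\<lambda>\<omega>. (norm (indicator (A k) \<omega> *\<^sub>R D k \<omega>))\<^sup>2)"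
    using Dk(3) sets_G_M[OF Ak] by (simp add: integrable_mult_indicator del: real_scaleR_def)
  fix U :: "'w \<Rightarrow> 'a" assume U: "U \<in> borel_measurable (G k)" "integrable M (\<lambda>\<omega>. (norm (U \<omega>))\<^sup>2)"
  have "(\<lambda>\<omega>. indicator (A k) \<omega> *\<^sub>R U \<omega>) \<in> borel_measurable (G k)"
    using ind U(1) by (intro borel_measurable_scaleR)
  moreover have "(norm (indicator (A k) \<omega> *\<^sub>R U \<omega>))\<^sup>2 = indicator (A k) \<omega> *\<^sub>R (norm (U \<omega>))\<^sup>2" for \<omega>
    by (auto simp: indicator_def)
  then have "integrable M (\<lambda>\<omega>. (norm (indicator (A k) \<omega> *\<^sub>R U \<omega>))\<^sup>2)"
    using U(2) sets_G_M[OF Ak] by (simp add: integrable_mult_indicator del: real_scaleR_def)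
  ultimately have "(\<integral>\<omega>. (indicator (A k) \<omega> *\<^sub>R U \<omega>) \<bullet> D k \<omega> \<partial>M) = 0"
    by (rule Dk(4))
  then show "(\<integral>\<omega>. U \<omega> \<bullet> (indicator (A k) \<omega> *\<^sub>R D k \<omega>) \<partial>M) = 0"
    by simp
qed

lemma mart_diff_sum_sets:
  assumes "mart_diff D n" "k \<le> n"
  shows "{\<omega>\<in>space M. \<exists>j\<le>k. r < norm (\<Sum>i<j. D i \<omega>)} \<in> sets (G k)"
    "{\<omega>\<in>space M. \<forall>j\<le>k. norm (\<Sum>i<j. D i \<omega>) \<le> r} \<in> sets (G k)"
proof -
  \<comment> \<open>The default value 0 makes the function \<open>G k\<close>-measurable for every
    \<open>j\<close>, so that the events with a bounded quantifier over \<open>j\<close> are seen to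
    be measurable at once.\<close>
  have [measurable]: "(\<lambda>\<omega>. if j \<le> k then \<Sum>i<j. D i \<omega> else 0) \<in> borel_measurable (G k)" for j
    using mart_diff_sum_measurable[OF assms(1), of j k] assms(2) by (cases "j \<le> k") auto
  have "{\<omega>\<in>space (G k). \<exists>j\<in>{..k}. r < norm (if j \<le> k then \<Sum>i<j. D i \<omega> else 0)} \<in> sets (G k)"
    by measurable
  also have "{\<omega>\<in>space (G k). \<exists>j\<in>{..k}. r < norm (if j \<le> k then \<Sum>i<j. D i \<omega> else 0)} =
     {\<omega>\<in>space M. \<exists>j\<le>k. r < norm (\<Sum>i<j. D i \<omega>)}" by auto
  finally show "{\<omega>\<in>space M. \<exists>j\<le>k. r < norm (\<Sum>i<j. D i \<omega>)} \<in> sets (G k)" .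
  have "{\<omega>\<in>space (G k). \<forall>j\<in>{..k}. norm (if j \<le> k then \<Sum>i<j. D i \<omega> else 0) \<le> r} \<in> sets (G k)"
    by measurable
  also have "{\<omega>\<in>space (G k). \<forall>j\<in>{..k}. norm (if j \<le> k then \<Sum>i<j. D i \<omega> else 0) \<le> r} =
     {\<omega>\<in>space M. \<forall>j\<le>k. norm (\<Sum>i<j. D i \<omega>) \<le> r}" by auto
  finally show "{\<omega>\<in>space M. \<forall>j\<le>k. norm (\<Sum>i<j. D i \<omega>) \<le> r} \<in> sets (G k)" .
qed

lemma second_moment_tail:
  fixes T :: "'w \<Rightarrow> 'k::{real_normed_vector, second_countable_topology}"
  assumes [measurable]: "T \<in> borel_measurable M" and "integrable M (\<lambda>\<omega>. (norm (T \<omega>))\<^sup>2)" "0 < \<epsilon>"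
  shows "measure M {\<omega>\<in>space M. \<epsilon> < norm (T \<omega>)} \<le> (\<integral>\<omega>. (norm (T \<omega>))\<^sup>2 \<partial>M) / \<epsilon>\<^sup>2"
proof -
  have "measure M {\<omega>\<in>space M. \<epsilon> < norm (T \<omega>)} \<le> measure M {\<omega>\<in>space M. \<epsilon>\<^sup>2 \<le> (norm (T \<omega>))\<^sup>2}"
    using assms(3) by (intro finite_measure_mono) (auto intro!: power_mono)
  also have "\<dots> \<le> (\<integral>\<omega>. (norm (T \<omega>))\<^sup>2 \<partial>M) / \<epsilon>\<^sup>2"
    using assms by (intro integral_Markov_inequality_measure[where A="space M"]) auto
  finally show ?thesis .
qed

text \<open>The second moment bound is applied to the sequence stopped when it first exceeds \<open>\<epsilon>\<close>.\<close>

lemma mart_diff_maximal_inequality: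
  assumes D: "mart_diff D n" and "0 < \<epsilon>"
  shows "measure M {\<omega>\<in>space M. \<exists>m\<le>n. \<epsilon> < norm (\<Sum>k<m. D k \<omega>)}
    \<le> (\<Sum>k<n. \<integral>\<omega>. (norm (D k \<omega>))\<^sup>2 \<partial>M) / \<epsilon>\<^sup>2"
proof -
  define S where "S m \<omega> = (\<Sum>k<m. D k \<omega>)" for m \<omega>
  define A where "A k = {\<omega>\<in>space M. \<forall>j\<le>k. norm (S j \<omega>) \<le> \<epsilon>}" for k
  define D' where "D' k \<omega> = indicator (A k) \<omega> *\<^sub>R D k \<omega>" for k \<omega>
  have A: "A k \<in> sets (G k)" if "k < n" for k
    unfolding A_def S_def by (rule mart_diff_sum_sets(2)[OF D less_imp_le[OF that]])
  have D': "mart_diff D' n" unfolding D'_def by (rule mart_diff_indicator[OF D A])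
  have T_meas: "(\<lambda>\<omega>. \<Sum>k<n. D' k \<omega>) \<in> borel_measurable M"
    using measurable_G_M[OF mart_diff_sum_measurable[OF D', of n n]] by simp
  have T_S: "(\<Sum>k<m. D' k \<omega>) = S m \<omega>" if "\<omega> \<in> space M" "\<forall>j<m. norm (S j \<omega>) \<le> \<epsilon>" for m \<omega>
    using that unfolding S_def D'_def A_def by (intro sum.cong) (auto simp: S_def)
  have stopped: "\<epsilon> < norm (\<Sum>k<n. D' k \<omega>)"
    if \<omega>: "\<omega> \<in> space M" and ex: "\<exists>m\<le>n. \<epsilon> < norm (S m \<omega>)" for \<omega>
  proof -
    define \<tau> where "\<tau> = (LEAST m. \<epsilon> < norm (S m \<omega>))"
    obtain m where m: "m \<le> n" "\<epsilon> < norm (S m \<omega>)" using ex by blast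
    have \<tau>: "\<epsilon> < norm (S \<tau> \<omega>)" unfolding \<tau>_def by (rule LeastI[of _ m]) (rule m(2))
    have "\<tau> \<le> m" unfolding \<tau>_def by (rule Least_le) (rule m(2))
    then have "\<tau> \<le> n" using m(1) by simp
    have before: "\<forall>j<\<tau>. norm (S j \<omega>) \<le> \<epsilon>"
      using not_less_Least[of _ "\<lambda>m. \<epsilon> < norm (S m \<omega>)"] unfolding \<tau>_def by (meson not_less)
    \<comment> \<open>\<open>A k\<close> requires the bound at \<open>\<tau>\<close> as soon as
      \<open>\<tau> \<le> k\<close>, so from \<open>\<tau>\<close> on all stopped differences vanish
      and the sum stays at its first value beyond \<open>\<epsilon>\<close>.\<close>
    have "(\<Sum>k<n. D' k \<omega>) = (\<Sum>k<\<tau>. D' k \<omega>)"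
    proof (rule sum.mono_neutral_right)
      have "\<omega> \<notin> A k" if "\<tau> \<le> k" for k using \<tau> that unfolding A_def by (auto simp: not_le)
      then show "\<forall>k\<in>{..<n} - {..<\<tau>}. D' k \<omega> = 0" by (simp add: D'_def)
    qed (use \<open>\<tau> \<le> n\<close> in auto)
    then show ?thesis using T_S[OF \<omega> before] \<tau> by simp
  qed
  have "measure M {\<omega>\<in>space M. \<exists>m\<le>n. \<epsilon> < norm (S m \<omega>)}
      \<le> measure M {\<omega>\<in>space M. \<epsilon> < norm (\<Sum>k<n. D' k \<omega>)}"
    using stopped T_meas by (intro finite_measure_mono) auto
  also have "\<dots> \<le> (\<integral>\<omega>. (norm (\<Sum>k<n. D' k \<omega>))\<^sup>2 \<partial>M) / \<epsilon>\<^sup>2"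
    using mart_diff_second_moment[OF D', of n] \<open>0 < \<epsilon>\<close> by (intro second_moment_tail T_meas) auto
  also have "\<dots> = (\<Sum>k<n. \<integral>\<omega>. (norm (D' k \<omega>))\<^sup>2 \<partial>M) / \<epsilon>\<^sup>2"
    using mart_diff_second_moment[OF D', of n] by simp
  also have "\<dots> \<le> (\<Sum>k<n. \<integral>\<omega>. (norm (D k \<omega>))\<^sup>2 \<partial>M) / \<epsilon>\<^sup>2"
    using mart_diffD(3)[OF D] mart_diffD(3)[OF D']
    by (intro divide_right_mono sum_mono integral_mono) (auto simp: D'_def indicator_def)
  finally show ?thesis unfolding S_def .
qed

text \<open>
  Truncating before the accumulated variance exceeds \<open>\<delta>\<close> is adapted, because \<open>q k\<close> is already known
  at time \<open>k\<close>.
\<close>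

lemma mart_diff_lenglart:
  assumes D: "mart_diff D n"
    and q: "\<And>k. k < n \<Longrightarrow> q k \<in> borel_measurable (G k)" "\<And>k \<omega>. k < n \<Longrightarrow> 0 \<le> q k \<omega>"
      "\<And>k. k < n \<Longrightarrow> integrable M (q k)"
    and cond: "\<And>k A. k < n \<Longrightarrow> A \<in> sets (G k) \<Longrightarrow>
      (\<integral>\<omega>. indicator A \<omega> * (norm (D k \<omega>))\<^sup>2 \<partial>M) = (\<integral>\<omega>. indicator A \<omega> * q k \<omega> \<partial>M)"
    and "0 < \<epsilon>" "0 \<le> \<delta>"
  shows "measure M {\<omega>\<in>space M. \<epsilon> < norm (\<Sum>k<n. D k \<omega>)}
    \<le> measure M {\<omega>\<in>space M. \<delta> < (\<Sum>k<n. q k \<omega>)} + \<delta> / \<epsilon>\<^sup>2"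
proof -
  define A where "A k = {\<omega>\<in>space M. (\<Sum>j<Suc k. q j \<omega>) \<le> \<delta>}" for k
  define D' where "D' k \<omega> = indicator (A k) \<omega> *\<^sub>R D k \<omega>" for k \<omega>
  have A: "A k \<in> sets (G k)" if "k < n" for k
  proof -
    have "(\<lambda>\<omega>. \<Sum>j<Suc k. q j \<omega>) \<in> borel_measurable (G k)"
      using that by (intro borel_measurable_sum measurable_G_mono[OF q(1)]) auto
    then have "{\<omega>\<in>space (G k). (\<Sum>j<Suc k. q j \<omega>) \<le> \<delta>} \<in> sets (G k)" by measurable
    then show ?thesis by (simp add: A_def)
  qed
  have D': "mart_diff D' n" unfolding D'_def by (rule mart_diff_indicator[OF D A])
  have meas: "(\<lambda>\<omega>. \<Sum>k<n. D' k \<omega>) \<in> borel_measurable M" "(\<lambda>\<omega>. \<Sum>k<n. D k \<omega>) \<in> borel_measurable M"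
    using measurable_G_M[OF mart_diff_sum_measurable[OF D', of n n]]
      measurable_G_M[OF mart_diff_sum_measurable[OF D, of n n]] by auto
  have measq: "(\<lambda>\<omega>. \<Sum>k<n. q k \<omega>) \<in> borel_measurable M"
    by (intro borel_measurable_sum measurable_G_M[OF q(1)]) auto
  note [measurable] = meas measq
  have untouched: "(\<Sum>k<n. D' k \<omega>) = (\<Sum>k<n. D k \<omega>)" if "\<omega> \<in> space M" "(\<Sum>k<n. q k \<omega>) \<le> \<delta>" for \<omega>
  proof (intro sum.cong refl)
    fix k assume "k \<in> {..<n}"
    then have "(\<Sum>j<Suc k. q j \<omega>) \<le> (\<Sum>k<n. q k \<omega>)" using q(2) by (intro sum_mono2) auto
    then show "D' k \<omega> = D k \<omega>" using that by (simp add: D'_def A_def)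
  qed
  \<comment> \<open>If \<open>\<omega>\<close> lies in \<open>A m\<close>, the untruncated sum up to
    and including \<open>m\<close> is already at most \<open>\<delta>\<close>; otherwise the last
    term is zero and the induction hypothesis applies.\<close>
  have bound: "(\<Sum>k<m. indicator (A k) \<omega> * q k \<omega>) \<le> \<delta>" if "m \<le> n" for m \<omega>
    using that
  proof (induction m)
    case (Suc m)
    show ?case
    proof (cases "\<omega> \<in> A m")
      case True
      have "(\<Sum>k<Suc m. indicator (A k) \<omega> * q k \<omega>) \<le> (\<Sum>k<Suc m. q k \<omega>)"
        using q(2) Suc.prems by (intro sum_mono) (auto simp: indicator_def)
      also have "\<dots> \<le> \<delta>" using True by (simp add: A_def)
      finally show ?thesis .
    qed (use Suc in auto)
  qed (use \<open>0 \<le> \<delta>\<close> in simp)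
  have int: "integrable M (\<lambda>\<omega>. indicator (A k) \<omega> * q k \<omega>)" if "k < n" for k
    using integrable_mult_indicator[OF sets_G_M[OF A[OF that]] q(3)[OF that]] by simp
  have norm_D': "(norm (D' k \<omega>))\<^sup>2 = indicator (A k) \<omega> * (norm (D k \<omega>))\<^sup>2" for k \<omega>
    by (simp add: D'_def indicator_def)
  have "(\<integral>\<omega>. (norm (\<Sum>k<n. D' k \<omega>))\<^sup>2 \<partial>M) = (\<Sum>k<n. \<integral>\<omega>. indicator (A k) \<omega> * q k \<omega> \<partial>M)"
    using mart_diff_second_moment[OF D', of n] cond A by (simp add: norm_D')
  also have "\<dots> = (\<integral>\<omega>. (\<Sum>k<n. indicator (A k) \<omega> * q k \<omega>) \<partial>M)"
    using int by (intro Bochner_Integration.integral_sum[symmetric]) auto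
  also have "\<dots> \<le> (\<integral>\<omega>. \<delta> \<partial>M)"
    using bound int by (intro integral_mono Bochner_Integration.integrable_sum) auto
  finally have second: "(\<integral>\<omega>. (norm (\<Sum>k<n. D' k \<omega>))\<^sup>2 \<partial>M) \<le> \<delta>" by (simp add: prob_space)
  have "measure M {\<omega>\<in>space M. \<epsilon> < norm (\<Sum>k<n. D k \<omega>)}
    \<le> measure M ({\<omega>\<in>space M. \<delta> < (\<Sum>k<n. q k \<omega>)} \<union> {\<omega>\<in>space M. \<epsilon> < norm (\<Sum>k<n. D' k \<omega>)})"
    using untouched by (intro finite_measure_mono) (auto simp: not_less[symmetric] intro: ccontr)
  also have "\<dots> \<le> measure M {\<omega>\<in>space M. \<delta> < (\<Sum>k<n. q k \<omega>)} + measure M {\<omega>\<in>space M. \<epsilon> < norm (\<Sum>k<n. D' k \<omega>)}"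
    by (intro measure_Un_le) measurable
  also have "measure M {\<omega>\<in>space M. \<epsilon> < norm (\<Sum>k<n. D' k \<omega>)} \<le> (\<integral>\<omega>. (norm (\<Sum>k<n. D' k \<omega>))\<^sup>2 \<partial>M) / \<epsilon>\<^sup>2"
    using mart_diff_second_moment[OF D', of n] \<open>0 < \<epsilon>\<close> by (intro second_moment_tail meas) auto
  also have "\<dots> \<le> \<delta> / \<epsilon>\<^sup>2" using second by (intro divide_right_mono) auto
  finally show ?thesis by simp
qed

text \<open>
  Restarting when the sequence first exceeds \<open>r\<close>: if no jump exceeds \<open>\<eta>\<close>, then going beyond
  \<open>r + \<eta> + s\<close> takes a further displacement \<open>s\<close>, and the conditional variance is deterministic.
\<close>

lemma mart_diff_tail:
  assumes D: "mart_diff D n"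
    and cond: "\<And>k A. k < n \<Longrightarrow> A \<in> sets (G k) \<Longrightarrow>
      (\<integral>\<omega>. indicator A \<omega> * (norm (D k \<omega>))\<^sup>2 \<partial>M) = v k * measure M A"
    and v: "\<And>k. k < n \<Longrightarrow> 0 \<le> v k"
    and "0 \<le> r" "0 \<le> \<eta>" "0 < s"
  shows "measure M {\<omega>\<in>space M. \<exists>m\<le>n. r + \<eta> + s < norm (\<Sum>k<m. D k \<omega>)}
    \<le> (\<Sum>k<n. v k) / s\<^sup>2 * measure M {\<omega>\<in>space M. \<exists>m\<le>n. r < norm (\<Sum>k<m. D k \<omega>)}
      + measure M {\<omega>\<in>space M. \<exists>k<n. \<eta> < norm (D k \<omega>)}"
proof -
  define S where "S m \<omega> = (\<Sum>k<m. D k \<omega>)" for m \<omega>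
  define B where "B k = {\<omega>\<in>space M. \<exists>j\<le>k. r < norm (S j \<omega>)}" for k
  define D' where "D' k \<omega> = indicator (B k) \<omega> *\<^sub>R D k \<omega>" for k \<omega>
  define J where "J = {\<omega>\<in>space M. \<exists>k<n. \<eta> < norm (D k \<omega>)}"
  define K where "K = {\<omega>\<in>space M. \<exists>m\<le>n. s < norm (\<Sum>k<m. D' k \<omega>)}"
  have B: "B k \<in> sets (G k)" if "k \<le> n" for k
    unfolding B_def S_def by (rule mart_diff_sum_sets(1)[OF D that])
  have D': "mart_diff D' n" unfolding D'_def by (rule mart_diff_indicator[OF D B]) auto
  have K: "K \<in> sets M" unfolding K_def by (rule sets_G_M[OF mart_diff_sum_sets(1)[OF D' order_refl]])
  have J: "J \<in> sets M"
  proof -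
    have [measurable]: "(\<lambda>\<omega>. if k < n then D k \<omega> else 0) \<in> borel_measurable M" for k
      using mart_diffD(2)[OF D, of k] by (cases "k < n") auto
    have "{\<omega>\<in>space M. \<exists>k\<in>{..<n}. \<eta> < norm (if k < n then D k \<omega> else 0)} \<in> sets M" by measurable
    also have "{\<omega>\<in>space M. \<exists>k\<in>{..<n}. \<eta> < norm (if k < n then D k \<omega> else 0)} = J"
      by (auto simp: J_def)
    finally show ?thesis .
  qed
  have incl: "\<omega> \<in> K" if \<omega>: "\<omega> \<in> space M" "\<omega> \<notin> J" and m: "m \<le> n" "r + \<eta> + s < norm (S m \<omega>)" for \<omega> m
  proof -
    define \<tau> where "\<tau> = (LEAST j. r < norm (S j \<omega>))"
    have m': "r < norm (S m \<omega>)" using m(2) \<open>0 \<le> \<eta>\<close> \<open>0 < s\<close> by simp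
    then have \<tau>: "r < norm (S \<tau> \<omega>)" "\<tau> \<le> m" unfolding \<tau>_def by (auto intro: LeastI Least_le)
    have before: "norm (S j \<omega>) \<le> r" if "j < \<tau>" for j
      using not_less_Least[of j "\<lambda>j. r < norm (S j \<omega>)"] that by (simp add: \<tau>_def not_less)
    \<comment> \<open>The empty sum is 0, hence not beyond \<open>r\<close>; so the crossing at
      \<open>\<tau>\<close> is made by one difference, which is at most \<open>\<eta>\<close>
      outside \<open>J\<close>.\<close>
    have "\<tau> \<noteq> 0"
    proof
      assume "\<tau> = 0"
      then show False using \<tau>(1) \<open>0 \<le> r\<close> by (simp add: S_def)
    qed
    then obtain p where p: "\<tau> = Suc p" using not0_implies_Suc by blast
    have "norm (D p \<omega>) \<le> \<eta>" using \<omega> p \<tau>(2) m(1) by (force simp: J_def not_less[symmetric])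
    moreover have "norm (S \<tau> \<omega>) \<le> norm (S p \<omega>) + norm (D p \<omega>)"
      unfolding p S_def by (simp add: norm_triangle_ineq)
    ultimately have S\<tau>: "norm (S \<tau> \<omega>) \<le> r + \<eta>" using before[of p] p by simp
    have mem_B: "\<omega> \<in> B k \<longleftrightarrow> \<tau> \<le> k" for k
      using \<omega>(1) \<tau>(1) before by (force simp: B_def not_less[symmetric])
    have "(\<Sum>k<m. D' k \<omega>) = (\<Sum>k\<in>{\<tau>..<m}. D' k \<omega>)"
      by (rule sum.mono_neutral_right) (auto simp: D'_def mem_B)
    also have "\<dots> = (\<Sum>k\<in>{\<tau>..<m}. D k \<omega>)"
      by (intro sum.cong) (auto simp: D'_def mem_B)
    also have "\<dots> = S m \<omega> - S \<tau> \<omega>"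
      using sum_diff_nat_ivl[of 0 \<tau> m "\<lambda>k. D k \<omega>"] \<tau>(2) by (simp add: S_def lessThan_atLeast0)
    finally have "norm (S m \<omega>) \<le> norm (\<Sum>k<m. D' k \<omega>) + norm (S \<tau> \<omega>)"
      using norm_triangle_sub[of "S m \<omega>" "S \<tau> \<omega>"] by simp
    then have "s < norm (\<Sum>k<m. D' k \<omega>)" using S\<tau> m(2) by simp
    then show ?thesis using \<omega>(1) m(1) by (auto simp: K_def)
  qed
  have norm_D': "(norm (D' k \<omega>))\<^sup>2 = indicator (B k) \<omega> * (norm (D k \<omega>))\<^sup>2" for k \<omega>
    by (simp add: D'_def indicator_def)
  have B_mono: "B k \<subseteq> B n" if "k < n" for k
    unfolding B_def by (intro Collect_mono) (meson that less_imp_le order_trans)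
  have "measure M {\<omega>\<in>space M. \<exists>m\<le>n. r + \<eta> + s < norm (S m \<omega>)} \<le> measure M (K \<union> J)"
    using incl K J by (intro finite_measure_mono) auto
  also have "\<dots> \<le> measure M K + measure M J"
    by (intro measure_Un_le K J)
  also have "measure M K \<le> (\<Sum>k<n. \<integral>\<omega>. (norm (D' k \<omega>))\<^sup>2 \<partial>M) / s\<^sup>2"
    unfolding K_def by (rule mart_diff_maximal_inequality[OF D' \<open>0 < s\<close>])
  \<comment> \<open>The conditional variance is the constant \<open>v k\<close>, so restricting
    \<open>D k\<close> to \<open>B k\<close> multiplies its second moment by the probability of
    \<open>B k\<close>. This keeps the probability of the first crossing as a factor.\<close>
  also have "\<dots> = (\<Sum>k<n. v k * measure M (B k)) / s\<^sup>2"
    using cond B by (simp add: norm_D')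
  also have "\<dots> \<le> (\<Sum>k<n. v k * measure M (B n)) / s\<^sup>2"
  proof (intro divide_right_mono sum_mono mult_left_mono finite_measure_mono)
    show "B n \<in> sets M" using B[of n] sets_G_M by auto
  qed (use v B_mono in auto)
  also have "\<dots> = (\<Sum>k<n. v k) / s\<^sup>2 * measure M (B n)"
    by (simp add: sum_distrib_right)
  finally show ?thesis by (simp add: S_def B_def J_def)
qed

end

section \<open>Increments of Brownian motion\<close>

context filtered_prob_space
begin

lemma space_F: "t0 \<le> t \<Longrightarrow> space (F t) = space M"
  using subalg[of t] by (simp add: subalgebra_def)

lemma measurable_F_M: "f \<in> measurable (F t) N \<Longrightarrow> t0 \<le> t \<Longrightarrow> f \<in> measurable M N"
  using measurable_from_subalg[OF subalg] by auto

lemma measurable_F_mono: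
  "f \<in> measurable (F s) N \<Longrightarrow> t0 \<le> s \<Longrightarrow> s \<le> t \<Longrightarrow> f \<in> measurable (F t) N"
  using filtration_mono[of s t] space_F[of s] space_F[of t] by (auto simp: measurable_def)

end

context brownian_motion
begin

abbreviation incr :: "real \<Rightarrow> real \<Rightarrow> 'u \<Rightarrow> 'w \<Rightarrow> real" where
  "incr s t h \<omega> \<equiv> W t h \<omega> - W s h \<omega>"

lemma incr_measurable:
  assumes "t0 \<le> s" "s \<le> t"
  shows "incr s t h \<in> borel_measurable (F t)" "incr s t h \<in> borel_measurable M"
proof -
  show *: "incr s t h \<in> borel_measurable (F t)"
    using assms W_adapted[of t h] measurable_F_mono[OF W_adapted[of s h]] by auto
  show "incr s t h \<in> borel_measurable M"
    using measurable_F_M[OF *] assms by simp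
qed

lemma incr_zero: "t0 \<le> s \<Longrightarrow> s \<le> t \<Longrightarrow> AE \<omega> in M. incr s t 0 \<omega> = 0"
  using W_scale[of t 0 0] W_scale[of s 0 0] by auto

lemma incr_moments:
  assumes "t0 \<le> s" "s \<le> t"
  shows "integrable M (incr s t h)" "(\<integral>\<omega>. incr s t h \<omega> \<partial>M) = 0"
    "integrable M (\<lambda>\<omega>. (incr s t h \<omega>)\<^sup>2)" "(\<integral>\<omega>. (incr s t h \<omega>)\<^sup>2 \<partial>M) = (t - s) * (norm h)\<^sup>2"
proof -
  have "integrable M (incr s t h) \<and> (\<integral>\<omega>. incr s t h \<omega> \<partial>M) = 0 \<and>
    integrable M (\<lambda>\<omega>. (incr s t h \<omega>)\<^sup>2) \<and> (\<integral>\<omega>. (incr s t h \<omega>)\<^sup>2 \<partial>M) = (t - s) * (norm h)\<^sup>2"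
  \<comment> \<open>A normal density has positive variance, so \<open>W_normal\<close> leaves out
    these cases; here the increment vanishes almost surely.\<close>
  proof (cases "s = t \<or> h = 0")
    case True
    then have AE: "AE \<omega> in M. incr s t h \<omega> = 0" using incr_zero[OF assms] by auto
    have "integrable M (incr s t h) \<longleftrightarrow> integrable M (\<lambda>_. 0::real)"
      using AE incr_measurable[OF assms] by (intro integrable_cong_AE) auto
    moreover have "integrable M (\<lambda>\<omega>. (incr s t h \<omega>)\<^sup>2) \<longleftrightarrow> integrable M (\<lambda>_. 0::real)"
      using AE incr_measurable[OF assms] by (intro integrable_cong_AE) auto
    moreover have "(\<integral>\<omega>. incr s t h \<omega> \<partial>M) = 0" "(\<integral>\<omega>. (incr s t h \<omega>)\<^sup>2 \<partial>M) = 0"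
      using AE by (auto intro!: integral_eq_zero_AE)
    ultimately show ?thesis using True by auto
  next
    case False
    let ?\<sigma> = "sqrt (t - s) * norm h"
    have \<sigma>: "0 < ?\<sigma>" using False assms by simp
    have D: "distributed M lborel (incr s t h) (normal_density 0 ?\<sigma>)"
      using W_normal[of s t h] False assms by simp
    have 1: "integrable M (incr s t h)"
      using distributed_integrable[OF D, of "\<lambda>x. x"] integrable_normal_moment[OF \<sigma>, of 0 1] by simp
    have 2: "integrable M (\<lambda>\<omega>. (incr s t h \<omega>)\<^sup>2)"
      using distributed_integrable[OF D, of "\<lambda>x. x\<^sup>2"] integrable_normal_moment[OF \<sigma>, of 0 2] by simp
    have 3: "(\<integral>\<omega>. incr s t h \<omega> \<partial>M) = 0"
      by (rule normal_distributed_expectation[OF \<sigma> D])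
    have "(\<integral>\<omega>. (incr s t h \<omega>)\<^sup>2 \<partial>M) = ?\<sigma>\<^sup>2"
      using normal_distributed_variance[OF \<sigma> D] 3 by simp
    then show ?thesis using 1 2 3 assms by (simp add: power_mult_distrib)
  qed
  then show "integrable M (incr s t h)" "(\<integral>\<omega>. incr s t h \<omega> \<partial>M) = 0"
    "integrable M (\<lambda>\<omega>. (incr s t h \<omega>)\<^sup>2)" "(\<integral>\<omega>. (incr s t h \<omega>)\<^sup>2 \<partial>M) = (t - s) * (norm h)\<^sup>2"
    by auto
qed

lemma incr_indep_var:
  assumes "t0 \<le> s" "s < t" and Z: "Z \<in> borel_measurable (F s)"
  shows "indep_var borel Z borel (incr s t h)"
proof -
  let ?E = "{incr s t h -` A \<inter> space M |A. A \<in> sets borel}"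
  note ind = W_indep[OF assms(1,2), of h]
  have "sigma_sets (space M) {Z -` A \<inter> space M |A. A \<in> sets borel} \<subseteq> sets (F s)"
  proof -
    have "{Z -` A \<inter> space M |A. A \<in> sets borel} \<subseteq> sets (F s)"
      using measurable_sets[OF Z] space_F[OF assms(1)] by auto
    then show ?thesis
      using sets.sigma_sets_subset[of "{Z -` A \<inter> space M |A. A \<in> sets borel}" "F s"]
      unfolding space_F[OF assms(1)] by blast
  qed
  \<comment> \<open>Preimages of Borel sets already form a sigma-algebra, so generating one adds
    nothing; this matches the event family of \<open>W_indep\<close> with the one behind
    \<open>indep_var\<close>.\<close>
  moreover have "sigma_sets (space M) ?E = ?E"
    using sigma_sets_vimage_commute[of "incr s t h" "space M" UNIV "sets borel"]
      sets.sigma_sets_eq[of "borel :: real measure"] by simp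
  ultimately have sub: "sigma_sets (space M) {Z -` A \<inter> space M |A. A \<in> sets borel} \<subseteq> sets (F s)"
    "sigma_sets (space M) ?E = ?E" by blast+
  have "indep_set (sigma_sets (space M) {Z -` A \<inter> space M |A. A \<in> sets borel}) (sigma_sets (space M) ?E)"
    unfolding sub(2)
  proof (rule indep_setI)
    show "?E \<subseteq> events" by (rule indep_setD_ev2[OF ind])
    show "sigma_sets (space M) {Z -` A \<inter> space M |A. A \<in> sets borel} \<subseteq> events"
      by (rule order_trans[OF sub(1) indep_setD_ev1[OF ind]])
    show "prob (a \<inter> b) = prob a * prob b"
      if "a \<in> sigma_sets (space M) {Z -` A \<inter> space M |A. A \<in> sets borel}" "b \<in> ?E" for a b
      by (rule indep_setD[OF ind set_mp[OF sub(1) that(1)] that(2)])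
  qed
  moreover have "Z \<in> borel_measurable M" using measurable_F_M[OF Z assms(1)] .
  moreover have "incr s t h \<in> borel_measurable M" using incr_measurable(2)[of s t h] assms by simp
  ultimately show ?thesis unfolding indep_var_eq by simp
qed

text \<open>\<open>Z\<close> is independent of the increment, so expectations factor. With
  \<open>Z\<close> carrying the indicator of an event in \<open>F s\<close>, these are the
  conditional moments of the increment given \<open>F s\<close>.\<close>

lemma incr_mult_moments:
  assumes "t0 \<le> s" "s \<le> t" and Z: "Z \<in> borel_measurable (F s)" "integrable M Z"
  shows "integrable M (\<lambda>\<omega>. Z \<omega> * incr s t h \<omega>)" "(\<integral>\<omega>. Z \<omega> * incr s t h \<omega> \<partial>M) = 0"
    "integrable M (\<lambda>\<omega>. Z \<omega> * (incr s t h \<omega>)\<^sup>2)"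
    "(\<integral>\<omega>. Z \<omega> * (incr s t h \<omega>)\<^sup>2 \<partial>M) = (t - s) * (norm h)\<^sup>2 * (\<integral>\<omega>. Z \<omega> \<partial>M)"
proof -
  have "integrable M (\<lambda>\<omega>. Z \<omega> * incr s t h \<omega>) \<and> (\<integral>\<omega>. Z \<omega> * incr s t h \<omega> \<partial>M) = 0 \<and>
    integrable M (\<lambda>\<omega>. Z \<omega> * (incr s t h \<omega>)\<^sup>2) \<and>
    (\<integral>\<omega>. Z \<omega> * (incr s t h \<omega>)\<^sup>2 \<partial>M) = (t - s) * (norm h)\<^sup>2 * (\<integral>\<omega>. Z \<omega> \<partial>M)"
  proof (cases "s = t")
    case False
    then have "s < t" using assms by simp
    note I1 = incr_indep_var[OF assms(1) this Z(1), of h]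
    have I2: "indep_var borel Z borel (\<lambda>\<omega>. (incr s t h \<omega>)\<^sup>2)"
      using indep_var_compose[OF I1, of "\<lambda>x. x" borel "\<lambda>x. x\<^sup>2" borel] by (simp add: comp_def)
    note m = incr_moments[OF assms(1,2), of h]
    show ?thesis
      using indep_var_integrable[OF I1 Z(2) m(1)] indep_var_integrable[OF I2 Z(2) m(3)]
        indep_var_lebesgue_integral[OF I1 Z(2) m(1)] indep_var_lebesgue_integral[OF I2 Z(2) m(3)] m(2,4)
      by simp
  qed simp
  then show "integrable M (\<lambda>\<omega>. Z \<omega> * incr s t h \<omega>)" "(\<integral>\<omega>. Z \<omega> * incr s t h \<omega> \<partial>M) = 0"
    "integrable M (\<lambda>\<omega>. Z \<omega> * (incr s t h \<omega>)\<^sup>2)"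
    "(\<integral>\<omega>. Z \<omega> * (incr s t h \<omega>)\<^sup>2 \<partial>M) = (t - s) * (norm h)\<^sup>2 * (\<integral>\<omega>. Z \<omega> \<partial>M)"
    by auto
qed

lemma incr_add: "t0 \<le> s \<Longrightarrow> s \<le> t \<Longrightarrow> AE \<omega> in M. incr s t (h + k) \<omega> = incr s t h \<omega> + incr s t k \<omega>"
  using W_add[of t h k] W_add[of s h k] by auto

lemma incr_diff: "t0 \<le> s \<Longrightarrow> s \<le> t \<Longrightarrow> AE \<omega> in M. incr s t (h - k) \<omega> = incr s t h \<omega> - incr s t k \<omega>"
  using incr_add[of s t "h - k" k] by auto

text \<open>Polarization, since independence of \<open>F s\<close> is only known for one direction at a time.\<close>

lemma incr_mult_covariance:
  assumes "t0 \<le> s" "s \<le> t" and Z: "Z \<in> borel_measurable (F s)" "integrable M Z"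
  shows "integrable M (\<lambda>\<omega>. Z \<omega> * (incr s t h \<omega> * incr s t k \<omega>))"
    "(\<integral>\<omega>. Z \<omega> * (incr s t h \<omega> * incr s t k \<omega>) \<partial>M) = (t - s) * (h \<bullet> k) * (\<integral>\<omega>. Z \<omega> \<partial>M)"
proof -
  let ?R = "\<lambda>\<omega>. (Z \<omega> * (incr s t (h + k) \<omega>)\<^sup>2 - Z \<omega> * (incr s t (h - k) \<omega>)\<^sup>2) / 4"
  have [measurable]: "Z \<in> borel_measurable M" using measurable_F_M[OF Z(1) assms(1)] .
  note [measurable] = incr_measurable(2)[OF assms(1,2)]
  note m = incr_mult_moments[OF assms]
  have R: "integrable M ?R" by (intro integrable_divide Bochner_Integration.integrable_diff m(3))
  have AE: "AE \<omega> in M. Z \<omega> * (incr s t h \<omega> * incr s t k \<omega>) = ?R \<omega>"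
    using incr_add[OF assms(1,2), of h k] incr_diff[OF assms(1,2), of h k]
  proof eventually_elim
    case (elim \<omega>)
    show ?case unfolding elim by (simp add: power2_eq_square algebra_simps)
  qed
  show "integrable M (\<lambda>\<omega>. Z \<omega> * (incr s t h \<omega> * incr s t k \<omega>))"
    by (subst integrable_cong_AE[OF _ _ AE]) (use R in measurable)
  have "(\<integral>\<omega>. Z \<omega> * (incr s t h \<omega> * incr s t k \<omega>) \<partial>M) = (\<integral>\<omega>. ?R \<omega> \<partial>M)"
    by (intro integral_cong_AE AE) measurable
  also have "\<dots> = ((t - s) * (norm (h + k))\<^sup>2 * (\<integral>\<omega>. Z \<omega> \<partial>M) - (t - s) * (norm (h - k))\<^sup>2 * (\<integral>\<omega>. Z \<omega> \<partial>M)) / 4"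
    by (simp only: integral_divide_zero Bochner_Integration.integral_diff[OF m(3) m(3)] m(4))
  also have "\<dots> = (t - s) * (((norm (h + k))\<^sup>2 - (norm (h - k))\<^sup>2) / 4) * (\<integral>\<omega>. Z \<omega> \<partial>M)"
    by (simp add: algebra_simps)
  also have "((norm (h + k))\<^sup>2 - (norm (h - k))\<^sup>2) / 4 = h \<bullet> k"
    by (simp add: power2_norm_eq_inner inner_add_left inner_diff_left inner_add_right inner_diff_right inner_commute)
  finally show "(\<integral>\<omega>. Z \<omega> * (incr s t h \<omega> * incr s t k \<omega>) \<partial>M) = (t - s) * (h \<bullet> k) * (\<integral>\<omega>. Z \<omega> \<partial>M)" .
qed

section \<open>One time step of an elementary integral\<close>

definition block_sum :: "'i set \<Rightarrow> ('i \<Rightarrow> 'w \<Rightarrow> real) \<Rightarrow> ('i \<Rightarrow> 'u) \<Rightarrow> ('i \<Rightarrow> 'k) \<Rightarrow> real \<Rightarrow> real \<Rightarrow> 'w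
    \<Rightarrow> 'k::{real_inner, banach, second_countable_topology}" where
  "block_sum I c h y s t \<omega> = (\<Sum>i\<in>I. (c i \<omega> * incr s t (h i) \<omega>) *\<^sub>R y i)"

text \<open>By \<open>hs_norm_finite_rank\<close>, this is the squared Hilbert-Schmidt norm of the
  finite-rank operator with coefficients \<open>c i \<omega>\<close>.\<close>

definition block_variance :: "'i set \<Rightarrow> ('i \<Rightarrow> 'w \<Rightarrow> real) \<Rightarrow> ('i \<Rightarrow> 'u) \<Rightarrow>
    ('i \<Rightarrow> 'k::{real_inner, banach, second_countable_topology}) \<Rightarrow> 'w \<Rightarrow> real" where
  "block_variance I c h y \<omega> = (\<Sum>i\<in>I. \<Sum>j\<in>I. c i \<omega> * c j \<omega> * (h i \<bullet> h j) * (y i \<bullet> y j))"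

context
  fixes I :: "'i set" and c :: "'i \<Rightarrow> 'w \<Rightarrow> real" and h :: "'i \<Rightarrow> 'u"
    and y :: "'i \<Rightarrow> 'k::{real_inner, banach, second_countable_topology}" and s t C :: real
  assumes I: "finite I" and st: "t0 \<le> s" "s \<le> t"
    and c: "\<And>i. i \<in> I \<Longrightarrow> c i \<in> borel_measurable (F s)"
    and C: "\<And>i \<omega>. i \<in> I \<Longrightarrow> \<omega> \<in> space M \<Longrightarrow> \<bar>c i \<omega>\<bar> \<le> C"
begin

lemma block_sum_measurable: "block_sum I c h y s t \<in> borel_measurable (F t)"
  unfolding block_sum_def
  using measurable_F_mono[OF c st] incr_measurable(1)[OF st]
  by (intro borel_measurable_sum borel_measurable_scaleR borel_measurable_times) auto

lemma block_variance_measurable: "block_variance I c h y \<in> borel_measurable (F s)"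
  unfolding block_variance_def
  using c by (intro borel_measurable_sum borel_measurable_times) auto

lemma coefficient_product_integrable:
  assumes "i \<in> I" "j \<in> I" "A \<in> sets (F s)"
  shows "(\<lambda>\<omega>. indicator A \<omega> * c i \<omega> * c j \<omega>) \<in> borel_measurable (F s)"
    "integrable M (\<lambda>\<omega>. indicator A \<omega> * c i \<omega> * c j \<omega>)"
proof -
  show *: "(\<lambda>\<omega>. indicator A \<omega> * c i \<omega> * c j \<omega>) \<in> borel_measurable (F s)"
    using assms c by (intro borel_measurable_times) auto
  show "integrable M (\<lambda>\<omega>. indicator A \<omega> * c i \<omega> * c j \<omega>)"
  proof (rule integrable_const_bound[of _ "C * C"])
    show "AE \<omega> in M. norm (indicator A \<omega> * c i \<omega> * c j \<omega>) \<le> C * C"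
    proof (intro AE_I2)
      fix \<omega> assume "\<omega> \<in> space M"
      then have "\<bar>c i \<omega>\<bar> * \<bar>c j \<omega>\<bar> \<le> C * C" using C[of i \<omega>] C[of j \<omega>] assms by (intro mult_mono) auto
      moreover from this have "0 \<le> C * C" by (meson abs_ge_zero mult_nonneg_nonneg order_trans)
      ultimately show "norm (indicator A \<omega> * c i \<omega> * c j \<omega>) \<le> C * C"
        by (simp add: indicator_def abs_mult)
    qed
  qed (use measurable_F_M[OF * st(1)] in auto)
qed

lemma block_variance_integrable: "integrable M (block_variance I c h y)"
  unfolding block_variance_def
proof (intro Bochner_Integration.integrable_sum)
  fix i j assume "i \<in> I" "j \<in> I"
  then have "integrable M (\<lambda>\<omega>. indicator (space (F s)) \<omega> * c i \<omega> * c j \<omega>)"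
    by (intro coefficient_product_integrable) auto
  moreover have "integrable M (\<lambda>\<omega>. indicator (space (F s)) \<omega> * c i \<omega> * c j \<omega>) \<longleftrightarrow>
      integrable M (\<lambda>\<omega>. c i \<omega> * c j \<omega>)"
    by (intro Bochner_Integration.integrable_cong) (auto simp: space_F[OF st(1)])
  ultimately have "integrable M (\<lambda>\<omega>. c i \<omega> * c j \<omega>)" by simp
  then show "integrable M (\<lambda>\<omega>. c i \<omega> * c j \<omega> * (h i \<bullet> h j) * (y i \<bullet> y j))"
    by simp
qed

lemma norm_block_sum_square:
  "(norm (block_sum I c h y s t \<omega>))\<^sup>2 =
     (\<Sum>i\<in>I. \<Sum>j\<in>I. (c i \<omega> * c j \<omega> * (incr s t (h i) \<omega> * incr s t (h j) \<omega>)) * (y i \<bullet> y j))"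
  unfolding power2_norm_eq_inner block_sum_def inner_sum_left inner_sum_right
  by (subst sum.swap, intro sum.cong refl) (simp add: algebra_simps inner_commute)

text \<open>The covariance identity is applied, for each pair of terms, to the scalar
  \<open>indicator A \<omega> * c i \<omega> * c j \<omega>\<close>, which is known at time
  \<open>s\<close>. Since \<open>A\<close> is an arbitrary event of \<open>F s\<close>, this is the
  conditional form of the isometry over one time step.\<close>

lemma block_sum_second_moment:
  assumes "A \<in> sets (F s)"
  shows "integrable M (\<lambda>\<omega>. indicator A \<omega> * (norm (block_sum I c h y s t \<omega>))\<^sup>2)"
    "(\<integral>\<omega>. indicator A \<omega> * (norm (block_sum I c h y s t \<omega>))\<^sup>2 \<partial>M) =
       (\<integral>\<omega>. indicator A \<omega> * ((t - s) * block_variance I c h y \<omega>) \<partial>M)"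
proof -
  have eq: "indicator A \<omega> * (norm (block_sum I c h y s t \<omega>))\<^sup>2 =
     (\<Sum>i\<in>I. \<Sum>j\<in>I. ((indicator A \<omega> * c i \<omega> * c j \<omega>) * (incr s t (h i) \<omega> * incr s t (h j) \<omega>)) * (y i \<bullet> y j))" for \<omega>
    unfolding norm_block_sum_square by (simp add: sum_distrib_left mult.assoc)
  have eq': "indicator A \<omega> * ((t - s) * block_variance I c h y \<omega>) =
     (\<Sum>i\<in>I. \<Sum>j\<in>I. (t - s) * (h i \<bullet> h j) * (indicator A \<omega> * c i \<omega> * c j \<omega>) * (y i \<bullet> y j))" for \<omega>
    unfolding block_variance_def by (simp add: sum_distrib_left mult_ac)
  note m = incr_mult_covariance[OF st coefficient_product_integrable[OF _ _ assms]]
  note n = coefficient_product_integrable(2)[OF _ _ assms]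
  show "integrable M (\<lambda>\<omega>. indicator A \<omega> * (norm (block_sum I c h y s t \<omega>))\<^sup>2)"
    unfolding eq by (intro Bochner_Integration.integrable_sum integrable_mult_left m(1))
  show "(\<integral>\<omega>. indicator A \<omega> * (norm (block_sum I c h y s t \<omega>))\<^sup>2 \<partial>M) =
       (\<integral>\<omega>. indicator A \<omega> * ((t - s) * block_variance I c h y \<omega>) \<partial>M)"
    unfolding eq eq' using m n by (simp add: Bochner_Integration.integral_sum)
qed

text \<open>Moving \<open>U\<close> inside the sum leaves the scalars
  \<open>c i \<omega> * (U \<omega> \<bullet> y i)\<close>, known at time \<open>s\<close>, each
  multiplied by an increment of mean zero.\<close>

lemma block_sum_orthogonal:
  assumes U: "U \<in> borel_measurable (F s)" "integrable M (\<lambda>\<omega>. (norm (U \<omega>))\<^sup>2)"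
  shows "(\<integral>\<omega>. U \<omega> \<bullet> block_sum I c h y s t \<omega> \<partial>M) = 0"
proof -
  have eq: "U \<omega> \<bullet> block_sum I c h y s t \<omega> = (\<Sum>i\<in>I. (c i \<omega> * (U \<omega> \<bullet> y i)) * incr s t (h i) \<omega>)" for \<omega>
    unfolding block_sum_def inner_sum_right inner_scaleR_right by (intro sum.cong refl) (simp only: mult_ac)
  have meas: "(\<lambda>\<omega>. c i \<omega> * (U \<omega> \<bullet> y i)) \<in> borel_measurable (F s)" if "i \<in> I" for i
    using c[OF that] U(1) by (intro borel_measurable_times borel_measurable_inner) auto
  have int: "integrable M (\<lambda>\<omega>. c i \<omega> * (U \<omega> \<bullet> y i))" if "i \<in> I" for i
  proof (rule Bochner_Integration.integrable_bound)
    show "integrable M (\<lambda>\<omega>. \<bar>C\<bar> * (norm (y i) * ((norm (U \<omega>))\<^sup>2 + 1)))" using U(2) by simp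
    show "AE \<omega> in M. norm (c i \<omega> * (U \<omega> \<bullet> y i)) \<le> norm (\<bar>C\<bar> * (norm (y i) * ((norm (U \<omega>))\<^sup>2 + 1)))"
    proof (intro AE_I2)
      fix \<omega> assume "\<omega> \<in> space M"
      then have c: "\<bar>c i \<omega>\<bar> \<le> \<bar>C\<bar>" using C[OF that, of \<omega>] by simp
      \<comment> \<open>Reduces integrability of the norm to that of its square.\<close>
      have U: "norm (U \<omega>) \<le> (norm (U \<omega>))\<^sup>2 + 1"
        using sum_squares_bound[of "norm (U \<omega>)" 1] norm_ge_zero[of "U \<omega>"] unfolding power_one mult_1_right
        by linarith
      have "\<bar>U \<omega> \<bullet> y i\<bar> \<le> norm (U \<omega>) * norm (y i)" by (rule Cauchy_Schwarz_ineq2)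
      also note U
      finally have "\<bar>U \<omega> \<bullet> y i\<bar> \<le> norm (y i) * ((norm (U \<omega>))\<^sup>2 + 1)"
        by (simp add: mult_right_mono mult.commute)
      then have "\<bar>c i \<omega>\<bar> * \<bar>U \<omega> \<bullet> y i\<bar> \<le> \<bar>C\<bar> * (norm (y i) * ((norm (U \<omega>))\<^sup>2 + 1))"
        using c by (intro mult_mono) auto
      then show "norm (c i \<omega> * (U \<omega> \<bullet> y i)) \<le> norm (\<bar>C\<bar> * (norm (y i) * ((norm (U \<omega>))\<^sup>2 + 1)))"
        by (simp add: abs_mult)
    qed
  qed (use measurable_F_M[OF meas[OF that] st(1)] in auto)
  show ?thesis
    unfolding eq using incr_mult_moments(1,2)[OF st meas int]
    by (simp add: Bochner_Integration.integral_sum)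
qed

end

end

section \<open>Elementary integrals on time grids\<close>

abbreviation el_start :: "('w, 'u, 'k) elementary \<Rightarrow> nat \<Rightarrow> real" where
  "el_start P i \<equiv> fst (P ! i)"
abbreviation el_end :: "('w, 'u, 'k) elementary \<Rightarrow> nat \<Rightarrow> real" where
  "el_end P i \<equiv> fst (snd (P ! i))"
abbreviation el_coef :: "('w, 'u, 'k) elementary \<Rightarrow> nat \<Rightarrow> 'w \<Rightarrow> real" where
  "el_coef P i \<equiv> fst (snd (snd (P ! i)))"
abbreviation el_arg :: "('w, 'u, 'k) elementary \<Rightarrow> nat \<Rightarrow> 'u" where
  "el_arg P i \<equiv> fst (snd (snd (snd (P ! i))))"
abbreviation el_val :: "('w, 'u, 'k) elementary \<Rightarrow> nat \<Rightarrow> 'k" where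
  "el_val P i \<equiv> snd (snd (snd (snd (P ! i))))"

text \<open>\<open>elementary_value\<close> uses intervals open on the left; here the right end is
  open instead, because evaluation at a left grid point \<open>x\<close> has to give the coefficient
  in force immediately after \<open>x\<close>.\<close>

definition el_active :: "('w, 'u, 'k) elementary \<Rightarrow> real \<Rightarrow> nat \<Rightarrow> 'w \<Rightarrow> real" where
  "el_active P x i \<omega> = (if el_start P i \<le> x \<and> x < el_end P i then el_coef P i \<omega> else 0)"

definition el_times :: "('w, 'u, 'k) elementary \<Rightarrow> real set" where
  "el_times P = el_start P ` {..<length P} \<union> el_end P ` {..<length P}"

lemma finite_el_times [simp]: "finite (el_times P)"
  by (simp add: el_times_def)

lemma elementary_integral_sum:
  "elementary_integral W P t \<omega> = (\<Sum>i<length P. (el_coef P i \<omega> *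
     (W (min t (el_end P i)) (el_arg P i) \<omega> - W (min t (el_start P i)) (el_arg P i) \<omega>)) *\<^sub>R el_val P i)"
  unfolding elementary_integral_def sum_list_sum_nth
  by (simp add: case_prod_beta atLeast0LessThan)

lemma elementary_value_apply:
  "blinfun_apply (elementary_value P x \<omega>) u = (\<Sum>i<length P.
     ((indicator {el_start P i<..el_end P i} x * el_coef P i \<omega>) * (el_arg P i \<bullet> u)) *\<^sub>R el_val P i)"
  unfolding elementary_value_def sum_list_sum_nth
  by (simp add: case_prod_beta atLeast0LessThan blinfun.sum_left blinfun.scaleR_left)

lemma elementary_processD:
  assumes "elementary_process M F t0 P" "i < length P"
  shows "t0 \<le> el_start P i" "el_start P i \<le> el_end P i" "el_coef P i \<in> borel_measurable (F (el_start P i))"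
    "\<exists>C. \<forall>\<omega>\<in>space M. \<bar>el_coef P i \<omega>\<bar> \<le> C"
proof -
  obtain a b \<xi> h y where P: "P ! i = (a, b, \<xi>, h, y)" by (metis prod.exhaust)
  have "(a, b, \<xi>, h, y) \<in> set P" using assms(2) P by (metis nth_mem)
  then show "t0 \<le> el_start P i" "el_start P i \<le> el_end P i"
    "el_coef P i \<in> borel_measurable (F (el_start P i))"
    "\<exists>C. \<forall>\<omega>\<in>space M. \<bar>el_coef P i \<omega>\<bar> \<le> C"
    using assms(1) unfolding elementary_process_def by (fastforce simp: P)+
qed

lemma elementary_process_bounded:
  assumes "elementary_process M F t0 P"
  shows "\<exists>C. \<forall>i<length P. \<forall>\<omega>\<in>space M. \<bar>el_coef P i \<omega>\<bar> \<le> C"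
proof -
  obtain C where C: "\<And>i. i < length P \<Longrightarrow> \<forall>\<omega>\<in>space M. \<bar>el_coef P i \<omega>\<bar> \<le> C i"
    using elementary_processD(4)[OF assms] by metis
  have "\<bar>el_coef P i \<omega>\<bar> \<le> (\<Sum>j<length P. \<bar>C j\<bar>)" if "i < length P" "\<omega> \<in> space M" for i \<omega>
  proof -
    have "\<bar>el_coef P i \<omega>\<bar> \<le> \<bar>C i\<bar>" using C[OF that(1)] that(2) by force
    also have "\<dots> \<le> (\<Sum>j<length P. \<bar>C j\<bar>)" using that(1) by (intro member_le_sum) auto
    finally show ?thesis .
  qed
  then show ?thesis by blast
qed

text \<open>
  No point of \<open>E\<close> lies strictly between two consecutive grid points, so an elementary process with
  times in \<open>E\<close> is constant between them.
\<close>

definition time_grid :: "real \<Rightarrow> real \<Rightarrow> real set \<Rightarrow> (nat \<Rightarrow> real) \<Rightarrow> nat \<Rightarrow> bool" where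
  "time_grid t0 T E s n \<longleftrightarrow> s 0 = t0 \<and> s n = T \<and> mono s \<and>
     (\<forall>x\<in>E. \<forall>k<n. x \<le> s k \<or> s (Suc k) \<le> x)"

lemma time_grid_exists:
  assumes "finite E" "t0 \<le> T"
  obtains s n where "time_grid t0 T E s n" "s ` {..n} = (E \<inter> {t0..T}) \<union> {t0, T}"
proof -
  define S where "S = (E \<inter> {t0..T}) \<union> {t0, T}"
  have S: "finite S" "S \<noteq> {}" using assms by (auto simp: S_def)
  define h where "h k = sorted_list_of_set S ! k" for k
  define n where "n = card S - 1"
  have card: "card S = Suc n" using S by (simp add: n_def card_gt_0_iff)
  \<comment> \<open>Constant from \<open>n\<close> on, so that \<open>s\<close> is monotone on all
    natural numbers and \<open>F (s k)\<close> is a filtration indexed by all of them.\<close>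
  define s where "s k = h (min k n)" for k
  have mono_h: "h i \<le> h j" if "i \<le> j" "j \<le> n" for i j
    unfolding h_def using that card by (intro sorted_nth_mono) auto
  have range: "h ` {..n} = S"
  proof -
    have "S = set (sorted_list_of_set S)" using S(1) by simp
    also have "\<dots> = h ` {..n}" using card by (auto simp: set_conv_nth h_def less_Suc_eq_le)
    finally show ?thesis by simp
  qed
  have range_s: "s ` {..n} = S" unfolding range[symmetric] by (intro image_cong) (auto simp: s_def)
  have "mono s" unfolding s_def by (intro monoI mono_h) auto
  moreover have "s 0 = t0"
  proof -
    have "t0 \<in> h ` {..n}" by (simp add: range S_def)
    then obtain k where "k \<le> n" "h k = t0" by auto
    then have "h 0 \<le> t0" using mono_h[of 0 k] by simp
    moreover have "h 0 \<in> S" using range by auto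
    then have "t0 \<le> h 0" using assms(2) by (auto simp: S_def)
    ultimately show ?thesis by (simp add: s_def)
  qed
  moreover have "s n = T"
  proof -
    have "T \<in> h ` {..n}" by (simp add: range S_def)
    then obtain k where "k \<le> n" "h k = T" by auto
    then have "T \<le> h n" using mono_h[of k n] by simp
    moreover have "h n \<in> S" using range by auto
    then have "h n \<le> T" using assms(2) by (auto simp: S_def)
    ultimately show ?thesis by (simp add: s_def)
  qed
  moreover have "x \<le> s k \<or> s (Suc k) \<le> x" if "x \<in> E" "k < n" for x k
  proof (cases "x \<in> {t0..T}")
    case True
    then have "x \<in> s ` {..n}" using that(1) by (simp add: range_s S_def)
    then obtain j where j: "j \<le> n" "x = s j" by auto
    show ?thesis
      using monoD[OF \<open>mono s\<close>, of j k] monoD[OF \<open>mono s\<close>, of "Suc k" j] j by (cases "j \<le> k") auto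
  next
    case False
    have "t0 \<le> s k" "s (Suc k) \<le> T"
      using monoD[OF \<open>mono s\<close>, of 0 k] monoD[OF \<open>mono s\<close>, of "Suc k" n] \<open>s 0 = t0\<close> \<open>s n = T\<close> that(2) by auto
    then show ?thesis using False by auto
  qed
  ultimately have "time_grid t0 T E s n" by (auto simp: time_grid_def)
  then show thesis using that range_s S_def by blast
qed

text \<open>Neither \<open>a\<close> nor \<open>b\<close> lies strictly inside a cell of the grid,
  so over one cell the truncated increment is either the full increment of \<open>w\<close> or
  zero.\<close>

lemma time_grid_telescope:
  fixes w :: "real \<Rightarrow> real"
  assumes g: "time_grid t0 T E s n" and ab: "a \<in> E" "b \<in> E" "t0 \<le> a" "a \<le> b" and "m \<le> n"
  shows "w (min (s m) b) - w (min (s m) a) =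
    (\<Sum>k<m. if a \<le> s k \<and> s k < b then w (s (Suc k)) - w (s k) else 0)"
  using \<open>m \<le> n\<close>
proof (induction m)
  case 0
  then show ?case using g ab by (simp add: time_grid_def)
next
  case (Suc m)
  have "a \<le> s m \<or> s (Suc m) \<le> a" "b \<le> s m \<or> s (Suc m) \<le> b" "s m \<le> s (Suc m)"
    using g ab Suc.prems by (auto simp: time_grid_def mono_def)
  then have "w (min (s (Suc m)) b) - w (min (s (Suc m)) a) =
    w (min (s m) b) - w (min (s m) a) + (if a \<le> s m \<and> s m < b then w (s (Suc m)) - w (s m) else 0)"
    using \<open>a \<le> b\<close> by (auto simp: min_def)
  then show ?case using Suc by simp
qed

lemma time_grid_ge: "time_grid t0 T E s n \<Longrightarrow> t0 \<le> s k"
  using monoD[of s 0 k] by (auto simp: time_grid_def)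

lemma time_grid_mono: "time_grid t0 T E s n \<Longrightarrow> i \<le> j \<Longrightarrow> s i \<le> s j"
  using monoD[of s i j] by (auto simp: time_grid_def)

context brownian_motion
begin

abbreviation grid_incr :: "('w, 'u, 'k::{real_inner, banach, second_countable_topology}) elementary \<Rightarrow>
    (nat \<Rightarrow> real) \<Rightarrow> nat \<Rightarrow> 'w \<Rightarrow> 'k" where
  "grid_incr P s k \<equiv> block_sum {..<length P} (el_active P (s k)) (el_arg P) (el_val P) (s k) (s (Suc k))"

abbreviation grid_variance :: "('w, 'u, 'k::{real_inner, banach, second_countable_topology}) elementary \<Rightarrow>
    (nat \<Rightarrow> real) \<Rightarrow> nat \<Rightarrow> 'w \<Rightarrow> real" where
  "grid_variance P s k \<equiv> block_variance {..<length P} (el_active P (s k)) (el_arg P) (el_val P)"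

lemma block_variance_nonneg: "0 \<le> block_variance I c h y \<omega>"
  unfolding block_variance_def by (rule finite_rank_norm_square_nonneg)

lemma elementary_integral_grid:
  assumes P: "elementary_process M F t0 P" and g: "time_grid t0 T E s n" "el_times P \<subseteq> E" and "m \<le> n"
  shows "elementary_integral W P (s m) \<omega> = (\<Sum>k<m. grid_incr P s k \<omega>)"
proof -
  have "elementary_integral W P (s m) \<omega> = (\<Sum>i<length P. (el_coef P i \<omega> *
     (\<Sum>k<m. if el_start P i \<le> s k \<and> s k < el_end P i then incr (s k) (s (Suc k)) (el_arg P i) \<omega> else 0)) *\<^sub>R el_val P i)"
    unfolding elementary_integral_sum
  proof (intro sum.cong refl)
    fix i assume "i \<in> {..<length P}"
    then have "el_start P i \<in> E" "el_end P i \<in> E" "t0 \<le> el_start P i" "el_start P i \<le> el_end P i"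
      using g(2) elementary_processD[OF P] by (auto simp: el_times_def)
    from time_grid_telescope[OF g(1) this \<open>m \<le> n\<close>, of "\<lambda>t. W t (el_arg P i) \<omega>"]
    show "(el_coef P i \<omega> * (W (min (s m) (el_end P i)) (el_arg P i) \<omega> -
        W (min (s m) (el_start P i)) (el_arg P i) \<omega>)) *\<^sub>R el_val P i =
      (el_coef P i \<omega> * (\<Sum>k<m. if el_start P i \<le> s k \<and> s k < el_end P i
        then incr (s k) (s (Suc k)) (el_arg P i) \<omega> else 0)) *\<^sub>R el_val P i"
      by simp
  qed
  also have "\<dots> = (\<Sum>i<length P. \<Sum>k<m. (el_active P (s k) i \<omega> * incr (s k) (s (Suc k)) (el_arg P i) \<omega>) *\<^sub>R el_val P i)"
    unfolding sum_distrib_left scaleR_sum_left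
    by (intro sum.cong refl) (simp add: el_active_def)
  also have "\<dots> = (\<Sum>k<m. grid_incr P s k \<omega>)"
    unfolding block_sum_def by (rule sum.swap)
  finally show ?thesis .
qed

lemma elementary_value_grid:
  fixes P :: "('w, 'u, 'k::{real_inner, banach, second_countable_topology}) elementary"
  assumes g: "time_grid t0 T E s n" "el_times P \<subseteq> E" and k: "k < n" "s k < x" "x \<le> s (Suc k)"
  shows "(hs_norm (elementary_value P x \<omega>))\<^sup>2 = ennreal (grid_variance P s k \<omega>)"
  unfolding block_variance_def
proof (rule hs_norm_finite_rank)
  fix u
  have "indicator {el_start P i<..el_end P i} x * el_coef P i \<omega> = el_active P (s k) i \<omega>" if "i < length P" for i
  proof -
    have "el_start P i \<in> E" "el_end P i \<in> E" using g(2) that by (auto simp: el_times_def)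
    then have "el_start P i \<le> s k \<or> s (Suc k) \<le> el_start P i" "el_end P i \<le> s k \<or> s (Suc k) \<le> el_end P i"
      using g(1) k(1) by (auto simp: time_grid_def)
    then show ?thesis using k by (auto simp: indicator_def el_active_def)
  qed
  then show "blinfun_apply (elementary_value P x \<omega>) u =
    (\<Sum>i<length P. (el_active P (s k) i \<omega> * (el_arg P i \<bullet> u)) *\<^sub>R el_val P i)"
    unfolding elementary_value_apply by (intro sum.cong refl) simp
qed

lemma elementary_value_measurable:
  "(\<lambda>x. (hs_norm (elementary_value P x \<omega>))\<^sup>2) \<in> borel_measurable lborel"
proof (rule borel_measurable_hs_norm_square)
  show "(\<lambda>x. elementary_value P x \<omega> u) \<in> borel_measurable lborel" for u
    unfolding elementary_value_apply
    by (intro borel_measurable_sum borel_measurable_scaleR borel_measurable_times) simp_all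
qed

text \<open>The cells are added one by one, the integrand being constant on each. This identifies
  the accumulated conditional variance of the grid increments, path by path, with the integral of
  the squared Hilbert-Schmidt norm.\<close>

lemma elementary_value_nn_integral:
  assumes g: "time_grid t0 T E s n" "el_times P \<subseteq> E" and "m \<le> n"
  shows "(\<integral>\<^sup>+x\<in>{t0..s m}. (hs_norm (elementary_value P x \<omega>))\<^sup>2 \<partial>lborel) =
    ennreal (\<Sum>k<m. (s (Suc k) - s k) * grid_variance P s k \<omega>)"
  using \<open>m \<le> n\<close>
proof (induction m)
  case 0
  have "s 0 = t0" using g by (simp add: time_grid_def)
  then have "(\<integral>\<^sup>+x\<in>{t0..s 0}. (hs_norm (elementary_value P x \<omega>))\<^sup>2 \<partial>lborel) = 0"
    using AE_lborel_singleton[of t0]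
    by (subst nn_integral_0_iff_AE)
      (auto simp: indicator_def intro!: borel_measurable_times_ennreal elementary_value_measurable[simplified])
  then show ?case by simp
next
  case (Suc m)
  let ?f = "\<lambda>x. (hs_norm (elementary_value P x \<omega>))\<^sup>2"
  have le: "t0 \<le> s m" "s m \<le> s (Suc m)" using time_grid_ge[OF g(1)] time_grid_mono[OF g(1)] by auto
  have "(\<integral>\<^sup>+x\<in>{t0..s (Suc m)}. ?f x \<partial>lborel) = (\<integral>\<^sup>+x. ?f x * indicator {t0..s m} x + ?f x * indicator {s m<..s (Suc m)} x \<partial>lborel)"
    using le by (intro nn_integral_cong) (auto simp: indicator_def)
  also have "\<dots> = (\<integral>\<^sup>+x\<in>{t0..s m}. ?f x \<partial>lborel) + (\<integral>\<^sup>+x\<in>{s m<..s (Suc m)}. ?f x \<partial>lborel)"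
    by (intro nn_integral_add borel_measurable_times_ennreal elementary_value_measurable) auto
  also have "(\<integral>\<^sup>+x\<in>{s m<..s (Suc m)}. ?f x \<partial>lborel) = (\<integral>\<^sup>+x. ennreal (grid_variance P s m \<omega>) * indicator {s m<..s (Suc m)} x \<partial>lborel)"
    using elementary_value_grid[OF g, of m] Suc.prems
    by (intro nn_integral_cong) (auto simp: indicator_def)
  also have "\<dots> = ennreal (grid_variance P s m \<omega>) * ennreal (s (Suc m) - s m)"
    using le by (subst nn_integral_cmult_indicator) auto
  also have "\<dots> = ennreal ((s (Suc m) - s m) * grid_variance P s m \<omega>)"
    using le by (simp add: ennreal_mult'[symmetric] block_variance_nonneg mult.commute)
  also have "(\<integral>\<^sup>+x\<in>{t0..s m}. ?f x \<partial>lborel) = ennreal (\<Sum>k<m. (s (Suc k) - s k) * grid_variance P s k \<omega>)"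
    using Suc by simp
  also have "ennreal (\<Sum>k<m. (s (Suc k) - s k) * grid_variance P s k \<omega>) + ennreal ((s (Suc m) - s m) * grid_variance P s m \<omega>)
      = ennreal (\<Sum>k<Suc m. (s (Suc k) - s k) * grid_variance P s k \<omega>)"
    using time_grid_mono[OF g(1)] le
    by (subst ennreal_plus[symmetric]) (auto intro!: sum_nonneg mult_nonneg_nonneg block_variance_nonneg)
  finally show ?case .
qed

lemma discrete_filtration_grid:
  assumes "time_grid t0 T E s n"
  shows "discrete_filtration M (\<lambda>k. F (s k))"
proof unfold_locales
  show "subalgebra M (F (s k))" for k
    by (rule subalg[OF time_grid_ge[OF assms]])
  show "sets (F (s k)) \<subseteq> sets (F (s (Suc k)))" for k
    by (rule filtration_mono[OF time_grid_ge[OF assms] time_grid_mono[OF assms]]) simp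
qed

context
  fixes P :: "('w, 'u, 'k::{real_inner, banach, second_countable_topology}) elementary"
    and T E s n
  assumes P: "elementary_process M F t0 P" and g: "time_grid t0 T E s n" "el_times P \<subseteq> E"
begin

interpretation discrete_filtration M "\<lambda>k. F (s k)"
  by (rule discrete_filtration_grid[OF g(1)])

lemma el_active_measurable:
  assumes "i < length P"
  shows "el_active P (s k) i \<in> borel_measurable (F (s k))"
proof (cases "el_start P i \<le> s k \<and> s k < el_end P i")
  case True
  then have "el_active P (s k) i = el_coef P i" by (auto simp: el_active_def)
  then show ?thesis
    using measurable_F_mono[OF elementary_processD(3)[OF P assms]] elementary_processD(1)[OF P assms] True
    by simp
next
  case False
  then have "el_active P (s k) i = (\<lambda>_. 0)" by (auto simp: el_active_def)
  then show ?thesis by simp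
qed

lemma el_active_bounded:
  "\<exists>C. \<forall>i<length P. \<forall>\<omega>\<in>space M. \<bar>el_active P (s k) i \<omega>\<bar> \<le> C"
proof -
  obtain C where C: "\<forall>i<length P. \<forall>\<omega>\<in>space M. \<bar>el_coef P i \<omega>\<bar> \<le> C"
    using elementary_process_bounded[OF P] by (rule exE)
  have "\<bar>el_active P (s k) i \<omega>\<bar> \<le> C" if "i < length P" "\<omega> \<in> space M" for i \<omega>
  proof -
    have "\<bar>el_coef P i \<omega>\<bar> \<le> C" using C that by blast
    then show ?thesis using abs_ge_zero[of "el_coef P i \<omega>"] by (auto simp: el_active_def simp del: abs_ge_zero)
  qed
  then show ?thesis by blast
qed

lemma grid_incr_second_moment:
  assumes "A \<in> sets (F (s k))"
  shows "integrable M (\<lambda>\<omega>. indicator A \<omega> * (norm (grid_incr P s k \<omega>))\<^sup>2)"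
    "(\<integral>\<omega>. indicator A \<omega> * (norm (grid_incr P s k \<omega>))\<^sup>2 \<partial>M) =
       (\<integral>\<omega>. indicator A \<omega> * ((s (Suc k) - s k) * grid_variance P s k \<omega>) \<partial>M)"
proof -
  obtain C where "\<forall>i<length P. \<forall>\<omega>\<in>space M. \<bar>el_active P (s k) i \<omega>\<bar> \<le> C"
    using el_active_bounded by (rule exE)
  then have C: "\<bar>el_active P (s k) i \<omega>\<bar> \<le> C" if "i < length P" "\<omega> \<in> space M" for i \<omega>
    using that by blast
  have le: "s k \<le> s (Suc k)" using time_grid_mono[OF g(1)] by simp
  show "integrable M (\<lambda>\<omega>. indicator A \<omega> * (norm (grid_incr P s k \<omega>))\<^sup>2)"
    by (rule block_sum_second_moment(1)[OF _ time_grid_ge[OF g(1)] le el_active_measurable _ assms, where C=C]) (use C in auto)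
  show "(\<integral>\<omega>. indicator A \<omega> * (norm (grid_incr P s k \<omega>))\<^sup>2 \<partial>M) =
       (\<integral>\<omega>. indicator A \<omega> * ((s (Suc k) - s k) * grid_variance P s k \<omega>) \<partial>M)"
    by (rule block_sum_second_moment(2)[OF _ time_grid_ge[OF g(1)] le el_active_measurable _ assms, where C=C]) (use C in auto)
qed

lemma grid_incr_mart_diff: "mart_diff (grid_incr P s) n"
  unfolding mart_diff_def
proof (intro allI impI conjI ballI)
  fix k
  obtain C where "\<forall>i<length P. \<forall>\<omega>\<in>space M. \<bar>el_active P (s k) i \<omega>\<bar> \<le> C"
    using el_active_bounded by (rule exE)
  then have C: "\<bar>el_active P (s k) i \<omega>\<bar> \<le> C" if "i < length P" "\<omega> \<in> space M" for i \<omega>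
    using that by blast
  have le: "s k \<le> s (Suc k)" using time_grid_mono[OF g(1)] by simp
  show "grid_incr P s k \<in> borel_measurable (F (s (Suc k)))"
    by (rule block_sum_measurable[OF _ time_grid_ge[OF g(1)] le el_active_measurable, where C=C]) (use C in auto)
  have "integrable M (\<lambda>\<omega>. indicator (space (F (s k))) \<omega> * (norm (grid_incr P s k \<omega>))\<^sup>2)"
    using sets.top[of "F (s k)"] by (intro grid_incr_second_moment) simp
  moreover have "integrable M (\<lambda>\<omega>. indicator (space (F (s k))) \<omega> * (norm (grid_incr P s k \<omega>))\<^sup>2) \<longleftrightarrow>
      integrable M (\<lambda>\<omega>. (norm (grid_incr P s k \<omega>))\<^sup>2)"
    by (intro Bochner_Integration.integrable_cong) auto
  ultimately show "integrable M (\<lambda>\<omega>. (norm (grid_incr P s k \<omega>))\<^sup>2)" by simp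
  fix U :: "'w \<Rightarrow> 'k" assume U: "U \<in> borel_measurable (F (s k))" "integrable M (\<lambda>\<omega>. (norm (U \<omega>))\<^sup>2)"
  show "(\<integral>\<omega>. U \<omega> \<bullet> grid_incr P s k \<omega> \<partial>M) = 0"
    by (rule block_sum_orthogonal[OF _ time_grid_ge[OF g(1)] le el_active_measurable _ U, where C=C]) (use C in auto)
qed

lemma grid_variance_measurable:
  "(\<lambda>\<omega>. (s (Suc k) - s k) * grid_variance P s k \<omega>) \<in> borel_measurable (F (s k))"
  "integrable M (\<lambda>\<omega>. (s (Suc k) - s k) * grid_variance P s k \<omega>)"
  "0 \<le> (s (Suc k) - s k) * grid_variance P s k \<omega>"
proof -
  obtain C where "\<forall>i<length P. \<forall>\<omega>\<in>space M. \<bar>el_active P (s k) i \<omega>\<bar> \<le> C"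
    using el_active_bounded by (rule exE)
  then have C: "\<bar>el_active P (s k) i \<omega>\<bar> \<le> C" if "i < length P" "\<omega> \<in> space M" for i \<omega>
    using that by blast
  have le: "s k \<le> s (Suc k)" using time_grid_mono[OF g(1)] by simp
  have "grid_variance P s k \<in> borel_measurable (F (s k))"
    by (rule block_variance_measurable[OF _ time_grid_ge[OF g(1)] le el_active_measurable, where C=C]) (use C in auto)
  then show "(\<lambda>\<omega>. (s (Suc k) - s k) * grid_variance P s k \<omega>) \<in> borel_measurable (F (s k))" by simp
  have "integrable M (grid_variance P s k)"
    by (rule block_variance_integrable[OF _ time_grid_ge[OF g(1)] le el_active_measurable, where C=C]) (use C in auto)
  then show "integrable M (\<lambda>\<omega>. (s (Suc k) - s k) * grid_variance P s k \<omega>)" by simp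
  show "0 \<le> (s (Suc k) - s k) * grid_variance P s k \<omega>"
    using le block_variance_nonneg by (intro mult_nonneg_nonneg) auto
qed

lemmas grid_lenglart = mart_diff_lenglart[OF grid_incr_mart_diff grid_variance_measurable(1,3,2)
    grid_incr_second_moment(2)]

end

text \<open>Coefficients may be random: the conditional variance of a grid increment is known at the
  left end of its cell, as the discrete inequality requires, and these variances sum to the integral
  on the right.\<close>

lemma elementary_integral_lenglart:
  assumes P: "elementary_process M F t0 P" and "t0 \<le> T" "0 < \<epsilon>" "0 \<le> \<delta>"
  shows "measure M {\<omega>\<in>space M. \<epsilon> < norm (elementary_integral W P T \<omega>)} \<le>
    measure M {\<omega>\<in>space M. ennreal \<delta> < (\<integral>\<^sup>+x\<in>{t0..T}. (hs_norm (elementary_value P x \<omega>))\<^sup>2 \<partial>lborel)} + \<delta> / \<epsilon>\<^sup>2"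
proof -
  obtain s n where g: "time_grid t0 T (el_times P) s n"
    by (rule time_grid_exists[OF finite_el_times \<open>t0 \<le> T\<close>])
  have sn: "s n = T" using g by (simp add: time_grid_def)
  have "0 \<le> (\<Sum>k<n. (s (Suc k) - s k) * grid_variance P s k \<omega>)" for \<omega>
    by (intro sum_nonneg grid_variance_measurable(3)[OF P g]) auto
  then show ?thesis
    using grid_lenglart[OF P g order_refl _ \<open>0 < \<epsilon>\<close> \<open>0 \<le> \<delta>\<close>]
    unfolding elementary_value_nn_integral[OF g order_refl order_refl, unfolded sn]
      elementary_integral_grid[OF P g order_refl order_refl, unfolded sn]
    by (simp add: ennreal_less_iff \<open>0 \<le> \<delta>\<close>)
qed

text \<open>The times in \<open>Q\<close> are added to the grid, so the discrete maximal inequality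
  sees them. The bound does not involve \<open>Q\<close>, which later lets \<open>Q\<close> exhaust
  a countable set.\<close>

lemma elementary_integral_maximal:
  assumes P: "elementary_process M F t0 P" and "t0 \<le> T" "0 < \<epsilon>" "0 \<le> V" and Q: "finite Q" "Q \<subseteq> {t0..T}"
    and V: "\<And>\<omega>. \<omega> \<in> space M \<Longrightarrow> (\<integral>\<^sup>+x\<in>{t0..T}. (hs_norm (elementary_value P x \<omega>))\<^sup>2 \<partial>lborel) \<le> ennreal V"
  shows "measure M {\<omega>\<in>space M. \<exists>t\<in>Q. \<epsilon> < norm (elementary_integral W P t \<omega>)} \<le> V / \<epsilon>\<^sup>2"
proof -
  obtain s n where g: "time_grid t0 T (el_times P \<union> Q) s n"
    and range: "s ` {..n} = ((el_times P \<union> Q) \<inter> {t0..T}) \<union> {t0, T}"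
    by (rule time_grid_exists[OF finite_UnI[OF finite_el_times Q(1)] \<open>t0 \<le> T\<close>])
  have sub: "el_times P \<subseteq> el_times P \<union> Q" by simp
  have sn: "s n = T" using g by (simp add: time_grid_def)
  interpret discrete_filtration M "\<lambda>k. F (s k)"
    by (rule discrete_filtration_grid[OF g(1)])
  note D = grid_incr_mart_diff[OF P g sub]
  have Q_ex: "\<exists>m\<le>n. t = s m" if "t \<in> Q" for t
  proof -
    have "t \<in> s ` {..n}" unfolding range using that Q(2) by auto
    then show ?thesis by auto
  qed
  have "measure M {\<omega>\<in>space M. \<exists>t\<in>Q. \<epsilon> < norm (elementary_integral W P t \<omega>)} \<le>
    measure M {\<omega>\<in>space M. \<exists>m\<le>n. \<epsilon> < norm (\<Sum>k<m. grid_incr P s k \<omega>)}"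
  proof (intro finite_measure_mono)
    show "{\<omega>\<in>space M. \<exists>m\<le>n. \<epsilon> < norm (\<Sum>k<m. grid_incr P s k \<omega>)} \<in> events"
      by (rule sets_G_M[OF mart_diff_sum_sets(1)[OF D order_refl]])
    show "{\<omega>\<in>space M. \<exists>t\<in>Q. \<epsilon> < norm (elementary_integral W P t \<omega>)} \<subseteq>
      {\<omega>\<in>space M. \<exists>m\<le>n. \<epsilon> < norm (\<Sum>k<m. grid_incr P s k \<omega>)}"
      using Q_ex elementary_integral_grid[OF P g sub] by force
  qed
  also have "\<dots> \<le> (\<Sum>k<n. \<integral>\<omega>. (norm (grid_incr P s k \<omega>))\<^sup>2 \<partial>M) / \<epsilon>\<^sup>2"
    by (rule mart_diff_maximal_inequality[OF D \<open>0 < \<epsilon>\<close>])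
  also have "(\<Sum>k<n. \<integral>\<omega>. (norm (grid_incr P s k \<omega>))\<^sup>2 \<partial>M) =
      (\<Sum>k<n. \<integral>\<omega>. (s (Suc k) - s k) * grid_variance P s k \<omega> \<partial>M)"
  proof (intro sum.cong refl)
    fix k
    have "(\<integral>\<omega>. (norm (grid_incr P s k \<omega>))\<^sup>2 \<partial>M) =
      (\<integral>\<omega>. indicator (space (F (s k))) \<omega> * (norm (grid_incr P s k \<omega>))\<^sup>2 \<partial>M)"
      by (intro Bochner_Integration.integral_cong) auto
    also have "\<dots> = (\<integral>\<omega>. indicator (space (F (s k))) \<omega> * ((s (Suc k) - s k) * grid_variance P s k \<omega>) \<partial>M)"
      using sets.top[of "F (s k)"] by (intro grid_incr_second_moment(2)[OF P g sub]) simp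
    also have "\<dots> = (\<integral>\<omega>. (s (Suc k) - s k) * grid_variance P s k \<omega> \<partial>M)"
      by (intro Bochner_Integration.integral_cong) auto
    finally show "(\<integral>\<omega>. (norm (grid_incr P s k \<omega>))\<^sup>2 \<partial>M) =
      (\<integral>\<omega>. (s (Suc k) - s k) * grid_variance P s k \<omega> \<partial>M)" .
  qed
  also have "\<dots> = (\<integral>\<omega>. (\<Sum>k<n. (s (Suc k) - s k) * grid_variance P s k \<omega>) \<partial>M)"
    by (intro Bochner_Integration.integral_sum[symmetric] grid_variance_measurable(2)[OF P g sub])
  also have "\<dots> \<le> (\<integral>\<omega>. V \<partial>M)"
  proof (intro integral_mono Bochner_Integration.integrable_sum grid_variance_measurable(2)[OF P g sub])
    fix \<omega> assume "\<omega> \<in> space M"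
    from V[OF this] show "(\<Sum>k<n. (s (Suc k) - s k) * grid_variance P s k \<omega>) \<le> V"
      using elementary_value_nn_integral[OF g sub order_refl] \<open>0 \<le> V\<close> by (simp add: sn)
  qed auto
  finally show ?thesis by (simp add: prob_space divide_right_mono)
qed

section \<open>Tails of integrals of deterministic elementary processes\<close>

definition el_deterministic :: "('w, 'u, 'k) elementary \<Rightarrow> bool" where
  "el_deterministic P \<longleftrightarrow> (\<forall>i<length P. \<forall>\<omega> \<omega>'. el_coef P i \<omega> = el_coef P i \<omega>')"

text \<open>Deterministic coefficients make the conditional variance of each grid increment a
  constant. The mesh condition turns every jump along the grid into an oscillation over times at
  most \<open>\<delta>\<close> apart, a term that path continuity makes small.\<close>

lemma elementary_integral_tail:
  assumes P: "elementary_process M F t0 P" "el_deterministic P" and "t0 \<le> T" "0 \<le> V"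
    and E: "finite E" "E \<subseteq> {t0..T}" "{t0, T} \<subseteq> E" "el_times P \<inter> {t0..T} \<subseteq> E"
    and mesh: "\<And>x. t0 \<le> x \<Longrightarrow> x < T \<Longrightarrow> \<exists>e\<in>E. x < e \<and> e \<le> x + \<delta>" and "0 \<le> \<delta>"
    and V: "\<And>\<omega>. (\<integral>\<^sup>+x\<in>{t0..T}. (hs_norm (elementary_value P x \<omega>))\<^sup>2 \<partial>lborel) \<le> ennreal V"
    and "0 \<le> r" "0 \<le> \<eta>" "0 < q"
  shows "measure M {\<omega>\<in>space M. \<exists>t\<in>E. r + \<eta> + q < norm (elementary_integral W P t \<omega>)} \<le>
    V / q\<^sup>2 * measure M {\<omega>\<in>space M. \<exists>t\<in>E. r < norm (elementary_integral W P t \<omega>)}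
    + measure M {\<omega>\<in>space M. \<exists>t\<in>E. \<exists>t'\<in>E. \<bar>t - t'\<bar> \<le> \<delta> \<and>
        \<eta> < norm (elementary_integral W P t \<omega> - elementary_integral W P t' \<omega>)}"
proof -
  obtain s n where g: "time_grid t0 T (el_times P \<union> E) s n"
    and range: "s ` {..n} = ((el_times P \<union> E) \<inter> {t0..T}) \<union> {t0, T}"
    by (rule time_grid_exists[OF finite_UnI[OF finite_el_times E(1)] \<open>t0 \<le> T\<close>])
  have sub: "el_times P \<subseteq> el_times P \<union> E" by simp
  have sn: "s n = T" using g by (simp add: time_grid_def)
  have range': "s ` {..n} = E" using range E by auto
  interpret discrete_filtration M "\<lambda>k. F (s k)"
    by (rule discrete_filtration_grid[OF g(1)])
  note D = grid_incr_mart_diff[OF P(1) g sub]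
  let ?J = "elementary_integral W P"
  have J: "?J (s m) \<omega> = (\<Sum>k<m. grid_incr P s k \<omega>)" if "m \<le> n" for m \<omega>
    by (rule elementary_integral_grid[OF P(1) g sub that])
  have J_meas: "?J t \<in> borel_measurable M" if "t \<in> E" for t
  proof -
    have "t \<in> s ` {..n}" using that by (simp add: range')
    then obtain m where m: "m \<le> n" "t = s m" by auto
    then have "?J t = (\<lambda>\<omega>. \<Sum>k<m. grid_incr P s k \<omega>)" using J by auto
    then show ?thesis using measurable_G_M[OF mart_diff_sum_measurable[OF D m(1) m(1)]] by simp
  qed
  \<comment> \<open>Any point serves to read off the constant variances \<open>v k\<close>.\<close>
  obtain \<omega>0 :: 'w where True by simp
  define v where "v k = (s (Suc k) - s k) * grid_variance P s k \<omega>0" for k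
  have v_eq: "(s (Suc k) - s k) * grid_variance P s k \<omega> = v k" for k \<omega>
  proof -
    have "el_active P (s k) i \<omega> = el_active P (s k) i \<omega>0" if "i < length P" for i
      using P(2) that unfolding el_deterministic_def el_active_def by metis
    then show ?thesis unfolding v_def block_variance_def by simp
  qed
  have sum_v: "(\<Sum>k<n. v k) \<le> V"
    using V[of \<omega>0] elementary_value_nn_integral[OF g sub order_refl, of \<omega>0] \<open>0 \<le> V\<close> by (simp add: sn v_eq)
  have v_nonneg: "0 \<le> v k" for k
    unfolding v_def by (rule grid_variance_measurable(3)[OF P(1) g sub])
  have cond: "(\<integral>\<omega>. indicator A \<omega> * (norm (grid_incr P s k \<omega>))\<^sup>2 \<partial>M) = v k * measure M A"
    if "A \<in> sets (F (s k))" for k A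
    using grid_incr_second_moment(2)[OF P(1) g sub that] sets_G_M[OF that] unfolding v_eq by simp
  have ex_iff: "(\<exists>m\<le>n. R (s m)) \<longleftrightarrow> (\<exists>t\<in>E. R t)" for R
    using range' by auto
  have first: "{\<omega>\<in>space M. \<exists>m\<le>n. c < norm (\<Sum>k<m. grid_incr P s k \<omega>)} =
      {\<omega>\<in>space M. \<exists>t\<in>E. c < norm (?J t \<omega>)}" for c
    unfolding ex_iff[symmetric] using J by auto
  \<comment> \<open>A point \<open>e\<close> of \<open>E\<close> beyond \<open>s k\<close> cannot be
    skipped by the grid, so the next grid point is at most \<open>e\<close>.\<close>
  have gap: "s (Suc k) - s k \<le> \<delta>" if "k < n" for k
  proof (cases "s k < T")
    case True
    then obtain e where e: "e \<in> E" "s k < e" "e \<le> s k + \<delta>"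
      using mesh[OF time_grid_ge[OF g(1)]] by blast
    then have "s (Suc k) \<le> e" using g that by (force simp: time_grid_def)
    then show ?thesis using e by simp
  next
    case False
    then show ?thesis
      using time_grid_mono[OF g(1), of "Suc k" n] that \<open>0 \<le> \<delta>\<close> sn by simp
  qed
  have "measure M {\<omega>\<in>space M. \<exists>t\<in>E. r + \<eta> + q < norm (?J t \<omega>)} \<le>
    (\<Sum>k<n. v k) / q\<^sup>2 * measure M {\<omega>\<in>space M. \<exists>t\<in>E. r < norm (?J t \<omega>)}
      + measure M {\<omega>\<in>space M. \<exists>k<n. \<eta> < norm (grid_incr P s k \<omega>)}"
    using mart_diff_tail[OF D cond v_nonneg \<open>0 \<le> r\<close> \<open>0 \<le> \<eta>\<close> \<open>0 < q\<close>] unfolding first .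
  also have "\<dots> \<le> V / q\<^sup>2 * measure M {\<omega>\<in>space M. \<exists>t\<in>E. r < norm (?J t \<omega>)}
      + measure M {\<omega>\<in>space M. \<exists>t\<in>E. \<exists>t'\<in>E. \<bar>t - t'\<bar> \<le> \<delta> \<and> \<eta> < norm (?J t \<omega> - ?J t' \<omega>)}"
  proof (intro add_mono mult_right_mono divide_right_mono sum_v finite_measure_mono)
    show "{\<omega>\<in>space M. \<exists>k<n. \<eta> < norm (grid_incr P s k \<omega>)} \<subseteq>
      {\<omega>\<in>space M. \<exists>t\<in>E. \<exists>t'\<in>E. \<bar>t - t'\<bar> \<le> \<delta> \<and> \<eta> < norm (?J t \<omega> - ?J t' \<omega>)}"
    proof safe
      fix \<omega> k assume k: "k < n" "\<eta> < norm (grid_incr P s k \<omega>)"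
      have "?J (s (Suc k)) \<omega> - ?J (s k) \<omega> = grid_incr P s k \<omega>" using J k(1) by simp
      moreover have "s (Suc k) \<in> E" "s k \<in> E" using range' k(1) by (auto simp: Suc_le_eq)
      moreover have "\<bar>s (Suc k) - s k\<bar> \<le> \<delta>" using gap[OF k(1)] time_grid_mono[OF g(1), of k "Suc k"] by simp
      ultimately show "\<exists>t\<in>E. \<exists>t'\<in>E. \<bar>t - t'\<bar> \<le> \<delta> \<and> \<eta> < norm (?J t \<omega> - ?J t' \<omega>)"
        using k(2) by metis
    qed
    have "{\<omega>\<in>space M. \<eta> < norm (?J t \<omega> - ?J t' \<omega>)} \<in> events" if "t \<in> E" "t' \<in> E" for t t'
      using J_meas[OF that(1)] J_meas[OF that(2)] by measurable
    then show "{\<omega>\<in>space M. \<exists>t\<in>E. \<exists>t'\<in>E. \<bar>t - t'\<bar> \<le> \<delta> \<and> \<eta> < norm (?J t \<omega> - ?J t' \<omega>)} \<in> events"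
      using E(1) by (intro sets.sets_Collect_finite_Ex) (auto intro!: sets.sets_Collect)
  qed auto
  finally show ?thesis .
qed

end

section \<open>Approximation by elementary processes\<close>

definition step_fun :: "(real \<times> real \<times> 'k) list \<Rightarrow> real \<Rightarrow> 'k::real_normed_vector" where
  "step_fun ps x = (\<Sum>(a, b, y)\<leftarrow>ps. indicator {a<..b} x *\<^sub>R y)"

text \<open>Membership in the mean-square closure of step functions on \<open>{t0..T}\<close>. The
  intervals must be ordered and start at or after \<open>t0\<close>, as in
  \<open>elementary_process\<close>.\<close>

definition l2_step_approx :: "real \<Rightarrow> real \<Rightarrow> (real \<Rightarrow> 'k::real_normed_vector) \<Rightarrow> bool" where
  "l2_step_approx t0 T g \<longleftrightarrow> (\<forall>\<epsilon>>0. \<exists>ps. (\<forall>(a, b, y)\<in>set ps. t0 \<le> a \<and> a \<le> b) \<and>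
     (\<integral>\<^sup>+x\<in>{t0..T}. ennreal ((norm (g x - step_fun ps x))\<^sup>2) \<partial>lborel) < ennreal \<epsilon>)"

lemma step_fun_simps [simp]:
  "step_fun [] x = 0"
  "step_fun ((a, b, y) # ps) x = indicator {a<..b} x *\<^sub>R y + step_fun ps x"
  "step_fun (ps @ qs) x = step_fun ps x + step_fun qs x"
  by (simp_all add: step_fun_def)

lemma step_fun_measurable [measurable]:
  "step_fun ps \<in> borel_measurable (borel :: real measure)"
  for ps :: "(real \<times> real \<times> 'k::{real_normed_vector, second_countable_topology}) list"
proof (induction ps)
  case Nil
  have "step_fun [] = (\<lambda>x. 0 :: 'k)" by (simp add: fun_eq_iff)
  then show ?case by simp
next
  case (Cons p ps)
  obtain a b y where p: "p = (a, b, y)" by (metis prod.exhaust)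
  have [measurable]: "step_fun ps \<in> borel_measurable borel" by (rule Cons)
  have "step_fun (p # ps) = (\<lambda>x. indicator {a<..b} x *\<^sub>R y + step_fun ps x)"
    by (simp add: fun_eq_iff p)
  then show ?case by simp
qed

lemma l2_add_le:
  fixes f g :: "real \<Rightarrow> 'k::{real_normed_vector, second_countable_topology}"
  assumes [measurable]: "f \<in> borel_measurable borel" "g \<in> borel_measurable borel" "A \<in> sets borel"
  shows "(\<integral>\<^sup>+x\<in>A. ennreal ((norm (f x + g x))\<^sup>2) \<partial>lborel) \<le>
    2 * (\<integral>\<^sup>+x\<in>A. ennreal ((norm (f x))\<^sup>2) \<partial>lborel) + 2 * (\<integral>\<^sup>+x\<in>A. ennreal ((norm (g x))\<^sup>2) \<partial>lborel)"
proof -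
  have "(\<integral>\<^sup>+x\<in>A. ennreal ((norm (f x + g x))\<^sup>2) \<partial>lborel) \<le>
    (\<integral>\<^sup>+x. 2 * (ennreal ((norm (f x))\<^sup>2) * indicator A x) + 2 * (ennreal ((norm (g x))\<^sup>2) * indicator A x) \<partial>lborel)"
  proof (intro nn_integral_mono)
    fix x
    have "ennreal ((norm (f x + g x))\<^sup>2) \<le> ennreal (2 * (norm (f x))\<^sup>2 + 2 * (norm (g x))\<^sup>2)"
      by (intro ennreal_leI norm_add_square_le)
    also have "\<dots> = 2 * ennreal ((norm (f x))\<^sup>2) + 2 * ennreal ((norm (g x))\<^sup>2)"
      by (simp add: ennreal_plus ennreal_mult)
    finally show "ennreal ((norm (f x + g x))\<^sup>2) * indicator A x \<le>
      2 * (ennreal ((norm (f x))\<^sup>2) * indicator A x) + 2 * (ennreal ((norm (g x))\<^sup>2) * indicator A x)"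
      by (simp add: indicator_def)
  qed
  also have "\<dots> = 2 * (\<integral>\<^sup>+x\<in>A. ennreal ((norm (f x))\<^sup>2) \<partial>lborel) + 2 * (\<integral>\<^sup>+x\<in>A. ennreal ((norm (g x))\<^sup>2) \<partial>lborel)"
    by (subst nn_integral_add) (auto simp: nn_integral_cmult)
  finally show ?thesis .
qed

lemma ennreal_two_halves:
  assumes "a < ennreal (\<epsilon> / 4)" "b < ennreal (\<epsilon> / 4)" "0 < \<epsilon>"
  shows "2 * a + 2 * b < ennreal \<epsilon>"
proof -
  obtain r where r: "a = ennreal r" "0 \<le> r" using assms(1) by (cases a) auto
  obtain s where s: "b = ennreal s" "0 \<le> s" using assms(2) by (cases b) auto
  have "r < \<epsilon> / 4" "s < \<epsilon> / 4" using assms r s by (auto simp: ennreal_less_iff)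
  then have "2 * r + 2 * s < \<epsilon>" by simp
  then have "ennreal (2 * r + 2 * s) < ennreal \<epsilon>" by (rule ennreal_lessI[OF \<open>0 < \<epsilon>\<close>])
  then show ?thesis using r s by (simp add: ennreal_plus ennreal_mult)
qed

context
  fixes t0 T :: real
begin

lemma l2_step_approx_limit:
  fixes g :: "real \<Rightarrow> 'k::{real_normed_vector, second_countable_topology}"
  assumes [measurable]: "g \<in> borel_measurable borel"
    and "\<And>\<epsilon>. 0 < \<epsilon> \<Longrightarrow> \<exists>g'. g' \<in> borel_measurable borel \<and> l2_step_approx t0 T g' \<and>
      (\<integral>\<^sup>+x\<in>{t0..T}. ennreal ((norm (g x - g' x))\<^sup>2) \<partial>lborel) < ennreal \<epsilon>"
  shows "l2_step_approx t0 T g"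
  unfolding l2_step_approx_def
proof (intro allI impI)
  fix \<epsilon> :: real assume "0 < \<epsilon>"
  then obtain g' where [measurable]: "g' \<in> borel_measurable borel" and g': "l2_step_approx t0 T g'"
    "(\<integral>\<^sup>+x\<in>{t0..T}. ennreal ((norm (g x - g' x))\<^sup>2) \<partial>lborel) < ennreal (\<epsilon> / 4)"
    using assms(2)[of "\<epsilon> / 4"] by auto
  obtain ps where ps: "\<forall>(a, b, y)\<in>set ps. t0 \<le> a \<and> a \<le> b"
    "(\<integral>\<^sup>+x\<in>{t0..T}. ennreal ((norm (g' x - step_fun ps x))\<^sup>2) \<partial>lborel) < ennreal (\<epsilon> / 4)"
    using g'(1) \<open>0 < \<epsilon>\<close> unfolding l2_step_approx_def by (meson zero_less_divide_iff zero_less_numeral)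
  have "(\<integral>\<^sup>+x\<in>{t0..T}. ennreal ((norm (g x - step_fun ps x))\<^sup>2) \<partial>lborel) < ennreal \<epsilon>"
    using l2_add_le[of "\<lambda>x. g x - g' x" "\<lambda>x. g' x - step_fun ps x" "{t0..T}"]
      ennreal_two_halves[OF g'(2) ps(2) \<open>0 < \<epsilon>\<close>] by simp
  then show "\<exists>ps. (\<forall>(a, b, y)\<in>set ps. t0 \<le> a \<and> a \<le> b) \<and>
     (\<integral>\<^sup>+x\<in>{t0..T}. ennreal ((norm (g x - step_fun ps x))\<^sup>2) \<partial>lborel) < ennreal \<epsilon>"
    using ps(1) by blast
qed

lemma l2_step_approx_add:
  fixes f g :: "real \<Rightarrow> 'k::{real_normed_vector, second_countable_topology}"
  assumes [measurable]: "f \<in> borel_measurable borel" "g \<in> borel_measurable borel"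
    and f: "l2_step_approx t0 T f" and g: "l2_step_approx t0 T g"
  shows "l2_step_approx t0 T (\<lambda>x. f x + g x)"
  unfolding l2_step_approx_def
proof (intro allI impI)
  fix \<epsilon> :: real assume "0 < \<epsilon>"
  then have "0 < \<epsilon> / 4" by simp
  obtain ps where ps: "\<forall>(a, b, y)\<in>set ps. t0 \<le> a \<and> a \<le> b"
    "(\<integral>\<^sup>+x\<in>{t0..T}. ennreal ((norm (f x - step_fun ps x))\<^sup>2) \<partial>lborel) < ennreal (\<epsilon> / 4)"
    using f \<open>0 < \<epsilon> / 4\<close> unfolding l2_step_approx_def by blast
  obtain qs where qs: "\<forall>(a, b, y)\<in>set qs. t0 \<le> a \<and> a \<le> b"
    "(\<integral>\<^sup>+x\<in>{t0..T}. ennreal ((norm (g x - step_fun qs x))\<^sup>2) \<partial>lborel) < ennreal (\<epsilon> / 4)"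
    using g \<open>0 < \<epsilon> / 4\<close> unfolding l2_step_approx_def by blast
  have eq: "f x - step_fun ps x + (g x - step_fun qs x) = f x + g x - step_fun (ps @ qs) x" for x
    by simp
  have "(\<integral>\<^sup>+x\<in>{t0..T}. ennreal ((norm (f x + g x - step_fun (ps @ qs) x))\<^sup>2) \<partial>lborel) < ennreal \<epsilon>"
    using l2_add_le[of "\<lambda>x. f x - step_fun ps x" "\<lambda>x. g x - step_fun qs x" "{t0..T}"]
      ennreal_two_halves[OF ps(2) qs(2) \<open>0 < \<epsilon>\<close>] unfolding eq by simp
  then show "\<exists>ps. (\<forall>(a, b, y)\<in>set ps. t0 \<le> a \<and> a \<le> b) \<and>
     (\<integral>\<^sup>+x\<in>{t0..T}. ennreal ((norm (f x + g x - step_fun ps x))\<^sup>2) \<partial>lborel) < ennreal \<epsilon>"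
    using ps(1) qs(1) by (intro exI[of _ "ps @ qs"]) auto
qed

lemma l2_step_approx_AE:
  fixes g :: "real \<Rightarrow> 'k::{real_normed_vector, second_countable_topology}"
  assumes "\<forall>(a, b, y)\<in>set ps. t0 \<le> a \<and> a \<le> b"
    and "\<And>x. t0 < x \<Longrightarrow> x \<le> T \<Longrightarrow> g x = step_fun ps x"
  shows "l2_step_approx t0 T g"
  unfolding l2_step_approx_def
proof (intro allI impI exI conjI)
  have "(\<integral>\<^sup>+x\<in>{t0..T}. ennreal ((norm (g x - step_fun ps x))\<^sup>2) \<partial>lborel) = (\<integral>\<^sup>+x. 0 \<partial>(lborel :: real measure))"
  proof (rule nn_integral_cong_AE)
    show "AE x in lborel. ennreal ((norm (g x - step_fun ps x))\<^sup>2) * indicator {t0..T} x = 0"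
      using AE_lborel_singleton[of t0]
    proof eventually_elim
      case (elim x)
      then show ?case using assms(2)[of x] by (auto simp: indicator_def)
    qed
  qed
  then show "(\<integral>\<^sup>+x\<in>{t0..T}. ennreal ((norm (g x - step_fun ps x))\<^sup>2) \<partial>lborel) < ennreal \<epsilon>" if "0 < \<epsilon>" for \<epsilon>
    using that by simp
qed (use assms(1) in blast)

lemma l2_step_approx_sum:
  fixes f :: "'i \<Rightarrow> real \<Rightarrow> 'k::{real_normed_vector, second_countable_topology}"
  assumes "finite I" "\<And>i. i \<in> I \<Longrightarrow> f i \<in> borel_measurable borel" "\<And>i. i \<in> I \<Longrightarrow> l2_step_approx t0 T (f i)"
  shows "l2_step_approx t0 T (\<lambda>x. \<Sum>i\<in>I. f i x)"
  using assms
proof (induction I)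
  case empty
  show ?case by (rule l2_step_approx_AE[of "[]"]) simp_all
next
  case (insert i I)
  then show ?case by (auto intro!: l2_step_approx_add borel_measurable_sum)
qed

text \<open>Dominated convergence: the squared differences are at most
  \<open>(2 * C)\<^sup>2\<close>, which is integrable over a bounded interval.\<close>

lemma l2_step_approx_bounded_limit:
  fixes g :: "real \<Rightarrow> 'k::{real_normed_vector, second_countable_topology}"
  assumes [measurable]: "g \<in> borel_measurable borel" "\<And>n. f n \<in> borel_measurable borel"
    and f: "\<And>n. l2_step_approx t0 T (f n)"
    and lim: "\<And>x. (\<lambda>n. f n x) \<longlonglongrightarrow> g x"
    and C: "\<And>n x. norm (f n x) \<le> C" "\<And>x. norm (g x) \<le> C"
  shows "l2_step_approx t0 T g"
proof (rule l2_step_approx_limit)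
  fix \<epsilon> :: real assume "0 < \<epsilon>"
  have "(\<lambda>n. \<integral>\<^sup>+x. ennreal ((norm (g x - f n x))\<^sup>2) * indicator {t0..T} x \<partial>lborel) \<longlonglongrightarrow> (\<integral>\<^sup>+x. 0 \<partial>(lborel :: real measure))"
  proof (rule nn_integral_dominated_convergence[where w="\<lambda>x. ennreal ((2 * C)\<^sup>2) * indicator {t0..T} x"])
    show "AE x in lborel. ennreal ((norm (g x - f n x))\<^sup>2) * indicator {t0..T} x \<le>
        ennreal ((2 * C)\<^sup>2) * indicator {t0..T} x" for n
    proof (intro AE_I2 mult_right_mono ennreal_leI power_mono)
      show "norm (g x - f n x) \<le> 2 * C" for x
        using norm_triangle_ineq4[of "g x" "f n x"] C(1)[of n x] C(2)[of x] by linarith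
    qed auto
    show "(\<integral>\<^sup>+x. ennreal ((2 * C)\<^sup>2) * indicator {t0..T} x \<partial>lborel) < \<infinity>"
      by (subst nn_integral_cmult_indicator) (auto simp: ennreal_mult_less_top emeasure_lborel_Icc_eq)
    show "AE x in lborel. (\<lambda>n. ennreal ((norm (g x - f n x))\<^sup>2) * indicator {t0..T} x) \<longlonglongrightarrow> 0"
    proof (intro AE_I2)
      fix x
      have "(\<lambda>n. ennreal ((norm (g x - f n x))\<^sup>2)) \<longlonglongrightarrow> ennreal ((norm (g x - g x))\<^sup>2)"
        by (intro tendsto_ennrealI tendsto_intros lim)
      then show "(\<lambda>n. ennreal ((norm (g x - f n x))\<^sup>2) * indicator {t0..T} x) \<longlonglongrightarrow> 0"
        by (cases "x \<in> {t0..T}") auto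
    qed
  qed measurable
  then have "\<forall>\<^sub>F n in sequentially. (\<integral>\<^sup>+x\<in>{t0..T}. ennreal ((norm (g x - f n x))\<^sup>2) \<partial>lborel) < ennreal \<epsilon>"
    using \<open>0 < \<epsilon>\<close> by (intro order_tendstoD(2)[of _ 0]) auto
  then obtain n where "(\<integral>\<^sup>+x\<in>{t0..T}. ennreal ((norm (g x - f n x))\<^sup>2) \<partial>lborel) < ennreal \<epsilon>"
    using eventually_happens'[OF sequentially_bot] by blast
  then show "\<exists>g'. g' \<in> borel_measurable borel \<and> l2_step_approx t0 T g' \<and>
      (\<integral>\<^sup>+x\<in>{t0..T}. ennreal ((norm (g x - g' x))\<^sup>2) \<partial>lborel) < ennreal \<epsilon>"
    using f by (intro exI[of _ "f n"]) auto
qed fact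

lemma l2_step_approx_uminus_indicator:
  assumes "l2_step_approx t0 T (\<lambda>x. indicator A x *\<^sub>R y)"
  shows "l2_step_approx t0 T (\<lambda>x. - (indicator A x *\<^sub>R y))"
  unfolding l2_step_approx_def
proof (intro allI impI)
  fix \<epsilon> :: real assume "0 < \<epsilon>"
  then obtain ps where ps: "\<forall>(a, b, y)\<in>set ps. t0 \<le> a \<and> a \<le> b"
    "(\<integral>\<^sup>+x\<in>{t0..T}. ennreal ((norm (indicator A x *\<^sub>R y - step_fun ps x))\<^sup>2) \<partial>lborel) < ennreal \<epsilon>"
    using assms[unfolded l2_step_approx_def, rule_format, OF \<open>0 < \<epsilon>\<close>] by (elim exE conjE)
  define qs where "qs = map (\<lambda>(a, b, y). (a, b, - y)) ps"
  have qs: "step_fun qs x = - step_fun ps x" for x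
    unfolding qs_def by (induction ps) auto
  have "norm (- (indicator A x *\<^sub>R y) - step_fun qs x) = norm (indicator A x *\<^sub>R y - step_fun ps x)" for x
    unfolding qs by (simp add: norm_minus_commute)
  then show "\<exists>ps. (\<forall>(a, b, y)\<in>set ps. t0 \<le> a \<and> a \<le> b) \<and>
     (\<integral>\<^sup>+x\<in>{t0..T}. ennreal ((norm (- (indicator A x *\<^sub>R y) - step_fun ps x))\<^sup>2) \<partial>lborel) < ennreal \<epsilon>"
    using ps by (intro exI[of _ qs]) (auto simp: qs_def)
qed

text \<open>Induction over the Borel sets from the rays \<open>{..a}\<close>, which are stable under
  intersection: a ray agrees with a step function off the null set \<open>{t0}\<close>, a complement
  is a difference from the constant \<open>y\<close>, and a disjoint union is a bounded
  limit.\<close>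

lemma l2_step_approx_indicator:
  fixes y :: "'k::{real_normed_vector, second_countable_topology}"
  assumes "A \<in> sets borel" "t0 \<le> T"
  shows "l2_step_approx t0 T (\<lambda>x. indicator A x *\<^sub>R y)"
proof -
  have sets_eq: "sigma_sets UNIV (range (\<lambda>a::real. {..a})) = sets borel"
    unfolding borel_eq_atMost by (simp add: sets_measure_of)
  have "Int_stable (range (\<lambda>a::real. {..a}))"
  proof (rule Int_stableI_image)
    show "\<exists>c\<in>UNIV. {..a} \<inter> {..b} = {..c}" for a b :: real
      by (intro bexI[of _ "min a b"]) auto
  qed
  moreover have "range (\<lambda>a::real. {..a}) \<subseteq> Pow UNIV" by simp
  moreover have "A \<in> sigma_sets UNIV (range (\<lambda>a::real. {..a}))"
    using assms(1) by (simp add: sets_eq)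
  ultimately show ?thesis
  proof (induction rule: sigma_sets_induct_disjoint)
    case (basic A)
    then obtain a where a: "A = {..a}" by auto
    show ?case
    proof (cases "t0 \<le> a")
      case True
      then show ?thesis by (intro l2_step_approx_AE[of "[(t0, a, y)]"]) (auto simp: a indicator_def)
    qed (intro l2_step_approx_AE[of "[]"], auto simp: a indicator_def)
  next
    case empty
    show ?case by (intro l2_step_approx_AE[of "[]"]) auto
  next
    case (compl A)
    have [measurable]: "A \<in> sets borel" using compl by (simp add: sets_eq)
    have "l2_step_approx t0 T (\<lambda>x. y + - (indicator A x *\<^sub>R y))"
    proof (intro l2_step_approx_add l2_step_approx_uminus_indicator compl)
      show "l2_step_approx t0 T (\<lambda>x. y)"
        using assms(2) by (intro l2_step_approx_AE[of "[(t0, T, y)]"]) auto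
    qed measurable
    moreover have "y + - (indicator A x *\<^sub>R y) = indicator (UNIV - A) x *\<^sub>R y" for x
      by (simp add: indicator_def)
    ultimately show ?case by simp
  next
    case (union A)
    have A [measurable]: "A i \<in> sets borel" for i using union(2) by (auto simp: sets_eq)
    have sums: "(\<lambda>i. indicator (A i) x :: real) sums indicator (\<Union>i. A i) x" for x
      using union(1) by (intro indicator_sums) (auto simp: disjoint_family_on_def)
    show ?case
    proof (rule l2_step_approx_bounded_limit[where f="\<lambda>n x. (\<Sum>i<n. indicator (A i) x *\<^sub>R y)" and C="norm y"])
      show "(\<lambda>n. \<Sum>i<n. indicator (A i) x *\<^sub>R y) \<longlonglongrightarrow> indicator (\<Union>i. A i) x *\<^sub>R y" for x
        using sums[of x] unfolding scaleR_sum_left[symmetric] sums_def by (intro tendsto_scaleR) auto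
      show "l2_step_approx t0 T (\<lambda>x. \<Sum>i<n. indicator (A i) x *\<^sub>R y)" for n
        using union by (intro l2_step_approx_sum) auto
      show "norm (\<Sum>i<n. indicator (A i) x *\<^sub>R y) \<le> norm y" for n x
      proof -
        have "(\<Sum>i<n. indicator (A i) x :: real) \<le> indicator (\<Union>i. A i) x"
          using sum_le_suminf[OF sums_summable[OF sums], of "{..<n}" x] sums_unique[OF sums, of x] by simp
        also have "\<dots> \<le> 1" by (simp add: indicator_def)
        finally have "(\<Sum>i<n. indicator (A i) x :: real) * norm y \<le> 1 * norm y" by (intro mult_right_mono) auto
        then show ?thesis unfolding scaleR_sum_left[symmetric] by (simp add: sum_nonneg)
      qed
      show "norm (indicator (\<Union>i. A i) x *\<^sub>R y) \<le> norm y" for x by (simp add: indicator_def)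
    qed measurable
  qed
qed

text \<open>Approximating simple functions can be taken with norm at most twice that of
  \<open>g\<close>. They are finite sums of indicators, and the bounded limit applies with
  \<open>2 * C\<close>.\<close>

lemma l2_step_approx_bounded:
  fixes g :: "real \<Rightarrow> 'k::{real_normed_vector, second_countable_topology}"
  assumes [measurable]: "g \<in> borel_measurable borel" and C: "\<And>x. norm (g x) \<le> C" and "t0 \<le> T"
  shows "l2_step_approx t0 T g"
proof -
  obtain s where s: "\<And>i. simple_function borel (s i)" "\<And>x. (\<lambda>i. s i x) \<longlonglongrightarrow> g x"
    "\<And>i x. dist (s i x) 0 \<le> 2 * dist (g x) 0"
    using borel_measurable_implies_sequence_metric[of g borel 0] by auto
  have [measurable]: "s i \<in> borel_measurable borel" for i
    by (rule borel_measurable_simple_function[OF s(1)])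
  show ?thesis
  proof (rule l2_step_approx_bounded_limit[where f=s and C="2 * C"])
    show "(\<lambda>n. s n x) \<longlonglongrightarrow> g x" for x by (rule s(2))
    show "norm (s n x) \<le> 2 * C" for n x using s(3)[of n x] C[of x] by simp
    show "norm (g x) \<le> 2 * C" for x using C[of x] norm_ge_zero[of "g x"] by linarith
    show "l2_step_approx t0 T (s n)" for n
    proof -
      have fin: "finite (range (s n))" using simple_functionD(1)[OF s(1)[of n]] by simp
      have "s n = (\<lambda>x. \<Sum>y\<in>range (s n). indicator (s n -` {y}) x *\<^sub>R y)"
      proof
        fix x
        have "(\<Sum>y\<in>range (s n). indicator (s n -` {y}) x *\<^sub>R y) = (\<Sum>y\<in>range (s n). if s n x = y then y else 0)"
          by (intro sum.cong) auto
        also have "\<dots> = s n x" using fin by simp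
        finally show "s n x = (\<Sum>y\<in>range (s n). indicator (s n -` {y}) x *\<^sub>R y)" by simp
      qed
      moreover have "l2_step_approx t0 T (\<lambda>x. \<Sum>y\<in>range (s n). indicator (s n -` {y}) x *\<^sub>R y)"
      proof (intro l2_step_approx_sum fin l2_step_approx_indicator \<open>t0 \<le> T\<close>)
        show "s n -` {y} \<in> sets borel" for y using simple_functionD(2)[OF s(1)[of n]] by simp
        then show "(\<lambda>x. indicator (s n -` {y}) x *\<^sub>R y) \<in> borel_measurable borel" for y by measurable
      qed
      ultimately show ?thesis by metis
    qed
  qed measurable
qed

end

section \<open>Approximation of Hilbert-Schmidt operator functions\<close>

text \<open>For an orthonormal sequence \<open>e\<close>, the finite-rank operator function whose
  columns are prescribed: a unit vector \<open>e n\<close> with \<open>n < m\<close> is sent to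
  \<open>step_fun (ps n)\<close>. All coefficients are the constant 1, so the process is
  deterministic.\<close>

definition step_operator :: "(nat \<Rightarrow> 'u) \<Rightarrow> (nat \<Rightarrow> (real \<times> real \<times> 'k) list) \<Rightarrow> nat \<Rightarrow> ('w, 'u, 'k) elementary" where
  "step_operator e ps m = concat (map (\<lambda>n. map (\<lambda>(a, b, y). (a, b, \<lambda>_. 1, e n, y)) (ps n)) [0..<m])"

lemma elementary_value_append:
  "elementary_value (P @ Q) x \<omega> = elementary_value P x \<omega> + elementary_value Q x \<omega>"
  by (simp add: elementary_value_def)

lemma step_operator_value:
  fixes e :: "nat \<Rightarrow> 'u::real_inner" and ps :: "nat \<Rightarrow> (real \<times> real \<times> 'k::real_normed_vector) list"
  shows "blinfun_apply (elementary_value (step_operator e ps m) x \<omega>) u =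
    (\<Sum>n<m. (e n \<bullet> u) *\<^sub>R step_fun (ps n) x)"
proof (induction m)
  case 0
  show ?case by (simp add: step_operator_def elementary_value_def)
next
  case (Suc m)
  have "blinfun_apply (elementary_value (map (\<lambda>(a, b, y). (a, b, \<lambda>_. 1, e m, y)) qs) x \<omega>) u =
    (e m \<bullet> u) *\<^sub>R step_fun qs x" for qs :: "(real \<times> real \<times> 'k) list"
    by (induction qs) (auto simp: elementary_value_def blinfun.add_left blinfun.scaleR_left scaleR_add_right)
  then show ?case
    using Suc by (simp add: step_operator_def elementary_value_append blinfun.add_left)
qed

text \<open>The columns \<open>\<Phi> s (e n)\<close> have a convergent sum of integrated squared
  norms, so all but finitely many contribute at most half of \<open>\<epsilon>\<close>; the
  remaining columns are replaced one by one by step functions.\<close>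

lemma hilbert_schmidt_step_approx:
  fixes \<Phi> :: "real \<Rightarrow> ('u::{real_inner, banach, second_countable_topology} \<Rightarrow>\<^sub>L
    'k::{real_inner, banach, second_countable_topology})" and M :: "'w measure"
  assumes meas: "\<And>u. (\<lambda>s. \<Phi> s u) \<in> borel_measurable borel"
    and hs: "\<And>s. hs_norm (\<Phi> s) \<le> ennreal C" and "t0 \<le> T" "0 < \<epsilon>"
  shows "\<exists>P :: ('w, 'u, 'k) elementary. elementary_process M F t0 P \<and>
    (\<forall>i<length P. \<forall>\<omega> \<omega>'. el_coef P i \<omega> = el_coef P i \<omega>') \<and>
    (\<forall>\<omega>. (\<integral>\<^sup>+s\<in>{t0..T}. (hs_norm (elementary_value P s \<omega> - \<Phi> s))\<^sup>2 \<partial>lborel) \<le> ennreal \<epsilon>)"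
proof -
  obtain e :: "nat \<Rightarrow> 'u" where e: "orthonormal_seq e"
    and hs_eq: "\<And>A :: 'u \<Rightarrow>\<^sub>L 'k. (hs_norm A)\<^sup>2 = (\<Sum>n. ennreal ((norm (A (e n)))\<^sup>2))"
    using hs_norm_suminf by metis
  have orth: "e m \<bullet> e n = 0" if "m \<noteq> n" for m n using e that by (simp add: orthonormal_seq_def)
  have unit: "e n = 0 \<or> e n \<bullet> e n = 1" for n
  proof -
    have "e n = 0 \<or> norm (e n) = 1" using e by (simp add: orthonormal_seq_def)
    then show ?thesis by (auto simp: dot_square_norm)
  qed
  note [measurable] = meas
  define N where "N n = (\<integral>\<^sup>+s\<in>{t0..T}. ennreal ((norm (\<Phi> s (e n)))\<^sup>2) \<partial>lborel)" for n
  have bound: "(\<Sum>n. ennreal ((norm (\<Phi> s (e n)))\<^sup>2)) \<le> ennreal (C\<^sup>2)" for s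
  proof -
    have "(hs_norm (\<Phi> s))\<^sup>2 \<le> (ennreal C)\<^sup>2" by (intro power_mono hs) auto
    also have "\<dots> \<le> ennreal (C\<^sup>2)" by (cases "0 \<le> C") (auto simp: ennreal_power ennreal_neg)
    finally show ?thesis by (simp add: hs_eq)
  qed
  have norm_bound: "norm (\<Phi> s (e n)) \<le> \<bar>C\<bar>" for s n
  proof -
    have "(\<Sum>i\<in>{n}. ennreal ((norm (\<Phi> s (e i)))\<^sup>2)) \<le> (\<Sum>n. ennreal ((norm (\<Phi> s (e n)))\<^sup>2))"
      by (rule sum_le_suminf) auto
    also note bound
    finally have "(norm (\<Phi> s (e n)))\<^sup>2 \<le> \<bar>C\<bar>\<^sup>2" by simp
    then show ?thesis by (rule power2_le_imp_le) simp
  qed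
  have "(\<Sum>n. N n) = (\<integral>\<^sup>+s\<in>{t0..T}. (\<Sum>n. ennreal ((norm (\<Phi> s (e n)))\<^sup>2)) \<partial>lborel)"
    unfolding N_def by (subst nn_integral_suminf[symmetric]) (auto simp: ennreal_suminf_multc)
  also have "\<dots> \<le> (\<integral>\<^sup>+s. ennreal (C\<^sup>2) * indicator {t0..T} s \<partial>lborel)"
    by (intro nn_integral_mono mult_right_mono bound) simp_all
  also have "\<dots> < \<infinity>"
    by (subst nn_integral_cmult_indicator) (auto simp: ennreal_mult_less_top emeasure_lborel_Icc_eq)
  finally have N_sum: "(\<Sum>n. N n) < \<infinity>" .
  have N_fin: "N n < \<infinity>" for n
  proof -
    have "(\<Sum>i\<in>{n}. N i) \<le> (\<Sum>n. N n)" by (rule sum_le_suminf) auto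
    also note N_sum
    finally show ?thesis by simp
  qed
  define r where "r n = enn2real (N n)" for n
  have N_r: "N n = ennreal (r n)" "0 \<le> r n" for n using N_fin[of n] by (auto simp: r_def less_top)
  have "summable r"
    using N_sum N_r by (intro summable_suminf_not_top) auto
  then have "(\<lambda>m. \<Sum>n<m. r n) \<longlonglongrightarrow> suminf r" by (rule summable_LIMSEQ)
  then have "\<forall>\<^sub>F m in sequentially. suminf r - \<epsilon> / 2 < (\<Sum>n<m. r n)"
    using \<open>0 < \<epsilon>\<close> by (intro order_tendstoD(1)) auto
  then obtain m where m: "suminf r - \<epsilon> / 2 < (\<Sum>n<m. r n)"
    using eventually_happens'[OF sequentially_bot] by blast
  \<comment> \<open>The denominator is positive also for \<open>m = 0\<close>, and \<open>m\<close>
    such errors add up to at most half of \<open>\<epsilon>\<close>.\<close>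
  define good where "good n ps \<longleftrightarrow> (\<forall>(a, b, y)\<in>set ps. t0 \<le> a \<and> a \<le> b) \<and>
     (\<integral>\<^sup>+s\<in>{t0..T}. ennreal ((norm (\<Phi> s (e n) - step_fun ps s))\<^sup>2) \<partial>lborel) < ennreal (\<epsilon> / (2 * real m + 1))" for n ps
  have "\<exists>ps. good n ps" for n
  proof -
    have "l2_step_approx t0 T (\<lambda>s. \<Phi> s (e n))"
      by (rule l2_step_approx_bounded[OF meas norm_bound \<open>t0 \<le> T\<close>])
    moreover have "0 < \<epsilon> / (2 * real m + 1)" using \<open>0 < \<epsilon>\<close> by simp
    ultimately show ?thesis unfolding l2_step_approx_def good_def by blast
  qed
  then obtain ps where good: "\<And>n. good n (ps n)" by metis
  note ps = good[unfolded good_def, THEN conjunct1] good[unfolded good_def, THEN conjunct2]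
  define P :: "('w, 'u, 'k) elementary" where "P = step_operator e ps m"
  have set_P: "set P = (\<Union>n<m. (\<lambda>(a, b, y). (a, b, \<lambda>_. 1, e n, y)) ` set (ps n))"
    by (simp add: P_def step_operator_def atLeast0LessThan)
  have "elementary_process M F t0 P"
    unfolding elementary_process_def set_P using ps(1) by (fastforce intro!: exI[of _ "1::real"])
  moreover have "\<forall>i<length P. \<forall>\<omega> \<omega>'. el_coef P i \<omega> = el_coef P i \<omega>'"
  proof (intro allI impI)
    fix i \<omega> \<omega>' assume "i < length P"
    then have "P ! i \<in> set P" by simp
    then show "el_coef P i \<omega> = el_coef P i \<omega>'" unfolding set_P by auto
  qed
  moreover have "(\<integral>\<^sup>+s\<in>{t0..T}. (hs_norm (elementary_value P s \<omega> - \<Phi> s))\<^sup>2 \<partial>lborel) \<le> ennreal \<epsilon>" for \<omega>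
  proof -
    have val: "elementary_value P s \<omega> (e j) = (if j < m then (e j \<bullet> e j) *\<^sub>R step_fun (ps j) s else 0)" for s j
    proof -
      have "elementary_value P s \<omega> (e j) = (\<Sum>n<m. if n = j then (e j \<bullet> e j) *\<^sub>R step_fun (ps j) s else 0)"
        unfolding P_def step_operator_value using orth by (intro sum.cong refl) auto
      then show ?thesis by simp
    qed
    \<comment> \<open>At a padding index, where \<open>e j = 0\<close>, both operators give zero and
      so does the left side.\<close>
    have le: "(norm ((elementary_value P s \<omega> - \<Phi> s) (e j)))\<^sup>2 \<le>
        (if j < m then (norm (\<Phi> s (e j) - step_fun (ps j) s))\<^sup>2 else (norm (\<Phi> s (e j)))\<^sup>2)" for s j
      using unit[of j] by (auto simp: val blinfun.diff_left norm_minus_commute)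
    have meas_value: "(\<lambda>s. elementary_value P s \<omega> (e j)) \<in> borel_measurable borel" for j
      unfolding val by measurable
    note [measurable] = this
    have "(\<integral>\<^sup>+s\<in>{t0..T}. (hs_norm (elementary_value P s \<omega> - \<Phi> s))\<^sup>2 \<partial>lborel) =
      (\<Sum>j. \<integral>\<^sup>+s\<in>{t0..T}. ennreal ((norm ((elementary_value P s \<omega> - \<Phi> s) (e j)))\<^sup>2) \<partial>lborel)"
      unfolding hs_eq ennreal_suminf_multc[symmetric] blinfun.diff_left
      by (subst nn_integral_suminf[symmetric]) (auto)
    also have "\<dots> \<le> (\<Sum>j. ennreal ((if j < m then \<epsilon> / (2 * real m + 1) else 0) + (if j < m then 0 else r j)))"
    proof (intro suminf_le summableI)
      fix j
      have "(\<integral>\<^sup>+s\<in>{t0..T}. ennreal ((norm ((elementary_value P s \<omega> - \<Phi> s) (e j)))\<^sup>2) \<partial>lborel) \<le>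
        (\<integral>\<^sup>+s\<in>{t0..T}. ennreal (if j < m then (norm (\<Phi> s (e j) - step_fun (ps j) s))\<^sup>2 else (norm (\<Phi> s (e j)))\<^sup>2) \<partial>lborel)"
        by (intro nn_integral_mono mult_right_mono ennreal_leI le) auto
      also have "\<dots> \<le> ennreal ((if j < m then \<epsilon> / (2 * real m + 1) else 0) + (if j < m then 0 else r j))"
        using less_imp_le[OF ps(2)[of j]] N_r(1)[of j] by (cases "j < m") (simp_all add: N_def)
      finally show "(\<integral>\<^sup>+s\<in>{t0..T}. ennreal ((norm ((elementary_value P s \<omega> - \<Phi> s) (e j)))\<^sup>2) \<partial>lborel) \<le>
        ennreal ((if j < m then \<epsilon> / (2 * real m + 1) else 0) + (if j < m then 0 else r j))" .
    qed
    also have "\<dots> = ennreal (m * (\<epsilon> / (2 * real m + 1)) + (suminf r - (\<Sum>n<m. r n)))"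
    proof (rule suminf_ennreal_eq)
      have "(\<lambda>j. if j < m then \<epsilon> / (2 * real m + 1) else 0) sums (\<Sum>j<m. \<epsilon> / (2 * real m + 1))"
        using sums_If_finite_set[of "{..<m}" "\<lambda>_. \<epsilon> / (2 * real m + 1)"] by simp
      moreover have "(\<lambda>j. r j - (if j < m then r j else 0)) sums (suminf r - (\<Sum>j<m. r j))"
        using sums_If_finite_set[of "{..<m}" r] summable_sums[OF \<open>summable r\<close>] by (intro sums_diff) simp_all
      moreover have "r j - (if j < m then r j else 0) = (if j < m then 0 else r j)" for j by simp
      ultimately show "(\<lambda>j. (if j < m then \<epsilon> / (2 * real m + 1) else 0) + (if j < m then 0 else r j)) sums
        (m * (\<epsilon> / (2 * real m + 1)) + (suminf r - (\<Sum>n<m. r n)))"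
        using sums_add by fastforce
    qed (use N_r(2) \<open>0 < \<epsilon>\<close> in auto)
    also have "\<dots> \<le> ennreal \<epsilon>"
    proof (intro ennreal_leI)
      have "real m * (\<epsilon> / (2 * real m + 1)) \<le> \<epsilon> / 2"
        using \<open>0 < \<epsilon>\<close> by (simp add: field_simps)
      then show "m * (\<epsilon> / (2 * real m + 1)) + (suminf r - (\<Sum>n<m. r n)) \<le> \<epsilon>" using m by linarith
    qed
    finally show ?thesis .
  qed
  ultimately show ?thesis by blast
qed

section \<open>Maximal moments of elementary integrals\<close>

text \<open>Continuity from below along the finite stages of an enumeration.\<close>

lemma (in prob_space) prob_countable_Union_le:
  assumes "countable D" and B: "\<And>t. t \<in> D \<Longrightarrow> B t \<in> events"
    and fin: "\<And>Q. finite Q \<Longrightarrow> Q \<subseteq> D \<Longrightarrow> prob (\<Union>t\<in>Q. B t) \<le> c"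
  shows "prob (\<Union>t\<in>D. B t) \<le> c"
proof (cases "D = {}")
  case True
  then show ?thesis using fin[of "{}"] by simp
next
  case False
  define A where "A n = (\<Union>i\<le>n. B (from_nat_into D i))" for n
  have D: "from_nat_into D i \<in> D" for i by (rule from_nat_into[OF False])
  have "(\<lambda>n. prob (A n)) \<longlonglongrightarrow> prob (\<Union>n. A n)"
    unfolding A_def using B D by (intro finite_Lim_measure_incseq) (auto simp: incseq_def intro: order_trans)
  moreover have "(\<Union>n. A n) = (\<Union>t\<in>D. B t)"
  proof -
    have "(\<Union>n. A n) = (\<Union>i. B (from_nat_into D i))" by (auto simp: A_def)
    also have "\<dots> = (\<Union>t\<in>range (from_nat_into D). B t)" by simp
    finally show ?thesis using range_from_nat_into[OF False assms(1)] by simp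
  qed
  moreover have "prob (A n) \<le> c" for n
  proof -
    have "A n = (\<Union>t\<in>from_nat_into D ` {..n}. B t)" by (simp add: A_def)
    moreover have "prob (\<Union>t\<in>from_nat_into D ` {..n}. B t) \<le> c" using D by (intro fin) auto
    ultimately show ?thesis by simp
  qed
  ultimately show ?thesis by (metis LIMSEQ_le_const2)
qed

section \<open>Reduction to countably many times\<close>

text \<open>Rounding down, on the grid of mesh \<open>1 / (n + 1)\<close> anchored at
  \<open>t0\<close>: the rounded time does not look into the future of \<open>t\<close>, stays at or
  above \<open>t0\<close> for \<open>t0 \<le> t\<close>, and takes countably many values.\<close>

definition left_grid :: "real \<Rightarrow> nat \<Rightarrow> real \<Rightarrow> real" where
  "left_grid t0 n t = t0 + real_of_int \<lfloor>(t - t0) * (real n + 1)\<rfloor> / (real n + 1)"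

text \<open>Rationality is asked of the distance from \<open>t0\<close>, which may itself be
  irrational; so the values of \<open>left_grid\<close> at times in \<open>{t0..T}\<close> belong to
  the set.\<close>

definition rat_times :: "real \<Rightarrow> real \<Rightarrow> real set" where
  "rat_times t0 T = {t\<in>{t0..T}. t - t0 \<in> \<rat>}"

lemma left_grid_le: "left_grid t0 n t \<le> t"
proof -
  have "real_of_int \<lfloor>(t - t0) * (real n + 1)\<rfloor> / (real n + 1) \<le> (t - t0) * (real n + 1) / (real n + 1)"
    by (intro divide_right_mono) auto
  also have "\<dots> = t - t0" by simp
  finally show ?thesis by (simp add: left_grid_def)
qed

lemma left_grid_ge: "t0 \<le> t \<Longrightarrow> t0 \<le> left_grid t0 n t"
  by (simp add: left_grid_def)

lemma left_grid_rat: "left_grid t0 n t - t0 \<in> \<rat>"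
  by (simp add: left_grid_def)

lemma left_grid_tendsto: "(\<lambda>n. left_grid t0 n t) \<longlonglongrightarrow> t"
proof (rule tendsto_sandwich[OF _ _ _ tendsto_const])
  have "t - 1 / (real n + 1) \<le> left_grid t0 n t" for n
  proof -
    have "((t - t0) * (real n + 1) - 1) / (real n + 1) \<le> real_of_int \<lfloor>(t - t0) * (real n + 1)\<rfloor> / (real n + 1)"
      by (intro divide_right_mono) linarith+
    then show ?thesis by (simp add: left_grid_def diff_divide_distrib)
  qed
  then show "\<forall>\<^sub>F n in sequentially. t - 1 / (real n + 1) \<le> left_grid t0 n t" by simp
  show "(\<lambda>n. t - 1 / (real n + 1)) \<longlonglongrightarrow> t" by real_asymp
qed (simp add: left_grid_le)

lemma countable_rat_times: "countable (rat_times t0 T)"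
proof -
  have "rat_times t0 T \<subseteq> (\<lambda>x. x + t0) ` \<rat>"
  proof
    fix t assume "t \<in> rat_times t0 T"
    then show "t \<in> (\<lambda>x. x + t0) ` \<rat>" by (intro image_eqI[of _ _ "t - t0"]) (auto simp: rat_times_def)
  qed
  then show ?thesis using countable_rat by (meson countable_image countable_subset)
qed

lemma left_grid_rat_times: "t0 \<le> t \<Longrightarrow> t \<le> T \<Longrightarrow> left_grid t0 n t \<in> rat_times t0 T"
  using left_grid_le[of t0 n t] by (simp add: rat_times_def left_grid_ge left_grid_rat)

lemma rat_times_closed_bound:
  fixes w :: "real \<Rightarrow> real"
  assumes w: "continuous_on {t0..} w" and le: "\<And>t. t \<in> rat_times t0 T \<Longrightarrow> w t \<le> c"
    and t: "t0 \<le> t" "t \<le> T"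
  shows "w t \<le> c"
proof (rule LIMSEQ_le_const2)
  show "(\<lambda>n. w (left_grid t0 n t)) \<longlonglongrightarrow> w t"
    using t by (intro continuous_on_tendsto_compose[OF w] left_grid_tendsto) (auto simp: left_grid_ge)
  show "\<exists>N. \<forall>n\<ge>N. w (left_grid t0 n t) \<le> c"
    using le left_grid_rat_times[OF t] by auto
qed

text \<open>\<open>(1 / 2) ^ k\<close> splits as \<open>(2 / 3) ^ k * (3 / 4) ^ k\<close>; the first
  factor absorbs the growth of the power, the second is summable.\<close>

lemma summable_powr_half_power:
  assumes "0 < q"
  shows "summable (\<lambda>k. (2 * q * (real k + 1)) powr \<nu> * (1 / 2) ^ k)"
proof (rule summable_comparison_test_ev)
  have "(\<lambda>k. (2 * q * (real k + 1)) powr \<nu> * (2 / 3) ^ k) \<longlonglongrightarrow> 0"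
    using assms by real_asymp
  then have "\<forall>\<^sub>F k in sequentially. (2 * q * (real k + 1)) powr \<nu> * (2 / 3) ^ k < 1"
    by (rule order_tendstoD) simp
  then show "\<forall>\<^sub>F k in sequentially. norm ((2 * q * (real k + 1)) powr \<nu> * (1 / 2) ^ k) \<le> (3 / 4) ^ k"
  proof eventually_elim
    case (elim k)
    have "norm ((2 * q * (real k + 1)) powr \<nu> * (1 / 2) ^ k) =
        ((2 * q * (real k + 1)) powr \<nu> * (2 / 3) ^ k) * (3 / 4) ^ k"
      by (simp add: power_mult_distrib[symmetric] mult.assoc abs_mult)
    also have "\<dots> \<le> 1 * (3 / 4) ^ k" using elim by (intro mult_right_mono) auto
    finally show ?case by simp
  qed
  show "summable (\<lambda>k. (3 / 4 :: real) ^ k)" by simp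
qed

context brownian_motion
begin

lemma elementary_integral_measurable:
  fixes P :: "('w, 'u, 'k::{real_inner, banach, second_countable_topology}) elementary"
  assumes P: "elementary_process M F t0 P" and "t0 \<le> t"
  shows "elementary_integral W P t \<in> borel_measurable (F t)"
    and "elementary_integral W P t \<in> borel_measurable M"
proof -
  have "(\<lambda>\<omega>. (el_coef P i \<omega> * (W (min t (el_end P i)) (el_arg P i) \<omega> -
      W (min t (el_start P i)) (el_arg P i) \<omega>)) *\<^sub>R el_val P i) \<in> borel_measurable (F t)"
    if i: "i < length P" for i
  proof (cases "el_start P i \<le> t")
    case True
    note d = elementary_processD[OF P i]
    have [measurable]: "el_coef P i \<in> borel_measurable (F t)"
      by (rule measurable_F_mono[OF d(3) d(1) True])
    have [measurable]: "W (min t (el_end P i)) (el_arg P i) \<in> borel_measurable (F t)"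
      "W (min t (el_start P i)) (el_arg P i) \<in> borel_measurable (F t)"
      using d(1,2) \<open>t0 \<le> t\<close> by (auto intro!: measurable_F_mono[OF W_adapted])
    show ?thesis by measurable
  next
    case False
    \<comment> \<open>The coefficient need not be known at time \<open>t\<close>, but the increment
      multiplying it is identically zero.\<close>
    then have mins: "min t (el_start P i) = t" "min t (el_end P i) = t"
      using elementary_processD(2)[OF P i] by auto
    show ?thesis unfolding mins by simp
  qed
  then show "elementary_integral W P t \<in> borel_measurable (F t)"
    unfolding elementary_integral_sum[abs_def] by (intro borel_measurable_sum) auto
  then show "elementary_integral W P t \<in> borel_measurable M"
    by (rule measurable_F_M) fact
qed

lemma elementary_integral_continuous:
  assumes P: "elementary_process M F t0 P"
  shows "AE \<omega> in M. continuous_on {t0..} (\<lambda>t. elementary_integral W P t \<omega>)"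
proof -
  have "AE \<omega> in M. \<forall>i\<in>{..<length P}. continuous_on {t0..} (\<lambda>t. W t (el_arg P i) \<omega>)"
    using W_continuous by (intro AE_finite_allI) auto
  then show ?thesis
  proof eventually_elim
    case (elim \<omega>)
    have cont: "continuous_on {t0..} (\<lambda>t. W (min t b) (el_arg P i) \<omega>)" if "i < length P" "t0 \<le> b" for i b
    proof (rule continuous_on_compose2[where g="\<lambda>t. W t (el_arg P i) \<omega>" and t="{t0..}"])
      show "continuous_on {t0..} (\<lambda>t. W t (el_arg P i) \<omega>)" using elim that(1) by simp
    qed (use that(2) in \<open>auto intro!: continuous_intros\<close>)
    show ?case
      unfolding elementary_integral_sum
    proof (intro continuous_on_sum)
      fix i assume "i \<in> {..<length P}"
      then have i: "i < length P" by simp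
      have "t0 \<le> el_start P i" "t0 \<le> el_end P i"
        using elementary_processD(1,2)[OF P i] by auto
      from cont[OF i this(1)] cont[OF i this(2)]
      show "continuous_on {t0..} (\<lambda>t. (el_coef P i \<omega> * (W (min t (el_end P i)) (el_arg P i) \<omega> -
          W (min t (el_start P i)) (el_arg P i) \<omega>)) *\<^sub>R el_val P i)"
        by (intro continuous_on_scaleR continuous_on_mult continuous_on_diff continuous_on_const)
    qed
  qed
qed

text \<open>Passing from level \<open>r\<close> to \<open>r + q + q\<close> halves the probability:
  one \<open>q\<close> allows for the jump across \<open>r\<close>, and the variance bound gives the
  factor for the other. The probability of larger jumps tends to zero as the grid is refined, since
  almost every path is uniformly continuous on \<open>{t0..T}\<close>.\<close>

lemma elementary_integral_tail_geometric:
  assumes P: "elementary_process M F t0 P" "el_deterministic P" and "t0 \<le> T" "0 \<le> V"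
    and V: "\<And>\<omega>. (\<integral>\<^sup>+x\<in>{t0..T}. (hs_norm (elementary_value P x \<omega>))\<^sup>2 \<partial>lborel) \<le> ennreal V"
    and q: "0 < q" "V / q\<^sup>2 \<le> 1 / 2"
  shows "prob {\<omega>\<in>space M. \<exists>t\<in>rat_times t0 T. 2 * q * real k < norm (elementary_integral W P t \<omega>)} \<le> (1 / 2) ^ k"
proof -
  let ?J = "elementary_integral W P"
  \<comment> \<open>One countable set containing every grid used below, so that \<open>a r\<close>
    bounds the crossing probability on each of them.\<close>
  define D where "D = rat_times t0 T \<union> (el_times P \<inter> {t0..T}) \<union> {t0, T}"
  have D: "countable D" "D \<subseteq> {t0..T}"
    unfolding D_def using \<open>t0 \<le> T\<close> countable_rat_times
    by (auto simp: countable_finite rat_times_def)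
  have J_meas [measurable]: "?J t \<in> borel_measurable M" if "t \<in> D" for t
    using elementary_integral_measurable(2)[OF P(1)] that D(2) by auto
  have ev: "{\<omega>\<in>space M. \<exists>t\<in>D'. r < norm (?J t \<omega>)} \<in> events" if "D' \<subseteq> D" for D' r
  proof (rule sets.sets_Collect_countable_Ex')
    show "countable D'" using that D(1) countable_subset by blast
    show "{\<omega>\<in>space M. r < norm (?J t \<omega>)} \<in> events" if "t \<in> D'" for t
      using J_meas[of t] that \<open>D' \<subseteq> D\<close> by (auto simp: subset_eq)
  qed
  define a where "a r = prob {\<omega>\<in>space M. \<exists>t\<in>D. r < norm (?J t \<omega>)}" for r
  define U where "U m = {\<omega>\<in>space M. \<exists>t\<in>D. \<exists>t'\<in>D. \<bar>t - t'\<bar> \<le> 1 / (real m + 1) \<and> q < norm (?J t \<omega> - ?J t' \<omega>)}" for m :: nat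
  have U_meas: "U m \<in> events" for m
    unfolding U_def
  proof (intro sets.sets_Collect_countable_Ex' D(1))
    fix t t' assume "t \<in> D" "t' \<in> D"
    then show "{\<omega>\<in>space M. \<bar>t - t'\<bar> \<le> 1 / (real m + 1) \<and> q < norm (?J t \<omega> - ?J t' \<omega>)} \<in> events"
      by measurable
  qed
  have "(\<lambda>m. prob (U m)) \<longlonglongrightarrow> prob (\<Inter>m. U m)"
  proof (rule finite_Lim_measure_decseq)
    show "decseq U"
    proof (rule decseq_SucI)
      fix m
      have "1 / (real (Suc m) + 1) \<le> 1 / (real m + 1)" by (intro divide_left_mono) auto
      then show "U (Suc m) \<subseteq> U m" unfolding U_def by (blast intro: order_trans)
    qed
  qed (use U_meas in auto)
  moreover have "prob (\<Inter>m. U m) = 0"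
  proof -
    have "AE \<omega> in M. \<omega> \<notin> (\<Inter>m. U m)"
      using elementary_integral_continuous[OF P(1)]
    proof eventually_elim
      case (elim \<omega>)
      have "uniformly_continuous_on {t0..T} (\<lambda>t. ?J t \<omega>)"
        using elim by (intro compact_uniformly_continuous continuous_on_subset[OF elim]) auto
      then obtain d where d: "0 < d" "\<And>t t'. t \<in> {t0..T} \<Longrightarrow> t' \<in> {t0..T} \<Longrightarrow> dist t' t < d \<Longrightarrow> dist (?J t' \<omega>) (?J t \<omega>) < q"
        unfolding uniformly_continuous_on_def using \<open>0 < q\<close> by meson
      obtain m where m: "1 / (real m + 1) < d"
        using reals_Archimedean[OF d(1)] by (auto simp: inverse_eq_divide add.commute)
      have "\<omega> \<notin> U m"
      proof
        assume "\<omega> \<in> U m"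
        then obtain t t' where t: "t \<in> D" "t' \<in> D" "\<bar>t - t'\<bar> \<le> 1 / (real m + 1)" "q < norm (?J t \<omega> - ?J t' \<omega>)"
          by (auto simp: U_def)
        then have "dist (?J t \<omega>) (?J t' \<omega>) < q"
          using m D(2) by (intro d(2)) (auto simp: dist_real_def)
        then show False using t(4) by (simp add: dist_norm)
      qed
      then show ?case by auto
    qed
    moreover have "(\<Inter>m. U m) \<in> events" using U_meas by auto
    ultimately show ?thesis by (subst prob_eq_0) auto
  qed
  ultimately have U0: "(\<lambda>m. prob (U m)) \<longlonglongrightarrow> 0" by simp
  have step: "a (r + q + q) \<le> 1 / 2 * a r" if "0 \<le> r" for r
  proof -
    have Un: "{\<omega>\<in>space M. \<exists>t\<in>Q. c < norm (?J t \<omega>)} = (\<Union>t\<in>Q. {\<omega>\<in>space M. c < norm (?J t \<omega>)})" for Q c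
      by auto
    have fin: "prob {\<omega>\<in>space M. \<exists>t\<in>Q. r + q + q < norm (?J t \<omega>)} \<le> 1 / 2 * a r" if Q: "finite Q" "Q \<subseteq> D" for Q
    proof (rule LIMSEQ_le_const)
      show "(\<lambda>m. 1 / 2 * a r + prob (U m)) \<longlonglongrightarrow> 1 / 2 * a r" using tendsto_add[OF tendsto_const U0] by simp
      show "\<exists>N. \<forall>m\<ge>N. prob {\<omega>\<in>space M. \<exists>t\<in>Q. r + q + q < norm (?J t \<omega>)} \<le> 1 / 2 * a r + prob (U m)"
      proof (intro exI allI impI)
        fix m :: nat
        \<comment> \<open>Uniform net of spacing \<open>1 / (m + 1)\<close>; where its next point
          would fall beyond \<open>T\<close>, the point \<open>T\<close> of \<open>E\<close> takes
          over.\<close>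
        define net where "net = (\<lambda>j. t0 + real j / (real m + 1)) ` {..nat \<lceil>(T - t0) * (real m + 1)\<rceil>} \<inter> {t0..T}"
        have net: "finite net" "net \<subseteq> D" by (auto simp: net_def D_def rat_times_def)
        define E where "E = Q \<union> net \<union> (el_times P \<inter> {t0..T}) \<union> {t0, T}"
        have E: "finite E" "E \<subseteq> D" using net Q by (auto simp: E_def D_def)
        have mesh: "\<exists>e\<in>E. x < e \<and> e \<le> x + 1 / (real m + 1)" if x: "t0 \<le> x" "x < T" for x
        proof -
          define j where "j = Suc (nat \<lfloor>(x - t0) * (real m + 1)\<rfloor>)"
          define e where "e = t0 + real j / (real m + 1)"
          have "0 \<le> (x - t0) * (real m + 1)" using x by simp
          then have "real j = of_int \<lfloor>(x - t0) * (real m + 1)\<rfloor> + 1" by (simp add: j_def)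
          then have j: "(x - t0) * (real m + 1) < real j" "real j \<le> (x - t0) * (real m + 1) + 1" by linarith+
          have e1: "x < e" using j(1) by (simp add: e_def field_simps)
          have "real j / (real m + 1) \<le> ((x - t0) * (real m + 1) + 1) / (real m + 1)"
            using j(2) by (intro divide_right_mono) auto
          then have e2: "e \<le> x + 1 / (real m + 1)" by (simp add: e_def add_divide_distrib)
          show ?thesis
          proof (cases "e \<le> T")
            case True
            have "real j \<le> (T - t0) * (real m + 1)" using True by (simp add: e_def field_simps)
            then have "j \<le> nat \<lceil>(T - t0) * (real m + 1)\<rceil>" by linarith
            then have "e \<in> net" using True e1 x by (auto simp: net_def e_def)
            then show ?thesis using e1 e2 by (auto simp: E_def)
          next
            case False
            then show ?thesis using e2 x by (intro bexI[of _ T]) (auto simp: E_def)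
          qed
        qed
        have "prob {\<omega>\<in>space M. \<exists>t\<in>Q. r + q + q < norm (?J t \<omega>)} \<le> prob {\<omega>\<in>space M. \<exists>t\<in>E. r + q + q < norm (?J t \<omega>)}"
          using ev[OF E(2)] by (intro finite_measure_mono) (auto simp: E_def)
        also have "\<dots> \<le> V / q\<^sup>2 * prob {\<omega>\<in>space M. \<exists>t\<in>E. r < norm (?J t \<omega>)}
          + prob {\<omega>\<in>space M. \<exists>t\<in>E. \<exists>t'\<in>E. \<bar>t - t'\<bar> \<le> 1 / (real m + 1) \<and> q < norm (?J t \<omega> - ?J t' \<omega>)}"
          by (rule elementary_integral_tail[OF P \<open>t0 \<le> T\<close> \<open>0 \<le> V\<close> E(1) _ _ _ mesh _ V \<open>0 \<le> r\<close> _ q(1)])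
            (use E(2) D(2) q(1) in \<open>auto simp: E_def\<close>)
        also have "\<dots> \<le> 1 / 2 * a r + prob (U m)"
          unfolding a_def
          using ev[OF order_refl] U_meas[of m] E(2)
          by (intro add_mono mult_mono q(2) finite_measure_mono) (auto simp: U_def)
        finally show "prob {\<omega>\<in>space M. \<exists>t\<in>Q. r + q + q < norm (?J t \<omega>)} \<le> 1 / 2 * a r + prob (U m)" .
      qed
    qed
    show ?thesis
      unfolding a_def[of "r + q + q"] Un
    proof (rule prob_countable_Union_le[OF D(1)])
      show "{\<omega>\<in>space M. r + q + q < norm (?J t \<omega>)} \<in> events" if "t \<in> D" for t
        using J_meas[OF that] by measurable
      show "prob (\<Union>t\<in>Q. {\<omega>\<in>space M. r + q + q < norm (?J t \<omega>)}) \<le> 1 / 2 * a r" if "finite Q" "Q \<subseteq> D" for Q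
        using fin[OF that] unfolding Un .
    qed
  qed
  have "a (2 * q * real k) \<le> (1 / 2) ^ k"
  proof (induction k)
    case 0
    show ?case by (simp add: a_def)
  next
    case (Suc k)
    have "a (2 * q * real (Suc k)) = a (2 * q * real k + q + q)" by (simp add: algebra_simps)
    also have "\<dots> \<le> 1 / 2 * a (2 * q * real k)" using q(1) by (intro step) auto
    finally show ?case using Suc by simp
  qed
  moreover have "prob {\<omega>\<in>space M. \<exists>t\<in>rat_times t0 T. 2 * q * real k < norm (?J t \<omega>)} \<le> a (2 * q * real k)"
    unfolding a_def using ev[OF order_refl] by (intro finite_measure_mono) (auto simp: D_def)
  ultimately show ?thesis by simp
qed

text \<open>Values are sorted into layers of width \<open>2 * q\<close>, and layer \<open>k\<close>
  is weighted by the geometric tail. Apart from \<open>\<nu>\<close> the bound depends only on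
  \<open>q\<close>, hence it is uniform along approximations with a common variance bound.\<close>

lemma elementary_integral_sup_moment:
  assumes P: "elementary_process M F t0 P" "el_deterministic P" and "t0 \<le> T" "0 \<le> V"
    and V: "\<And>\<omega>. (\<integral>\<^sup>+x\<in>{t0..T}. (hs_norm (elementary_value P x \<omega>))\<^sup>2 \<partial>lborel) \<le> ennreal V"
    and q: "0 < q" "V / q\<^sup>2 \<le> 1 / 2" and "0 < \<nu>"
  shows "(\<integral>\<^sup>+\<omega>. (SUP t\<in>rat_times t0 T. ennreal (norm (elementary_integral W P t \<omega>) powr \<nu>)) \<partial>M)
    \<le> ennreal (\<Sum>k. (2 * q * (real k + 1)) powr \<nu> * (1 / 2) ^ k)"
proof -
  let ?J = "elementary_integral W P"
  define A where "A k = {\<omega>\<in>space M. \<exists>t\<in>rat_times t0 T. 2 * q * real k < norm (?J t \<omega>)}" for k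
  have A [measurable]: "A k \<in> events" for k
    unfolding A_def
  proof (rule sets.sets_Collect_countable_Ex'[OF _ countable_rat_times])
    fix t assume "t \<in> rat_times t0 T"
    then have [measurable]: "?J t \<in> borel_measurable M"
      using elementary_integral_measurable(2)[OF P(1)] by (simp add: rat_times_def)
    show "{\<omega>\<in>space M. 2 * q * real k < norm (?J t \<omega>)} \<in> events" by measurable
  qed
  have "(\<integral>\<^sup>+\<omega>. (SUP t\<in>rat_times t0 T. ennreal (norm (?J t \<omega>) powr \<nu>)) \<partial>M) \<le>
    (\<integral>\<^sup>+\<omega>. (\<Sum>k. ennreal ((2 * q * (real k + 1)) powr \<nu>) * indicator (A k) \<omega>) \<partial>M)"
  proof (intro nn_integral_mono SUP_least)
    fix \<omega> t assume \<omega>: "\<omega> \<in> space M" and t: "t \<in> rat_times t0 T"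
    show "ennreal (norm (?J t \<omega>) powr \<nu>) \<le> (\<Sum>k. ennreal ((2 * q * (real k + 1)) powr \<nu>) * indicator (A k) \<omega>)"
    proof (cases "?J t \<omega> = 0")
      case False
      define x where "x = norm (?J t \<omega>) / (2 * q)"
      have x: "0 < x" using False q(1) by (simp add: x_def)
      \<comment> \<open>Ceiling minus one instead of the floor: membership in \<open>A k\<close>
        needs the strict inequality \<open>k < x\<close>, also when \<open>x\<close> is an
        integer.\<close>
      define k where "k = nat (\<lceil>x\<rceil> - 1)"
      have "real k = of_int \<lceil>x\<rceil> - 1" using x by (simp add: k_def)
      then have k: "real k < x" "x \<le> real k + 1" by linarith+
      have k1: "2 * q * real k < norm (?J t \<omega>)" and k2: "norm (?J t \<omega>) \<le> 2 * q * (real k + 1)"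
        using k q(1) by (simp_all add: x_def field_simps)
      have mem: "\<omega> \<in> A k" unfolding A_def using k1 \<omega> t by blast
      have term_le: "f k \<le> suminf f" for f :: "nat \<Rightarrow> ennreal"
        using sum_le_suminf[of f "{k}"] by simp
      have "ennreal (norm (?J t \<omega>) powr \<nu>) \<le> ennreal ((2 * q * (real k + 1)) powr \<nu>)"
        using k2 \<open>0 < \<nu>\<close> by (intro ennreal_leI powr_mono2) auto
      also have "\<dots> = ennreal ((2 * q * (real k + 1)) powr \<nu>) * indicator (A k) \<omega>"
        using mem by simp
      also have "\<dots> \<le> (\<Sum>k. ennreal ((2 * q * (real k + 1)) powr \<nu>) * indicator (A k) \<omega>)"
        by (rule term_le[of "\<lambda>k. ennreal ((2 * q * (real k + 1)) powr \<nu>) * indicator (A k) \<omega>"])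
      finally show ?thesis .
    qed simp
  qed
  also have "\<dots> = (\<Sum>k. ennreal ((2 * q * (real k + 1)) powr \<nu>) * emeasure M (A k))"
    by (subst nn_integral_suminf) (auto simp: nn_integral_cmult_indicator)
  also have "\<dots> \<le> (\<Sum>k. ennreal ((2 * q * (real k + 1)) powr \<nu> * (1 / 2) ^ k))"
  proof (intro suminf_le summableI)
    fix k
    have "emeasure M (A k) \<le> ennreal ((1 / 2) ^ k)"
      unfolding emeasure_eq_measure A_def
      by (intro ennreal_leI elementary_integral_tail_geometric[OF P \<open>t0 \<le> T\<close> \<open>0 \<le> V\<close> V q])
    then show "ennreal ((2 * q * (real k + 1)) powr \<nu>) * emeasure M (A k) \<le> ennreal ((2 * q * (real k + 1)) powr \<nu> * (1 / 2) ^ k)"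
      by (subst ennreal_mult) (auto intro!: mult_left_mono)
  qed
  also have "\<dots> = ennreal (\<Sum>k. (2 * q * (real k + 1)) powr \<nu> * (1 / 2) ^ k)"
    using summable_powr_half_power[OF q(1), of \<nu>] q(1) by (intro suminf_ennreal2) auto
  finally show ?thesis .
qed

end

section \<open>The stochastic integral of a deterministic operator function\<close>

lemma continuous_on_atLeastI:
  fixes g :: "real \<Rightarrow> 'k::topological_space"
  assumes "\<And>T. continuous_on {t0..T} g"
  shows "continuous_on {t0..} g"
  unfolding continuous_on_eq_continuous_within
proof
  fix t assume "t \<in> {t0..}"
  have "at t within {t0..} = at t within {t0..t + 1}"
    by (rule at_within_nhd[of t "{..<t + 1}"]) auto
  moreover have "continuous (at t within {t0..t + 1}) g"
    using assms[of "t + 1"] \<open>t \<in> {t0..}\<close> by (simp add: continuous_on_eq_continuous_within)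
  ultimately show "continuous (at t within {t0..}) g" by simp
qed

text \<open>The windows grow with \<open>n\<close>, so any bounded interval is covered from some
  index on, and the increments there are dominated by a geometric series. Evaluation at
  \<open>left_grid\<close> times gives the same limit by uniform convergence and continuity of
  \<open>g\<close>.\<close>

lemma geometric_uniform_limit:
  fixes f :: "nat \<Rightarrow> real \<Rightarrow> 'k::banach"
  assumes cont: "\<And>n. continuous_on {t0..} (f n)"
    and step: "\<And>n t. N \<le> n \<Longrightarrow> t0 \<le> t \<Longrightarrow> t \<le> t0 + real n + 1 \<Longrightarrow> norm (f (Suc n) t - f n t) \<le> (1 / 2) ^ n"
  shows "\<exists>g. continuous_on {t0..} g \<and> (\<forall>T. uniform_limit {t0..T} f g sequentially) \<and>
    (\<forall>t\<ge>t0. (\<lambda>n. f n (left_grid t0 n t)) \<longlonglongrightarrow> g t)"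
proof -
  \<comment> \<open>The bound is the partial sum of the geometric series in closed form, which is
    what the induction on \<open>j\<close> reproduces.\<close>
  have near: "norm (f (n + j) t - f n t) \<le> 2 * (1 / 2) ^ n - 2 * (1 / 2) ^ (n + j)"
    if "N \<le> n" "t0 \<le> t" "t \<le> t0 + real n + 1" for n j t
  proof (induction j)
    case (Suc j)
    have "norm (f (Suc (n + j)) t - f (n + j) t) \<le> (1 / 2) ^ (n + j)" using that by (intro step) auto
    then have "norm (f (n + Suc j) t - f n t) \<le> (1 / 2) ^ (n + j) + (2 * (1 / 2) ^ n - 2 * (1 / 2) ^ (n + j))"
      using norm_triangle_ineq[of "f (Suc (n + j)) t - f (n + j) t" "f (n + j) t - f n t"] Suc by simp
    then show ?case by simp
  qed simp
  have near': "norm (f m t - f n t) \<le> 2 * (1 / 2) ^ n"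
    if "N \<le> n" "t0 \<le> t" "t \<le> t0 + real n + 1" "n \<le> m" for n m t
  proof -
    have "norm (f m t - f n t) \<le> 2 * (1 / 2) ^ n - 2 * (1 / 2) ^ m"
      using near[OF that(1-3), of "m - n"] that(4) by simp
    moreover have "0 \<le> 2 * (1 / 2 :: real) ^ m" by simp
    ultimately show ?thesis by linarith
  qed
  have half: "(\<lambda>n. 2 * (1 / 2 :: real) ^ n) \<longlonglongrightarrow> 0"
    by (intro tendsto_mult_right_zero LIMSEQ_power_zero) simp
  define N' where "N' t = max N (nat \<lceil>t - t0\<rceil>)" for t
  have N': "N \<le> n" "s \<le> t0 + real n + 1" if "N' t \<le> n" "s \<le> t" for s t n
  proof -
    have n: "N \<le> n" "nat \<lceil>t - t0\<rceil> \<le> n" using that(1) by (auto simp: N'_def)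
    then show "N \<le> n" by simp
    have "t - t0 \<le> real n" using n(2) by linarith
    then show "s \<le> t0 + real n + 1" using that(2) by simp
  qed
  have conv: "convergent (\<lambda>n. f n t)" if "t0 \<le> t" for t
  proof (rule Cauchy_convergent, rule metric_CauchyI)
    fix e :: real assume "0 < e"
    then have "\<forall>\<^sub>F n in sequentially. 2 * (1 / 2 :: real) ^ n < e / 2"
      by (intro order_tendstoD(2)[OF half]) simp
    then have "\<forall>\<^sub>F n in sequentially. 2 * (1 / 2 :: real) ^ n < e / 2 \<and> N' t \<le> n"
      using eventually_ge_at_top by (rule eventually_conj)
    then obtain n where n: "2 * (1 / 2 :: real) ^ n < e / 2" "N' t \<le> n"
      using eventually_happens'[OF sequentially_bot] by blast
    have "dist (f m t) (f n t) < e / 2" if "n \<le> m" for m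
      using near'[OF N'(1)[OF n(2) order_refl] \<open>t0 \<le> t\<close> N'(2)[OF n(2) order_refl] that] n(1) by (simp add: dist_norm)
    then show "\<exists>M. \<forall>m\<ge>M. \<forall>n\<ge>M. dist (f m t) (f n t) < e"
      by (meson dist_triangle_half_l)
  qed
  define g where "g t = lim (\<lambda>n. f n t)" for t
  have g: "(\<lambda>n. f n t) \<longlonglongrightarrow> g t" if "t0 \<le> t" for t
    using conv[OF that] unfolding g_def convergent_LIMSEQ_iff .
  have near_g: "norm (g s - f n s) \<le> 2 * (1 / 2) ^ n" if "N' t \<le> n" "t0 \<le> s" "s \<le> t" for n s t
  proof (rule LIMSEQ_le_const2)
    show "(\<lambda>m. norm (f m s - f n s)) \<longlonglongrightarrow> norm (g s - f n s)"
      by (intro tendsto_intros g that)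
    show "\<exists>M. \<forall>m\<ge>M. norm (f m s - f n s) \<le> 2 * (1 / 2) ^ n"
      using near'[OF N'(1)[OF that(1,3)] that(2) N'(2)[OF that(1,3)]] by blast
  qed
  have unif: "uniform_limit {t0..T} f g sequentially" for T
    unfolding uniform_limit_iff
  proof (intro allI impI)
    fix e :: real assume "0 < e"
    then have "\<forall>\<^sub>F n in sequentially. 2 * (1 / 2 :: real) ^ n < e"
      by (intro order_tendstoD(2)[OF half]) simp
    moreover have "\<forall>\<^sub>F n in sequentially. N' T \<le> n" by (rule eventually_ge_at_top)
    ultimately show "\<forall>\<^sub>F n in sequentially. \<forall>x\<in>{t0..T}. dist (f n x) (g x) < e"
    proof eventually_elim
      case (elim n)
      show ?case
      proof
        fix x assume "x \<in> {t0..T}"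
        then show "dist (f n x) (g x) < e"
          using near_g[OF elim(2), of x] elim(1) by (simp add: dist_norm norm_minus_commute)
      qed
    qed
  qed
  have cont_T: "continuous_on {t0..T} g" for T
    by (rule uniform_limit_theorem[OF _ unif])
      (auto intro!: always_eventually continuous_on_subset[OF cont])
  have cont_g: "continuous_on {t0..} g"
    by (rule continuous_on_atLeastI[OF cont_T])
  have "(\<lambda>n. f n (left_grid t0 n t)) \<longlonglongrightarrow> g t" if t: "t0 \<le> t" for t
  proof -
    have lg: "(\<lambda>n. g (left_grid t0 n t)) \<longlonglongrightarrow> g t"
      using t by (intro continuous_on_tendsto_compose[OF cont_g] left_grid_tendsto) (auto simp: left_grid_ge)
    have "(\<lambda>n. f n (left_grid t0 n t) - g (left_grid t0 n t)) \<longlonglongrightarrow> 0"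
    proof (rule Lim_null_comparison[OF _ half])
      show "\<forall>\<^sub>F n in sequentially. norm (f n (left_grid t0 n t) - g (left_grid t0 n t)) \<le> 2 * (1 / 2) ^ n"
        using eventually_ge_at_top[of "N' t"]
      proof eventually_elim
        case (elim n)
        then show ?case
          using near_g[OF elim left_grid_ge[OF t] left_grid_le, of n] by (simp add: norm_minus_commute)
      qed
    qed
    from tendsto_add[OF this lg] show ?thesis by simp
  qed
  then show ?thesis using cont_g unif by blast
qed

lemma (in prob_space) tendsto_AE_imp_tendsto_prob:
  fixes X :: "nat \<Rightarrow> 'a \<Rightarrow> 'k::{real_normed_vector, second_countable_topology}"
  assumes [measurable]: "\<And>n. X n \<in> borel_measurable M" "Y \<in> borel_measurable M"
    and lim: "AE \<omega> in M. (\<lambda>n. X n \<omega>) \<longlonglongrightarrow> Y \<omega>" and "0 < \<epsilon>"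
  shows "(\<lambda>n. prob {\<omega>\<in>space M. \<epsilon> < norm (X n \<omega> - Y \<omega>)}) \<longlonglongrightarrow> 0"
proof -
  let ?A = "\<lambda>n. {\<omega>\<in>space M. \<epsilon> < norm (X n \<omega> - Y \<omega>)}"
  have "(\<lambda>n. \<integral>\<omega>. indicator (?A n) \<omega> \<partial>M) \<longlonglongrightarrow> (\<integral>\<omega>. (0 :: real) \<partial>M)"
  proof (rule integral_dominated_convergence[where w="\<lambda>_. 1"])
    show "AE \<omega> in M. (\<lambda>n. indicator (?A n) \<omega> :: real) \<longlonglongrightarrow> 0"
      using lim
    proof eventually_elim
      case (elim \<omega>)
      have "(\<lambda>n. norm (X n \<omega> - Y \<omega>)) \<longlonglongrightarrow> norm (Y \<omega> - Y \<omega>)"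
        by (intro tendsto_intros elim)
      then have "\<forall>\<^sub>F n in sequentially. norm (X n \<omega> - Y \<omega>) < \<epsilon>"
        using \<open>0 < \<epsilon>\<close> by (intro order_tendstoD) auto
      then show ?case
        by (intro tendsto_eventually) (auto elim!: eventually_mono simp: indicator_def)
    qed
  qed (auto simp: indicator_def)
  then show ?thesis by simp
qed

section \<open>Differences of elementary processes\<close>

definition el_uminus :: "('w, 'u, 'k) elementary \<Rightarrow> ('w, 'u, 'k) elementary" where
  "el_uminus P = map (\<lambda>(a, b, \<xi>, h, y). (a, b, \<lambda>\<omega>. - \<xi> \<omega>, h, y)) P"

abbreviation el_diff :: "('w, 'u, 'k) elementary \<Rightarrow> ('w, 'u, 'k) elementary \<Rightarrow> ('w, 'u, 'k) elementary" where
  "el_diff P Q \<equiv> P @ el_uminus Q"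

lemma elementary_value_diff:
  "elementary_value (el_diff P Q) s \<omega> = elementary_value P s \<omega> - elementary_value Q s \<omega>"
proof -
  have "elementary_value (el_uminus Q) s \<omega> = - elementary_value Q s \<omega>"
    by (induction Q) (auto simp: elementary_value_def el_uminus_def)
  then show ?thesis by (simp add: elementary_value_append)
qed

lemma elementary_integral_diff:
  "elementary_integral W (el_diff P Q) t \<omega> = elementary_integral W P t \<omega> - elementary_integral W Q t \<omega>"
proof -
  have "elementary_integral W (el_uminus Q) t \<omega> = - elementary_integral W Q t \<omega>"
    by (induction Q) (auto simp: elementary_integral_def el_uminus_def)
  then show ?thesis by (simp add: elementary_integral_def)
qed

lemma elementary_process_diff:
  assumes "elementary_process M F t0 P" "elementary_process M F t0 Q"
  shows "elementary_process M F t0 (el_diff P Q)"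
proof -
  have "elementary_process M F t0 (el_uminus Q)"
    using assms(2) unfolding elementary_process_def el_uminus_def by fastforce
  then show ?thesis using assms(1) unfolding elementary_process_def by auto
qed

context brownian_motion
begin

context
  fixes \<Phi> :: "real \<Rightarrow> ('u \<Rightarrow>\<^sub>L 'k::{real_inner, banach, second_countable_topology})" and C :: real
  assumes \<Phi>_meas: "\<And>u. (\<lambda>s. \<Phi> s u) \<in> borel_measurable (restrict_space borel {t0..})"
    and \<Phi>_hs: "\<And>s. t0 \<le> s \<Longrightarrow> hs_norm (\<Phi> s) \<le> ennreal C"
begin

text \<open>Values of \<open>\<Phi>\<close> before \<open>t0\<close> are arbitrary. Extension by
  zero gives an operator function that is measurable and bounded on the whole line, as the
  approximation requires, with the same integrals over \<open>{t0..t}\<close>.\<close>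

lemma extended_measurable: "(\<lambda>s. (if t0 \<le> s then \<Phi> s else 0) u) \<in> borel_measurable borel"
proof -
  have "(\<lambda>s. if s \<in> {t0..} then \<Phi> s u else 0) \<in> borel_measurable borel"
    using \<Phi>_meas[of u] by (subst measurable_restrict_space_iff[symmetric]) auto
  moreover have "(\<lambda>s. if s \<in> {t0..} then \<Phi> s u else 0) = (\<lambda>s. (if t0 \<le> s then \<Phi> s else 0) u)"
    by auto
  ultimately show ?thesis by simp
qed

lemma extended_hs_norm: "hs_norm (if t0 \<le> s then \<Phi> s else 0) \<le> ennreal C"
proof (cases "t0 \<le> s")
  case False
  obtain e :: "nat \<Rightarrow> 'u" where
    hs: "\<And>A :: 'u \<Rightarrow>\<^sub>L 'k. (hs_norm A)\<^sup>2 = (\<Sum>n. ennreal ((norm (A (e n)))\<^sup>2))"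
    using hs_norm_suminf by metis
  have "(hs_norm (0 :: 'u \<Rightarrow>\<^sub>L 'k))\<^sup>2 = 0" by (simp add: hs)
  then show ?thesis using False by simp
qed (simp add: \<Phi>_hs)

definition ito_error :: "('w, 'u, 'k) elementary \<Rightarrow> real \<Rightarrow> 'w \<Rightarrow> ennreal" where
  "ito_error P t \<omega> = (\<integral>\<^sup>+s\<in>{t0..t}. (hs_norm (elementary_value P s \<omega> - \<Phi> s))\<^sup>2 \<partial>lborel)"

lemma ito_error_extended:
  "ito_error P t \<omega> = (\<integral>\<^sup>+s\<in>{t0..t}. (hs_norm (elementary_value P s \<omega> - (if t0 \<le> s then \<Phi> s else 0)))\<^sup>2 \<partial>lborel)"
  unfolding ito_error_def by (intro nn_integral_cong) (auto simp: indicator_def)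

lemma elementary_difference_measurable:
  "(\<lambda>s. (hs_norm (elementary_value P s \<omega> - (if t0 \<le> s then \<Phi> s else 0)))\<^sup>2) \<in> borel_measurable borel"
proof (rule borel_measurable_hs_norm_square)
  fix u
  have [measurable]: "(\<lambda>s. elementary_value P s \<omega> u) \<in> borel_measurable borel"
    unfolding elementary_value_apply
    by (intro borel_measurable_sum borel_measurable_scaleR borel_measurable_times) simp_all
  note [measurable] = extended_measurable[of u]
  show "(\<lambda>s. (elementary_value P s \<omega> - (if t0 \<le> s then \<Phi> s else 0)) u) \<in> borel_measurable borel"
    unfolding blinfun.diff_left by measurable
qed

text \<open>Joint measurability in sample point and time, then Tonelli. It makes the error events of
  the uniqueness argument measurable, so that their probabilities can be compared and added.\<close>

lemma ito_error_measurable: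
  assumes P: "elementary_process M F t0 P"
  shows "ito_error P t \<in> borel_measurable M"
proof -
  have coef [measurable]: "el_coef P i \<in> borel_measurable M" if "i < length P" for i
    by (rule measurable_F_M[OF elementary_processD(3,1)[OF P that]])
  have "(\<lambda>x. (hs_norm (elementary_value P (snd x) (fst x) - (if t0 \<le> snd x then \<Phi> (snd x) else 0)))\<^sup>2)
    \<in> borel_measurable (M \<Otimes>\<^sub>M lborel)"
  proof (rule borel_measurable_hs_norm_square)
    fix u
    have [measurable]: "(\<lambda>x. elementary_value P (snd x) (fst x) u) \<in> borel_measurable (M \<Otimes>\<^sub>M lborel)"
      unfolding elementary_value_apply
    proof (intro borel_measurable_sum borel_measurable_scaleR borel_measurable_times borel_measurable_const)
      fix i assume "i \<in> {..<length P}"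
      then have [measurable]: "el_coef P i \<in> borel_measurable M" using coef by simp
      show "(\<lambda>x. el_coef P i (fst x)) \<in> borel_measurable (M \<Otimes>\<^sub>M lborel)" by measurable
      show "(\<lambda>x. indicat_real {el_start P i<..el_end P i} (snd x)) \<in> borel_measurable (M \<Otimes>\<^sub>M lborel)" by measurable
    qed
    note [measurable] = extended_measurable[of u]
    have [measurable]: "(\<lambda>x. (if t0 \<le> snd x then \<Phi> (snd x) else 0) u) \<in> borel_measurable (M \<Otimes>\<^sub>M lborel)"
      by (rule measurable_compose[OF measurable_snd, where g="\<lambda>s. (if t0 \<le> s then \<Phi> s else 0) u"]) simp
    show "(\<lambda>x. (elementary_value P (snd x) (fst x) - (if t0 \<le> snd x then \<Phi> (snd x) else 0)) u)
      \<in> borel_measurable (M \<Otimes>\<^sub>M lborel)"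
      unfolding blinfun.diff_left by measurable
  qed
  then have [measurable]: "(\<lambda>(\<omega>, s). (hs_norm (elementary_value P s \<omega> - (if t0 \<le> s then \<Phi> s else 0)))\<^sup>2)
    \<in> borel_measurable (M \<Otimes>\<^sub>M lborel)"
    by (simp add: case_prod_beta')
  have "(\<lambda>\<omega>. \<integral>\<^sup>+s\<in>{t0..t}. (hs_norm (elementary_value P s \<omega> - (if t0 \<le> s then \<Phi> s else 0)))\<^sup>2 \<partial>lborel)
    \<in> borel_measurable M"
    by (rule lborel.borel_measurable_nn_integral) (simp add: case_prod_beta', measurable)
  then show ?thesis unfolding ito_error_extended[abs_def] .
qed

lemma elementary_value_diff_le:
  "(\<integral>\<^sup>+s\<in>{t0..t}. (hs_norm (elementary_value (el_diff P Q) s \<omega>))\<^sup>2 \<partial>lborel) \<le>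
    2 * ito_error P t \<omega> + 2 * ito_error Q t \<omega>"
proof -
  let ?\<Psi> = "\<lambda>s. if t0 \<le> s then \<Phi> s else 0"
  let ?p = "\<lambda>s. (hs_norm (elementary_value P s \<omega> - ?\<Psi> s))\<^sup>2"
  let ?q = "\<lambda>s. (hs_norm (elementary_value Q s \<omega> - ?\<Psi> s))\<^sup>2"
  have [measurable]: "?p \<in> borel_measurable borel" "?q \<in> borel_measurable borel"
    by (rule elementary_difference_measurable)+
  have le: "(hs_norm (elementary_value (el_diff P Q) s \<omega>))\<^sup>2 \<le> 2 * ?p s + 2 * ?q s" for s
  proof -
    have "(hs_norm (elementary_value (el_diff P Q) s \<omega>))\<^sup>2 \<le>
      2 * ?p s + 2 * (hs_norm (?\<Psi> s - elementary_value Q s \<omega>))\<^sup>2"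
      by (rule hs_norm_add_square_le) (simp add: elementary_value_diff blinfun.diff_left)
    also have "(hs_norm (?\<Psi> s - elementary_value Q s \<omega>))\<^sup>2 = ?q s"
      by (rule hs_norm_uminus_square) (simp add: blinfun.diff_left)
    finally show ?thesis .
  qed
  have "(\<integral>\<^sup>+s\<in>{t0..t}. (hs_norm (elementary_value (el_diff P Q) s \<omega>))\<^sup>2 \<partial>lborel) \<le>
    (\<integral>\<^sup>+s. 2 * (?p s * indicator {t0..t} s) + 2 * (?q s * indicator {t0..t} s) \<partial>lborel)"
  proof (intro nn_integral_mono)
    fix s show "(hs_norm (elementary_value (el_diff P Q) s \<omega>))\<^sup>2 * indicator {t0..t} s \<le>
      2 * (?p s * indicator {t0..t} s) + 2 * (?q s * indicator {t0..t} s)"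
      using le[of s] by (cases "s \<in> {t0..t}") (simp_all del: if_split)
  qed
  also have "\<dots> = 2 * (\<integral>\<^sup>+s\<in>{t0..t}. ?p s \<partial>lborel) + 2 * (\<integral>\<^sup>+s\<in>{t0..t}. ?q s \<partial>lborel)"
    by (subst nn_integral_add) (simp_all add: nn_integral_cmult)
  finally show ?thesis unfolding ito_error_extended .
qed

lemma elementary_value_le:
  assumes "t0 \<le> t"
  shows "(\<integral>\<^sup>+s\<in>{t0..t}. (hs_norm (elementary_value P s \<omega>))\<^sup>2 \<partial>lborel) \<le>
    2 * ito_error P t \<omega> + ennreal (2 * C\<^sup>2 * (t - t0))"
proof -
  let ?\<Psi> = "\<lambda>s. if t0 \<le> s then \<Phi> s else 0"
  let ?p = "\<lambda>s. (hs_norm (elementary_value P s \<omega> - ?\<Psi> s))\<^sup>2"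
  have [measurable]: "?p \<in> borel_measurable borel"
    by (rule elementary_difference_measurable)
  have le: "(hs_norm (elementary_value P s \<omega>))\<^sup>2 \<le> 2 * ?p s + ennreal (2 * C\<^sup>2)" for s
  proof -
    have "(hs_norm (?\<Psi> s))\<^sup>2 \<le> (ennreal C)\<^sup>2" by (intro power_mono extended_hs_norm) auto
    also have "\<dots> \<le> ennreal (C\<^sup>2)" by (cases "0 \<le> C") (auto simp: ennreal_power ennreal_neg)
    finally have C: "2 * (hs_norm (?\<Psi> s))\<^sup>2 \<le> 2 * ennreal (C\<^sup>2)" by (intro mult_left_mono) auto
    have "(hs_norm (elementary_value P s \<omega>))\<^sup>2 \<le> 2 * ?p s + 2 * (hs_norm (?\<Psi> s))\<^sup>2"
      by (rule hs_norm_add_square_le) (simp add: blinfun.diff_left)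
    also have "\<dots> \<le> 2 * ?p s + 2 * ennreal (C\<^sup>2)" using C by (intro add_mono) auto
    also have "2 * ennreal (C\<^sup>2) = ennreal (2 * C\<^sup>2)" by (simp add: ennreal_mult)
    finally show ?thesis .
  qed
  have "(\<integral>\<^sup>+s\<in>{t0..t}. (hs_norm (elementary_value P s \<omega>))\<^sup>2 \<partial>lborel) \<le>
    (\<integral>\<^sup>+s. 2 * (?p s * indicator {t0..t} s) + ennreal (2 * C\<^sup>2) * indicator {t0..t} s \<partial>lborel)"
  proof (intro nn_integral_mono)
    fix s show "(hs_norm (elementary_value P s \<omega>))\<^sup>2 * indicator {t0..t} s \<le>
      2 * (?p s * indicator {t0..t} s) + ennreal (2 * C\<^sup>2) * indicator {t0..t} s"
      using le[of s] by (cases "s \<in> {t0..t}") (simp_all del: if_split)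
  qed
  also have "\<dots> = 2 * (\<integral>\<^sup>+s\<in>{t0..t}. ?p s \<partial>lborel) + ennreal (2 * C\<^sup>2) * ennreal (t - t0)"
    using assms by (subst nn_integral_add) (simp_all add: nn_integral_cmult nn_integral_cmult_indicator)
  also have "ennreal (2 * C\<^sup>2) * ennreal (t - t0) = ennreal (2 * C\<^sup>2 * (t - t0))"
    using assms by (subst ennreal_mult) auto
  finally show ?thesis unfolding ito_error_extended .
qed

text \<open>\<open>I\<close> and \<open>J\<close> may come from different sequences of random
  processes. The difference of the two approximants has small squared Hilbert-Schmidt integral in
  probability, which \<open>elementary_integral_lenglart\<close> turns into a small stochastic
  integral. The index tends to infinity before \<open>\<delta>\<close> tends to zero.\<close>

lemma has_ito_integral_unique:
  assumes I: "has_ito_integral M F t0 W t (\<lambda>s \<omega>. \<Phi> s) I"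
    and J: "has_ito_integral M F t0 W t (\<lambda>s \<omega>. \<Phi> s) J" and "t0 \<le> t"
  shows "AE \<omega> in M. I \<omega> = J \<omega>"
proof -
  obtain P where P: "\<And>n. elementary_process M F t0 (P n)"
    "\<And>\<epsilon>. 0 < \<epsilon> \<Longrightarrow> (\<lambda>n. prob {\<omega>\<in>space M. ennreal \<epsilon> < ito_error (P n) t \<omega>}) \<longlonglongrightarrow> 0"
    "\<And>\<epsilon>. 0 < \<epsilon> \<Longrightarrow> (\<lambda>n. prob {\<omega>\<in>space M. \<epsilon> < norm (elementary_integral W (P n) t \<omega> - I \<omega>)}) \<longlonglongrightarrow> 0"
    using I unfolding has_ito_integral_def ito_error_def by blast
  obtain Q where Q: "\<And>n. elementary_process M F t0 (Q n)"
    "\<And>\<epsilon>. 0 < \<epsilon> \<Longrightarrow> (\<lambda>n. prob {\<omega>\<in>space M. ennreal \<epsilon> < ito_error (Q n) t \<omega>}) \<longlonglongrightarrow> 0"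
    "\<And>\<epsilon>. 0 < \<epsilon> \<Longrightarrow> (\<lambda>n. prob {\<omega>\<in>space M. \<epsilon> < norm (elementary_integral W (Q n) t \<omega> - J \<omega>)}) \<longlonglongrightarrow> 0"
    using J unfolding has_ito_integral_def ito_error_def by blast
  have [measurable]: "I \<in> borel_measurable M" "J \<in> borel_measurable M"
    using I J by (auto simp: has_ito_integral_def)
  note [measurable] = ito_error_measurable[OF P(1)] ito_error_measurable[OF Q(1)]
    elementary_integral_measurable(2)[OF P(1) \<open>t0 \<le> t\<close>] elementary_integral_measurable(2)[OF Q(1) \<open>t0 \<le> t\<close>]
  have bound: "prob {\<omega>\<in>space M. \<epsilon> < norm (I \<omega> - J \<omega>)} \<le> \<delta> / (\<epsilon> / 3)\<^sup>2" if "0 < \<epsilon>" "0 < \<delta>" for \<epsilon> \<delta>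
  proof (rule LIMSEQ_le_const)
    let ?a = "\<lambda>n. prob {\<omega>\<in>space M. \<epsilon> / 3 < norm (elementary_integral W (P n) t \<omega> - I \<omega>)}"
    let ?b = "\<lambda>n. prob {\<omega>\<in>space M. \<epsilon> / 3 < norm (elementary_integral W (Q n) t \<omega> - J \<omega>)}"
    \<comment> \<open>Each error is doubled in \<open>elementary_value_diff_le\<close>, so two
      errors of at most \<open>\<delta> / 4\<close> keep the variance of the difference at most
      \<open>\<delta>\<close>.\<close>
    let ?c = "\<lambda>n. prob {\<omega>\<in>space M. ennreal (\<delta> / 4) < ito_error (P n) t \<omega>}"
    let ?d = "\<lambda>n. prob {\<omega>\<in>space M. ennreal (\<delta> / 4) < ito_error (Q n) t \<omega>}"
    have "(\<lambda>n. ?a n + ?b n + (?c n + ?d n + \<delta> / (\<epsilon> / 3)\<^sup>2)) \<longlonglongrightarrow> 0 + 0 + (0 + 0 + \<delta> / (\<epsilon> / 3)\<^sup>2)"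
      using that by (intro tendsto_add tendsto_const P(2,3) Q(2,3)) auto
    then show "(\<lambda>n. ?a n + ?b n + (?c n + ?d n + \<delta> / (\<epsilon> / 3)\<^sup>2)) \<longlonglongrightarrow> \<delta> / (\<epsilon> / 3)\<^sup>2" by simp
    have "prob {\<omega>\<in>space M. \<epsilon> < norm (I \<omega> - J \<omega>)} \<le> ?a n + ?b n + (?c n + ?d n + \<delta> / (\<epsilon> / 3)\<^sup>2)" for n
    proof -
      let ?R = "el_diff (P n) (Q n)"
      have R: "elementary_process M F t0 ?R" by (rule elementary_process_diff[OF P(1) Q(1)])
      note [measurable] = elementary_integral_measurable(2)[OF R \<open>t0 \<le> t\<close>]
      have "{\<omega>\<in>space M. \<epsilon> < norm (I \<omega> - J \<omega>)} \<subseteq>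
        ({\<omega>\<in>space M. \<epsilon> / 3 < norm (elementary_integral W (P n) t \<omega> - I \<omega>)} \<union>
        {\<omega>\<in>space M. \<epsilon> / 3 < norm (elementary_integral W (Q n) t \<omega> - J \<omega>)}) \<union>
        {\<omega>\<in>space M. \<epsilon> / 3 < norm (elementary_integral W ?R t \<omega>)}"
      proof (intro subsetI, rule ccontr)
        fix \<omega> assume \<omega>: "\<omega> \<in> {\<omega>\<in>space M. \<epsilon> < norm (I \<omega> - J \<omega>)}"
        assume "\<omega> \<notin> ({\<omega>\<in>space M. \<epsilon> / 3 < norm (elementary_integral W (P n) t \<omega> - I \<omega>)} \<union>
        {\<omega>\<in>space M. \<epsilon> / 3 < norm (elementary_integral W (Q n) t \<omega> - J \<omega>)}) \<union>
        {\<omega>\<in>space M. \<epsilon> / 3 < norm (elementary_integral W ?R t \<omega>)}"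
        then have le: "norm (I \<omega> - elementary_integral W (P n) t \<omega>) \<le> \<epsilon> / 3"
          "norm (elementary_integral W (Q n) t \<omega> - J \<omega>) \<le> \<epsilon> / 3"
          "norm (elementary_integral W (P n) t \<omega> - elementary_integral W (Q n) t \<omega>) \<le> \<epsilon> / 3"
          using \<omega> by (auto simp: not_less elementary_integral_diff norm_minus_commute)
        have "I \<omega> - J \<omega> = (I \<omega> - elementary_integral W (P n) t \<omega>) +
          (elementary_integral W (P n) t \<omega> - elementary_integral W (Q n) t \<omega>) + (elementary_integral W (Q n) t \<omega> - J \<omega>)"
          by simp
        then have "norm (I \<omega> - J \<omega>) \<le> \<epsilon> / 3 + \<epsilon> / 3 + \<epsilon> / 3"
          using norm_triangle_le[OF add_mono[OF norm_triangle_le[OF add_mono[OF le(1,3)]] le(2)]] by metis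
        then show False using \<omega> by simp
      qed
      then have "prob {\<omega>\<in>space M. \<epsilon> < norm (I \<omega> - J \<omega>)} \<le> prob (({\<omega>\<in>space M. \<epsilon> / 3 < norm (elementary_integral W (P n) t \<omega> - I \<omega>)} \<union>
        {\<omega>\<in>space M. \<epsilon> / 3 < norm (elementary_integral W (Q n) t \<omega> - J \<omega>)}) \<union>
        {\<omega>\<in>space M. \<epsilon> / 3 < norm (elementary_integral W ?R t \<omega>)})"
        by (rule finite_measure_mono) measurable
      also have "\<dots> \<le> (?a n + ?b n) + prob {\<omega>\<in>space M. \<epsilon> / 3 < norm (elementary_integral W ?R t \<omega>)}"
        by (rule order_trans[OF measure_Un_le add_right_mono[OF measure_Un_le]]) measurable
      also have "prob {\<omega>\<in>space M. \<epsilon> / 3 < norm (elementary_integral W ?R t \<omega>)} \<le>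
        prob {\<omega>\<in>space M. ennreal \<delta> < (\<integral>\<^sup>+s\<in>{t0..t}. (hs_norm (elementary_value ?R s \<omega>))\<^sup>2 \<partial>lborel)} + \<delta> / (\<epsilon> / 3)\<^sup>2"
        using that by (intro elementary_integral_lenglart[OF R \<open>t0 \<le> t\<close>]) auto
      also have "prob {\<omega>\<in>space M. ennreal \<delta> < (\<integral>\<^sup>+s\<in>{t0..t}. (hs_norm (elementary_value ?R s \<omega>))\<^sup>2 \<partial>lborel)} \<le>
        prob ({\<omega>\<in>space M. ennreal (\<delta> / 4) < ito_error (P n) t \<omega>} \<union> {\<omega>\<in>space M. ennreal (\<delta> / 4) < ito_error (Q n) t \<omega>})"
      proof (rule finite_measure_mono)
        show "{\<omega>\<in>space M. ennreal \<delta> < (\<integral>\<^sup>+s\<in>{t0..t}. (hs_norm (elementary_value ?R s \<omega>))\<^sup>2 \<partial>lborel)} \<subseteq>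
          {\<omega>\<in>space M. ennreal (\<delta> / 4) < ito_error (P n) t \<omega>} \<union> {\<omega>\<in>space M. ennreal (\<delta> / 4) < ito_error (Q n) t \<omega>}"
        proof (intro subsetI, rule ccontr)
          fix \<omega> assume \<omega>: "\<omega> \<in> {\<omega>\<in>space M. ennreal \<delta> < (\<integral>\<^sup>+s\<in>{t0..t}. (hs_norm (elementary_value ?R s \<omega>))\<^sup>2 \<partial>lborel)}"
          assume "\<omega> \<notin> {\<omega>\<in>space M. ennreal (\<delta> / 4) < ito_error (P n) t \<omega>} \<union> {\<omega>\<in>space M. ennreal (\<delta> / 4) < ito_error (Q n) t \<omega>}"
          then have "ito_error (P n) t \<omega> \<le> ennreal (\<delta> / 4)" "ito_error (Q n) t \<omega> \<le> ennreal (\<delta> / 4)"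
            using \<omega> by (auto simp: not_less)
          then have "2 * ito_error (P n) t \<omega> + 2 * ito_error (Q n) t \<omega> \<le> 2 * ennreal (\<delta> / 4) + 2 * ennreal (\<delta> / 4)"
            by (intro add_mono mult_left_mono) auto
          also have "\<dots> = ennreal (2 * (\<delta> / 4) + 2 * (\<delta> / 4))"
          proof -
            have two: "ennreal (2 * (\<delta> / 4)) = 2 * ennreal (\<delta> / 4)"
              using \<open>0 < \<delta>\<close> by (subst ennreal_mult) simp_all
            show ?thesis
              unfolding two[symmetric] using \<open>0 < \<delta>\<close> by (intro ennreal_plus[symmetric]) simp_all
          qed
          also have "\<dots> = ennreal \<delta>" by simp
          finally have "(\<integral>\<^sup>+s\<in>{t0..t}. (hs_norm (elementary_value ?R s \<omega>))\<^sup>2 \<partial>lborel) \<le> ennreal \<delta>"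
            using elementary_value_diff_le order_trans by blast
          then show False using \<omega> by (simp add: not_less[symmetric])
        qed
      qed measurable
      also have "\<dots> \<le> ?c n + ?d n" by (rule measure_Un_le) measurable
      finally show ?thesis by simp
    qed
    then show "\<exists>N. \<forall>n\<ge>N. prob {\<omega>\<in>space M. \<epsilon> < norm (I \<omega> - J \<omega>)} \<le> ?a n + ?b n + (?c n + ?d n + \<delta> / (\<epsilon> / 3)\<^sup>2)"
      by blast
  qed
  have zero: "prob {\<omega>\<in>space M. \<epsilon> < norm (I \<omega> - J \<omega>)} = 0" if "0 < \<epsilon>" for \<epsilon>
  proof -
    \<comment> \<open>With \<open>\<delta>\<close> equal to \<open>e\<close> times the square of
      \<open>\<epsilon> / 3\<close>, the bound is exactly \<open>e\<close>.\<close>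
    have "prob {\<omega>\<in>space M. \<epsilon> < norm (I \<omega> - J \<omega>)} \<le> 0 + e" if "0 < e" for e
      using bound[OF \<open>0 < \<epsilon>\<close>, of "e * (\<epsilon> / 3)\<^sup>2"] that \<open>0 < \<epsilon>\<close> by simp
    then have "prob {\<omega>\<in>space M. \<epsilon> < norm (I \<omega> - J \<omega>)} \<le> 0" by (rule field_le_epsilon)
    then show ?thesis by (simp add: antisym)
  qed
  have "AE \<omega> in M. \<forall>m::nat. norm (I \<omega> - J \<omega>) \<le> 1 / (real m + 1)"
  proof (rule AE_all_countable[THEN iffD2], rule allI)
    fix m :: nat
    have "AE \<omega> in M. \<omega> \<notin> {\<omega>\<in>space M. 1 / (real m + 1) < norm (I \<omega> - J \<omega>)}"
      using zero[of "1 / (real m + 1)"] by (subst prob_eq_0[symmetric]) auto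
    then show "AE \<omega> in M. norm (I \<omega> - J \<omega>) \<le> 1 / (real m + 1)"
      using AE_space by eventually_elim (auto simp: not_less)
  qed
  then show ?thesis
  proof eventually_elim
    case (elim \<omega>)
    have "norm (I \<omega> - J \<omega>) \<le> 0"
    proof (rule LIMSEQ_le_const)
      show "(\<lambda>m. 1 / (real m + 1)) \<longlonglongrightarrow> 0" by real_asymp
    qed (use elim in blast)
    then show ?case by simp
  qed
qed

lemma ito_error_mono: "t \<le> t' \<Longrightarrow> ito_error P t \<omega> \<le> ito_error P t' \<omega>"
  unfolding ito_error_def by (intro nn_integral_mono) (auto simp: indicator_def)

section \<open>Construction of the Wiener integral\<close>

text \<open>The rate 1/16 is matched to the maximal inequality at level \<open>(1 / 2) ^ n\<close>:
  division by the squared level \<open>(1 / 4) ^ n\<close> leaves a multiple of the summable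
  \<open>(1 / 4) ^ n\<close>. The interval grows with \<open>n\<close>, so one sequence serves all
  times.\<close>

lemma ito_approximation_exists:
  "\<exists>P. \<forall>n. elementary_process M F t0 (P n) \<and> el_deterministic (P n) \<and>
     (\<forall>\<omega>. ito_error (P n) (t0 + real n + 1) \<omega> \<le> ennreal ((1 / 16) ^ n))"
proof (rule choice, rule allI)
  fix n :: nat
  show "\<exists>P. elementary_process M F t0 P \<and> el_deterministic P \<and>
    (\<forall>\<omega>. ito_error P (t0 + real n + 1) \<omega> \<le> ennreal ((1 / 16) ^ n))"
    using hilbert_schmidt_step_approx[of "\<lambda>s. if t0 \<le> s then \<Phi> s else 0" C t0 "t0 + real n + 1" "(1 / 16) ^ n" M F,
        OF extended_measurable extended_hs_norm]
    unfolding ito_error_extended el_deterministic_def by simp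
qed

definition ito_approx :: "nat \<Rightarrow> ('w, 'u, 'k) elementary" where
  "ito_approx = (SOME P. \<forall>n. elementary_process M F t0 (P n) \<and> el_deterministic (P n) \<and>
     (\<forall>\<omega>. ito_error (P n) (t0 + real n + 1) \<omega> \<le> ennreal ((1 / 16) ^ n)))"

lemma ito_approx:
  "elementary_process M F t0 (ito_approx n)" "el_deterministic (ito_approx n)"
  "t \<le> t0 + real n + 1 \<Longrightarrow> ito_error (ito_approx n) t \<omega> \<le> ennreal ((1 / 16) ^ n)"
proof -
  have *: "\<forall>n. elementary_process M F t0 (ito_approx n) \<and> el_deterministic (ito_approx n) \<and>
     (\<forall>\<omega>. ito_error (ito_approx n) (t0 + real n + 1) \<omega> \<le> ennreal ((1 / 16) ^ n))"
    using someI_ex[OF ito_approximation_exists] unfolding ito_approx_def .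
  then show "elementary_process M F t0 (ito_approx n)" "el_deterministic (ito_approx n)" by blast+
  assume "t \<le> t0 + real n + 1"
  then show "ito_error (ito_approx n) t \<omega> \<le> ennreal ((1 / 16) ^ n)"
    using ito_error_mono * order_trans by blast
qed

text \<open>
  Evaluating the approximations at grid points to the left makes the limit progressively measurable
  with respect to the raw filtration, although the coordinates of \<open>W\<close> are continuous only almost surely.
\<close>

definition wiener_integral :: "real \<Rightarrow> 'w \<Rightarrow> 'k" where
  "wiener_integral t \<omega> = lim (\<lambda>n. elementary_integral W (ito_approx n) (left_grid t0 n t) \<omega>)"

text \<open>The maximal inequality on the countable set of rational times makes the exceptional
  probabilities summable; Borel-Cantelli gives the bound there, and continuity of elementary
  integrals extends it to all times.\<close>

lemma ito_approx_increment:
  "AE \<omega> in M. \<exists>N. \<forall>n\<ge>N. \<forall>t. t0 \<le> t \<longrightarrow> t \<le> t0 + real n + 1 \<longrightarrow>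
    norm (elementary_integral W (ito_approx (Suc n)) t \<omega> - elementary_integral W (ito_approx n) t \<omega>) \<le> (1 / 2) ^ n"
proof -
  let ?R = "\<lambda>n. el_diff (ito_approx (Suc n)) (ito_approx n)"
  have R: "elementary_process M F t0 (?R n)" for n
    by (rule elementary_process_diff[OF ito_approx(1) ito_approx(1)])
  define B where "B n t = {\<omega>\<in>space M. (1 / 2) ^ n < norm (elementary_integral W (?R n) t \<omega>)}" for n t
  define A where "A n = (\<Union>t\<in>rat_times t0 (t0 + real n + 1). B n t)" for n
  have B: "B n t \<in> events" if "t \<in> rat_times t0 T" for n t T
  proof -
    have [measurable]: "elementary_integral W (?R n) t \<in> borel_measurable M"
      using that by (intro elementary_integral_measurable(2)[OF R]) (simp add: rat_times_def)
    show ?thesis unfolding B_def by measurable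
  qed
  have A: "A n \<in> events" for n
    unfolding A_def using B countable_rat_times by (intro sets.countable_UN') auto
  have error: "(\<integral>\<^sup>+s\<in>{t0..t0 + real n + 1}. (hs_norm (elementary_value (?R n) s \<omega>))\<^sup>2 \<partial>lborel) \<le> ennreal (4 * (1 / 16) ^ n)" for n \<omega>
  proof -
    have "(\<integral>\<^sup>+s\<in>{t0..t0 + real n + 1}. (hs_norm (elementary_value (?R n) s \<omega>))\<^sup>2 \<partial>lborel) \<le>
      2 * ito_error (ito_approx (Suc n)) (t0 + real n + 1) \<omega> + 2 * ito_error (ito_approx n) (t0 + real n + 1) \<omega>"
      by (rule elementary_value_diff_le)
    also have "\<dots> \<le> 2 * ennreal ((1 / 16) ^ Suc n) + 2 * ennreal ((1 / 16) ^ n)"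
      by (intro add_mono mult_left_mono ito_approx(3)) auto
    also have "\<dots> \<le> 2 * ennreal ((1 / 16) ^ n) + 2 * ennreal ((1 / 16) ^ n)"
      by (intro add_mono mult_left_mono ennreal_leI power_decreasing) auto
    also have "\<dots> = 4 * ennreal ((1 / 16) ^ n)" by (simp add: distrib_right[symmetric])
    also have "\<dots> = ennreal (4 * (1 / 16) ^ n)" by (subst ennreal_mult) simp_all
    finally show ?thesis .
  qed
  have prob_A: "prob (A n) \<le> 4 * (1 / 4) ^ n" for n
  proof -
    have "prob (A n) \<le> (4 * (1 / 16) ^ n) / ((1 / 2) ^ n)\<^sup>2"
      unfolding A_def
    proof (rule prob_countable_Union_le[OF countable_rat_times B])
      fix Q assume Q: "finite Q" "Q \<subseteq> rat_times t0 (t0 + real n + 1)"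
      have "(\<Union>t\<in>Q. B n t) = {\<omega>\<in>space M. \<exists>t\<in>Q. (1 / 2) ^ n < norm (elementary_integral W (?R n) t \<omega>)}"
        by (auto simp: B_def)
      also have "prob \<dots> \<le> (4 * (1 / 16) ^ n) / ((1 / 2) ^ n)\<^sup>2"
        using Q(2) by (intro elementary_integral_maximal[OF R _ _ _ Q(1) _ error]) (auto simp: rat_times_def)
      finally show "prob (\<Union>t\<in>Q. B n t) \<le> (4 * (1 / 16) ^ n) / ((1 / 2) ^ n)\<^sup>2" .
    qed
    also have "\<dots> = 4 * (1 / 4) ^ n"
    proof -
      have "(1 / 16 :: real) ^ n = (1 / 4) ^ n * (1 / 4) ^ n" "((1 / 2 :: real) ^ n)\<^sup>2 = (1 / 4) ^ n"
        by (simp_all add: power2_eq_square power_mult_distrib[symmetric])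
      then show ?thesis by simp
    qed
    finally show ?thesis .
  qed
  have "AE \<omega> in M. \<forall>\<^sub>F n in sequentially. \<omega> \<in> space M - A n"
  proof (rule borel_cantelli_AE1[OF A])
    show "summable (\<lambda>n. prob (A n))"
    proof (rule summable_comparison_test)
      show "\<exists>N. \<forall>n\<ge>N. norm (prob (A n)) \<le> 4 * (1 / 4) ^ n" using prob_A by auto
      show "summable (\<lambda>n. 4 * (1 / 4 :: real) ^ n)" by (intro summable_mult) simp
    qed
  qed (simp add: less_top[symmetric])
  moreover have "AE \<omega> in M. \<forall>n. continuous_on {t0..} (\<lambda>t. elementary_integral W (?R n) t \<omega>)"
    using elementary_integral_continuous[OF R] by (simp add: AE_all_countable)
  ultimately show ?thesis
  proof eventually_elim
    case (elim \<omega>)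
    obtain N where N: "\<And>n. N \<le> n \<Longrightarrow> \<omega> \<in> space M - A n"
      using elim(1) by (auto simp: eventually_sequentially)
    show ?case
    proof (intro exI allI impI)
      fix n t assume n: "N \<le> n" and t: "t0 \<le> t" "t \<le> t0 + real n + 1"
      have "norm (elementary_integral W (?R n) t \<omega>) \<le> (1 / 2) ^ n"
      proof (rule rat_times_closed_bound[OF _ _ t, where w="\<lambda>t. norm (elementary_integral W (?R n) t \<omega>)"])
        show "continuous_on {t0..} (\<lambda>t. norm (elementary_integral W (?R n) t \<omega>))"
          using elim(2) by (intro continuous_on_norm) blast
        show "norm (elementary_integral W (?R n) t \<omega>) \<le> (1 / 2) ^ n" if "t \<in> rat_times t0 (t0 + real n + 1)" for t
          using N[OF n] that by (auto simp: A_def B_def not_less)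
      qed
      then show "norm (elementary_integral W (ito_approx (Suc n)) t \<omega> - elementary_integral W (ito_approx n) t \<omega>) \<le> (1 / 2) ^ n"
        by (simp add: elementary_integral_diff)
    qed
  qed
qed

text \<open>Almost surely the approximations taken at \<open>t\<close> itself converge to the same
  value as those taken at \<open>left_grid\<close> times. The latter give measurability, the former
  the integral and its moments.\<close>

lemma wiener_integral_limit:
  "AE \<omega> in M. continuous_on {t0..} (\<lambda>t. wiener_integral t \<omega>) \<and>
    (\<forall>t\<ge>t0. (\<lambda>n. elementary_integral W (ito_approx n) t \<omega>) \<longlonglongrightarrow> wiener_integral t \<omega>)"
proof -
  have "AE \<omega> in M. \<forall>n. continuous_on {t0..} (\<lambda>t. elementary_integral W (ito_approx n) t \<omega>)"
    using elementary_integral_continuous[OF ito_approx(1)] by (simp add: AE_all_countable)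
  with ito_approx_increment show ?thesis
  proof eventually_elim
    case (elim \<omega>)
    then obtain N where N: "\<And>n t. N \<le> n \<Longrightarrow> t0 \<le> t \<Longrightarrow> t \<le> t0 + real n + 1 \<Longrightarrow>
      norm (elementary_integral W (ito_approx (Suc n)) t \<omega> - elementary_integral W (ito_approx n) t \<omega>) \<le> (1 / 2) ^ n"
      by blast
    obtain g where g: "continuous_on {t0..} g"
      "\<And>T. uniform_limit {t0..T} (\<lambda>n t. elementary_integral W (ito_approx n) t \<omega>) g sequentially"
      "\<And>t. t0 \<le> t \<Longrightarrow> (\<lambda>n. elementary_integral W (ito_approx n) (left_grid t0 n t) \<omega>) \<longlonglongrightarrow> g t"
      using geometric_uniform_limit[of t0 "\<lambda>n t. elementary_integral W (ito_approx n) t \<omega>" N] elim(2) N by blast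
    have eq: "wiener_integral t \<omega> = g t" if "t0 \<le> t" for t
      unfolding wiener_integral_def by (rule limI) (rule g(3)[OF that])
    have "(\<lambda>n. elementary_integral W (ito_approx n) t \<omega>) \<longlonglongrightarrow> g t" if "t0 \<le> t" for t
      using tendsto_uniform_limitI[OF g(2)[of t], of t] that by simp
    moreover have "continuous_on {t0..} (\<lambda>t. wiener_integral t \<omega>) \<longleftrightarrow> continuous_on {t0..} g"
      by (intro continuous_on_cong) (auto simp: eq)
    ultimately show ?case using g(1) eq by simp
  qed
qed

text \<open>Measurability passes to \<open>lim\<close> whether or not the sequence converges at a
  given sample point, so it suffices to treat each approximation at the rounded time.\<close>

lemma wiener_integral_progressive: "progressively_measurable F t0 wiener_integral"
  unfolding progressively_measurable_def
proof (intro allI impI)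
  fix T assume "t0 \<le> T"
  let ?N = "restrict_space borel {t0..T} \<Otimes>\<^sub>M F T"
  have "(\<lambda>x. lim (\<lambda>n. elementary_integral W (ito_approx n) (left_grid t0 n (fst x)) (snd x))) \<in> borel_measurable ?N"
  proof (rule borel_measurable_lim_metric)
    fix n
    define \<tau> where "\<tau> i = t0 + real_of_int i / (real n + 1)" for i
    \<comment> \<open>The time is frozen at the grid point with index \<open>i\<close>, and the
      rounding index then selects among countably many such functions. For grid points outside
      \<open>{t0..T}\<close> the value 0 keeps \<open>f i\<close> measurable, and these indices are
      never selected.\<close>
    define f where "f i x = (if t0 \<le> \<tau> i \<and> \<tau> i \<le> T then elementary_integral W (ito_approx n) (\<tau> i) (snd x) else 0)"
      for i and x :: "real \<times> 'w"
    have f [measurable]: "f i \<in> borel_measurable ?N" for i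
    proof (cases "t0 \<le> \<tau> i \<and> \<tau> i \<le> T")
      case True
      have "elementary_integral W (ito_approx n) (\<tau> i) \<in> borel_measurable (F T)"
        using True by (intro measurable_F_mono[OF elementary_integral_measurable(1)[OF ito_approx(1)]]) auto
      then have "(\<lambda>x. elementary_integral W (ito_approx n) (\<tau> i) (snd x)) \<in> borel_measurable ?N"
        by (rule measurable_compose[OF measurable_snd])
      then show ?thesis using True by (simp add: f_def[abs_def])
    qed (auto simp: f_def[abs_def])
    have [measurable]: "(\<lambda>x. fst x) \<in> borel_measurable ?N"
      by (rule measurable_compose[OF measurable_fst]) (simp add: measurable_restrict_space1)
    have "(\<lambda>x. f \<lfloor>(fst x - t0) * (real n + 1)\<rfloor> x) \<in> borel_measurable ?N"
      by (rule measurable_compose_countable[OF f]) measurable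
    moreover have "f \<lfloor>(fst x - t0) * (real n + 1)\<rfloor> x =
        elementary_integral W (ito_approx n) (left_grid t0 n (fst x)) (snd x)" if "x \<in> space ?N" for x
    proof -
      have x: "t0 \<le> fst x" "fst x \<le> T" using that by (auto simp: space_pair_measure)
      have "\<tau> \<lfloor>(fst x - t0) * (real n + 1)\<rfloor> = left_grid t0 n (fst x)" by (simp add: \<tau>_def left_grid_def)
      then show ?thesis
        using left_grid_ge[OF x(1), of n] left_grid_le[of t0 n "fst x"] x(2) by (simp add: f_def)
    qed
    ultimately show "(\<lambda>x. elementary_integral W (ito_approx n) (left_grid t0 n (fst x)) (snd x)) \<in> borel_measurable ?N"
      by (subst measurable_cong[of _ _ "\<lambda>x. f \<lfloor>(fst x - t0) * (real n + 1)\<rfloor> x"]) auto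
  qed
  then show "(\<lambda>(s, \<omega>). wiener_integral s \<omega>) \<in> borel_measurable ?N"
    by (simp add: wiener_integral_def case_prod_beta')
qed

lemma wiener_integral_measurable:
  assumes "t0 \<le> t"
  shows "wiener_integral t \<in> borel_measurable M"
proof -
  have "(\<lambda>\<omega>. lim (\<lambda>n. elementary_integral W (ito_approx n) (left_grid t0 n t) \<omega>)) \<in> borel_measurable M"
    by (intro borel_measurable_lim_metric elementary_integral_measurable(2) ito_approx(1) left_grid_ge assms)
  then show ?thesis by (simp add: wiener_integral_def[abs_def])
qed

lemma wiener_integral_start: "wiener_integral t0 \<omega> = 0"
proof -
  have "elementary_integral W (ito_approx n) t0 \<omega> = 0" for n
  proof -
    have "min t0 (el_end (ito_approx n) i) = t0" "min t0 (el_start (ito_approx n) i) = t0" if "i < length (ito_approx n)" for i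
      using elementary_processD(1,2)[OF ito_approx(1) that] by auto
    then show ?thesis unfolding elementary_integral_sum by simp
  qed
  then show ?thesis by (simp add: wiener_integral_def left_grid_def)
qed

text \<open>The error of the approximations is bounded at every sample point, so the first
  probability is eventually zero; the second tends to zero by almost sure convergence.\<close>

lemma wiener_integral_has_ito_integral:
  assumes "t0 \<le> t"
  shows "has_ito_integral M F t0 W t (\<lambda>s \<omega>. \<Phi> s) (wiener_integral t)"
  unfolding has_ito_integral_def
proof (intro conjI allI exI impI)
  show "progressively_measurable F t0 (\<lambda>s \<omega>. \<Phi> s u)" for u
    unfolding progressively_measurable_def
  proof (intro allI impI)
    fix T
    have "(\<lambda>s. \<Phi> s u) \<in> borel_measurable (restrict_space borel {t0..T})"
    proof -
      have "(\<lambda>s. (if t0 \<le> s then \<Phi> s else 0) u) \<in> borel_measurable (restrict_space borel {t0..T})"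
        by (rule measurable_restrict_space1[OF extended_measurable])
      then show ?thesis by (subst measurable_cong[of _ _ "\<lambda>s. (if t0 \<le> s then \<Phi> s else 0) u"]) auto
    qed
    then have "(\<lambda>x. \<Phi> (fst x) u) \<in> borel_measurable (restrict_space borel {t0..T} \<Otimes>\<^sub>M F T)"
      by (rule measurable_compose[OF measurable_fst])
    then show "(\<lambda>(s, \<omega>). \<Phi> s u) \<in> borel_measurable (restrict_space borel {t0..T} \<Otimes>\<^sub>M F T)"
      by (simp add: case_prod_beta')
  qed
  show "wiener_integral t \<in> borel_measurable M" by (rule wiener_integral_measurable[OF assms])
  show "elementary_process M F t0 (ito_approx n)" for n by (rule ito_approx(1))
  fix \<epsilon> :: real assume "0 < \<epsilon>"
  have "\<forall>\<^sub>F n in sequentially. (1 / 16 :: real) ^ n < \<epsilon>"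
    using \<open>0 < \<epsilon>\<close> by (intro order_tendstoD(2)[OF LIMSEQ_power_zero]) auto
  moreover have "\<forall>\<^sub>F n in sequentially. nat \<lceil>t - t0\<rceil> \<le> n" by (rule eventually_ge_at_top)
  ultimately have "\<forall>\<^sub>F n in sequentially. prob {\<omega>\<in>space M. ennreal \<epsilon> < ito_error (ito_approx n) t \<omega>} = 0"
  proof eventually_elim
    case (elim n)
    have "t - t0 \<le> real n" using elim(2) by linarith
    then have "ito_error (ito_approx n) t \<omega> \<le> ennreal \<epsilon>" for \<omega>
      using ito_approx(3)[of t n \<omega>] ennreal_leI[OF less_imp_le[OF elim(1)]] by (auto intro: order_trans)
    then have "{\<omega>\<in>space M. ennreal \<epsilon> < ito_error (ito_approx n) t \<omega>} = {}" by (auto simp: not_less[symmetric])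
    then show ?case by (metis measure_empty)
  qed
  then show "(\<lambda>n. prob {\<omega>\<in>space M. ennreal \<epsilon> < (\<integral>\<^sup>+s\<in>{t0..t}.
      (hs_norm (elementary_value (ito_approx n) s \<omega> - \<Phi> s))\<^sup>2 \<partial>lborel)}) \<longlonglongrightarrow> 0"
    unfolding ito_error_def by (rule tendsto_eventually)
  have "AE \<omega> in M. (\<lambda>n. elementary_integral W (ito_approx n) t \<omega>) \<longlonglongrightarrow> wiener_integral t \<omega>"
    using wiener_integral_limit by eventually_elim (use assms in blast)
  then show "(\<lambda>n. prob {\<omega>\<in>space M. \<epsilon> < norm (elementary_integral W (ito_approx n) t \<omega> - wiener_integral t \<omega>)}) \<longlonglongrightarrow> 0"
    by (intro tendsto_AE_imp_tendsto_prob elementary_integral_measurable(2)[OF ito_approx(1) assms]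
        wiener_integral_measurable assms \<open>0 < \<epsilon>\<close>)
qed

text \<open>Fatou's lemma along the approximations, whose maxima over rational times have moments
  bounded by one constant. The bound goes through a measurable majorant, because a supremum over
  uncountably many times need not be measurable.\<close>

lemma wiener_integral_sup_moment:
  assumes "t0 \<le> T" "0 < \<nu>"
  shows "\<exists>S\<in>borel_measurable M. (AE \<omega> in M. \<forall>t\<in>{t0..T}. ennreal (norm (wiener_integral t \<omega>) powr \<nu>) \<le> S \<omega>) \<and>
    (\<integral>\<^sup>+\<omega>. S \<omega> \<partial>M) < \<infinity>"
proof -
  define N where "N = nat \<lceil>T - t0\<rceil>"
  \<comment> \<open>From \<open>elementary_value_le\<close> with error at most 1, which holds once
    the indices are shifted by \<open>N\<close>, so that \<open>T\<close> lies in their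
    window.\<close>
  define V where "V = 2 + 2 * C\<^sup>2 * (T - t0)"
  \<comment> \<open>Makes the ratio \<open>V / q\<^sup>2\<close> equal to one half, as the geometric
    tail needs.\<close>
  define q where "q = sqrt (2 * V)"
  have "0 \<le> 2 * C\<^sup>2 * (T - t0)" using assms by simp
  then have V: "0 < V" unfolding V_def by linarith
  then have q: "0 < q" "V / q\<^sup>2 \<le> 1 / 2" by (simp_all add: q_def)
  let ?J = "\<lambda>n. elementary_integral W (ito_approx (n + N))"
  define S where "S n \<omega> = (SUP t\<in>rat_times t0 T. ennreal (norm (?J n t \<omega>) powr \<nu>))" for n \<omega>
  define K where "K = (\<Sum>k. (2 * q * (real k + 1)) powr \<nu> * (1 / 2) ^ k)"
  have V_bound: "(\<integral>\<^sup>+s\<in>{t0..T}. (hs_norm (elementary_value (ito_approx (n + N)) s \<omega>))\<^sup>2 \<partial>lborel) \<le> ennreal V" for n \<omega>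
  proof -
    have "T - t0 \<le> real N" unfolding N_def by linarith
    then have "ito_error (ito_approx (n + N)) T \<omega> \<le> ennreal ((1 / 16) ^ (n + N))"
      by (intro ito_approx(3)) simp
    also have "\<dots> \<le> ennreal 1" by (intro ennreal_leI power_le_one) auto
    finally have e1: "ito_error (ito_approx (n + N)) T \<omega> \<le> 1" by simp
    have "(\<integral>\<^sup>+s\<in>{t0..T}. (hs_norm (elementary_value (ito_approx (n + N)) s \<omega>))\<^sup>2 \<partial>lborel) \<le>
      2 * ito_error (ito_approx (n + N)) T \<omega> + ennreal (2 * C\<^sup>2 * (T - t0))"
      by (rule elementary_value_le[OF assms(1)])
    also have "\<dots> \<le> 2 * 1 + ennreal (2 * C\<^sup>2 * (T - t0))"
      using e1 by (intro add_mono mult_left_mono) auto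
    also have "\<dots> = ennreal V"
      unfolding V_def using assms by (subst ennreal_plus) auto
    finally show ?thesis .
  qed
  have S_meas [measurable]: "S n \<in> borel_measurable M" for n
    unfolding S_def[abs_def]
  proof (rule borel_measurable_SUP[OF countable_rat_times])
    fix t assume "t \<in> rat_times t0 T"
    then have [measurable]: "?J n t \<in> borel_measurable M"
      by (intro elementary_integral_measurable(2)[OF ito_approx(1)]) (simp add: rat_times_def)
    show "(\<lambda>\<omega>. ennreal (norm (?J n t \<omega>) powr \<nu>)) \<in> borel_measurable M" by measurable
  qed
  have S_le: "(\<integral>\<^sup>+\<omega>. S n \<omega> \<partial>M) \<le> ennreal K" for n
    unfolding S_def K_def
    by (rule elementary_integral_sup_moment[OF ito_approx(1,2) assms(1) less_imp_le[OF V] V_bound q assms(2)])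
  have cont: "AE \<omega> in M. \<forall>n. continuous_on {t0..} (\<lambda>t. ?J n t \<omega>)"
    using elementary_integral_continuous[OF ito_approx(1)] by (simp add: AE_all_countable)
  have "AE \<omega> in M. \<forall>t\<in>{t0..T}. ennreal (norm (wiener_integral t \<omega>) powr \<nu>) \<le> liminf (\<lambda>n. S n \<omega>)"
    using cont wiener_integral_limit
  proof eventually_elim
    case (elim \<omega>)
    show ?case
    proof
      fix t assume t: "t \<in> {t0..T}"
      have J_le: "ennreal (norm (?J n t \<omega>) powr \<nu>) \<le> S n \<omega>" for n
      proof (cases "S n \<omega>")
        case (real c)
        have "norm (?J n t \<omega>) powr \<nu> \<le> c"
        proof (rule rat_times_closed_bound[where w="\<lambda>t. norm (?J n t \<omega>) powr \<nu>" and T=T])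
          show "continuous_on {t0..} (\<lambda>t. norm (?J n t \<omega>) powr \<nu>)"
            using elim(1) \<open>0 < \<nu>\<close> by (intro continuous_on_powr' continuous_on_norm continuous_on_const) auto
          fix s assume "s \<in> rat_times t0 T"
          then have "ennreal (norm (?J n s \<omega>) powr \<nu>) \<le> S n \<omega>" unfolding S_def by (rule SUP_upper)
          then show "norm (?J n s \<omega>) powr \<nu> \<le> c" using real by simp
        qed (use t in auto)
        then show ?thesis using real by (simp add: ennreal_leI)
      qed simp
      have "(\<lambda>n. ?J n t \<omega>) \<longlonglongrightarrow> wiener_integral t \<omega>"
        using elim(2) t LIMSEQ_ignore_initial_segment[of "\<lambda>n. elementary_integral W (ito_approx n) t \<omega>" _ N] by auto
      then have "(\<lambda>n. ennreal (norm (?J n t \<omega>) powr \<nu>)) \<longlonglongrightarrow> ennreal (norm (wiener_integral t \<omega>) powr \<nu>)"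
        using \<open>0 < \<nu>\<close> by (intro tendsto_ennrealI tendsto_powr' tendsto_norm tendsto_const) auto
      then have "ennreal (norm (wiener_integral t \<omega>) powr \<nu>) = liminf (\<lambda>n. ennreal (norm (?J n t \<omega>) powr \<nu>))"
        by (intro lim_imp_Liminf[symmetric] sequentially_bot)
      also have "\<dots> \<le> liminf (\<lambda>n. S n \<omega>)"
        by (intro Liminf_mono always_eventually allI J_le)
      finally show "ennreal (norm (wiener_integral t \<omega>) powr \<nu>) \<le> liminf (\<lambda>n. S n \<omega>)" .
    qed
  qed
  moreover have "(\<integral>\<^sup>+\<omega>. liminf (\<lambda>n. S n \<omega>) \<partial>M) \<le> liminf (\<lambda>n. \<integral>\<^sup>+\<omega>. S n \<omega> \<partial>M)"
    by (rule nn_integral_liminf) measurable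
  moreover have "liminf (\<lambda>n. \<integral>\<^sup>+\<omega>. S n \<omega> \<partial>M) \<le> ennreal K"
    using Liminf_mono[of "\<lambda>n. \<integral>\<^sup>+\<omega>. S n \<omega> \<partial>M" "\<lambda>_. ennreal K" sequentially] S_le by (simp add: Liminf_const)
  ultimately show ?thesis
    by (intro bexI[of _ "\<lambda>\<omega>. liminf (\<lambda>n. S n \<omega>)"]) (auto intro: le_less_trans order_trans)
qed

end

end

section \<open>Equations with Lipschitz drift driven by a given path\<close>

lemma continuous_set_integrable:
  fixes f :: "real \<Rightarrow> 'e::{banach, second_countable_topology}"
  assumes "continuous_on {t0..} f"
  shows "set_integrable lborel {t0..t} f"
  by (rule borel_integrable_atLeastAtMost') (rule continuous_on_subset[OF assms], auto)

lemma set_integral_norm_le: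
  fixes f :: "real \<Rightarrow> 'e::{banach, second_countable_topology}" and g :: "real \<Rightarrow> real"
  assumes "set_integrable lborel A f" "set_integrable lborel A g" "\<And>s. s \<in> A \<Longrightarrow> norm (f s) \<le> g s"
  shows "norm (LINT s:A|lborel. f s) \<le> (LINT s:A|lborel. g s)"
proof -
  have "norm (LINT s:A|lborel. f s) \<le> (LINT s:A|lborel. norm (f s))"
    by (rule set_integral_norm_bound[OF assms(1)])
  also have "\<dots> \<le> (LINT s:A|lborel. g s)"
    by (rule set_integral_mono) (use assms in \<open>auto intro: set_integrable_norm\<close>)
  finally show ?thesis .
qed

lemma set_integral_const_Icc: "a \<le> b \<Longrightarrow> (LINT s:{a..b}|lborel. (c::real)) = (b - a) * c"
  by (simp add: set_lebesgue_integral_def)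

lemma indefinite_integral_diff_le:
  fixes f :: "real \<Rightarrow> 'e::{banach, second_countable_topology}"
  assumes f: "continuous_on {t0..} f" and B: "\<And>s. s \<in> {t0..T} \<Longrightarrow> norm (f s) \<le> B"
    and "t0 \<le> s" "s \<le> t" "t \<le> T"
  shows "norm ((LINT r:{t0..t}|lborel. f r) - (LINT r:{t0..s}|lborel. f r)) \<le> B * (t - s)"
proof -
  have split: "{t0..t} = {t0..s} \<union> {s<..t}" using assms by auto
  have int: "set_integrable lborel {s<..t} f"
    by (rule set_integrable_subset[OF continuous_set_integrable[OF f, of t]]) (use assms in auto)
  have "(LINT r:{t0..t}|lborel. f r) = (LINT r:{t0..s}|lborel. f r) + (LINT r:{s<..t}|lborel. f r)"
    unfolding split by (rule set_integral_Un[OF _ continuous_set_integrable[OF f] int]) auto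
  then have "norm ((LINT r:{t0..t}|lborel. f r) - (LINT r:{t0..s}|lborel. f r)) = norm (LINT r:{s<..t}|lborel. f r)"
    by simp
  also have "\<dots> \<le> (LINT r:{s<..t}|lborel. B)"
    by (rule set_integral_norm_le[OF int]) (use assms in \<open>auto simp: set_integrable_def\<close>)
  also have "\<dots> = B * (t - s)" using assms by (simp add: set_lebesgue_integral_def)
  finally show ?thesis .
qed

lemma continuous_norm_bound:
  fixes f :: "real \<Rightarrow> 'e::real_normed_vector"
  assumes "continuous_on {t0..} f"
  shows "\<exists>B\<ge>0. \<forall>s\<in>{t0..T}. norm (f s) \<le> B"
proof -
  have "compact (f ` {t0..T})"
    by (intro compact_continuous_image continuous_on_subset[OF assms]) auto
  then obtain B where "\<forall>x\<in>f ` {t0..T}. norm x \<le> B"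
    using compact_imp_bounded bounded_iff by blast
  then show ?thesis by (intro exI[of _ "\<bar>B\<bar>"]) force
qed

lemma continuous_on_indefinite_integral:
  fixes f :: "real \<Rightarrow> 'e::{banach, second_countable_topology}"
  assumes f: "continuous_on {t0..} f"
  shows "continuous_on {t0..} (\<lambda>t. LINT s:{t0..t}|lborel. f s)"
proof (rule continuous_on_atLeastI)
  fix T
  obtain B where B: "0 \<le> B" "\<And>s. s \<in> {t0..T} \<Longrightarrow> norm (f s) \<le> B"
    using continuous_norm_bound[OF f] by blast
  have "B-lipschitz_on {t0..T} (\<lambda>t. LINT s:{t0..t}|lborel. f s)"
  proof (rule lipschitz_onI[OF _ B(1)])
    fix x y assume "x \<in> {t0..T}" "y \<in> {t0..T}"
    then show "dist (LINT s:{t0..x}|lborel. f s) (LINT s:{t0..y}|lborel. f s) \<le> B * dist x y"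
      using indefinite_integral_diff_le[OF f B(2), where s=x and t=y] indefinite_integral_diff_le[OF f B(2), where s=y and t=x]
      by (cases "x \<le> y") (auto simp: dist_norm norm_minus_commute abs_if)
  qed
  then show "continuous_on {t0..T} (\<lambda>t. LINT s:{t0..t}|lborel. f s)"
    by (rule lipschitz_on_continuous_on)
qed

text \<open>Multiplied by the decaying exponential, the right-hand side of the integral inequality
  becomes \<open>\<phi>\<close>, whose derivative has the factor \<open>w\<close> minus that
  right-hand side and is therefore nonpositive.\<close>

lemma gronwall:
  fixes w :: "real \<Rightarrow> real"
  assumes w: "continuous_on {t0..} w" and "0 \<le> K"
    and le: "\<And>t. t0 \<le> t \<Longrightarrow> t \<le> T \<Longrightarrow> w t \<le> A + K * (LINT s:{t0..t}|lborel. w s)"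
    and t: "t0 \<le> t" "t \<le> T"
  shows "w t \<le> A * exp (K * (t - t0))"
proof -
  define v where "v t = integral {t0..t} w" for t
  have v: "(LINT s:{t0..t}|lborel. w s) = v t" for t
    unfolding v_def by (rule set_borel_integral_eq_integral(2)[OF continuous_set_integrable[OF w]])
  define \<phi> where "\<phi> t = exp (- (K * (t - t0))) * (A + K * v t)" for t
  have cont: "continuous_on {t0..T} w" by (rule continuous_on_subset[OF w]) auto
  have deriv: "(\<phi> has_real_derivative exp (- (K * (x - t0))) * (K * (w x - (A + K * v x)))) (at x within {t0..T})"
    if "x \<in> {t0..T}" for x
  proof -
    have [derivative_intros]: "(v has_real_derivative w x) (at x within {t0..T})"
      unfolding v_def by (rule integral_has_real_derivative[OF cont that])
    show ?thesis
      unfolding \<phi>_def by (auto intro!: derivative_eq_intros simp: algebra_simps)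
  qed
  have "\<phi> t \<le> \<phi> t0"
  proof (rule DERIV_nonpos_imp_decreasing_open[OF t(1)])
    fix x assume x: "t0 < x" "x < t"
    have "at x within {t0..T} = at x" using x t by (intro at_within_Icc_at) auto
    then have "(\<phi> has_real_derivative exp (- (K * (x - t0))) * (K * (w x - (A + K * v x)))) (at x)"
      using deriv[of x] x t by simp
    moreover have "exp (- (K * (x - t0))) * (K * (w x - (A + K * v x))) \<le> 0"
      using le[of x] x t \<open>0 \<le> K\<close> by (intro mult_nonneg_nonpos) (auto simp: v)
    ultimately show "\<exists>y. (\<phi> has_real_derivative y) (at x) \<and> y \<le> 0" by blast
  next
    have "continuous_on {t0..T} \<phi>"
      using deriv by (intro DERIV_continuous_on[of _ _ "\<lambda>x. exp (- (K * (x - t0))) * (K * (w x - (A + K * v x)))"]) auto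
    then show "continuous_on {t0..t} \<phi>" by (rule continuous_on_subset) (use t in auto)
  qed
  also have "\<phi> t0 = A" by (simp add: \<phi>_def v_def)
  finally have \<phi>_le: "exp (K * (t - t0)) * \<phi> t \<le> exp (K * (t - t0)) * A" by (intro mult_left_mono) auto
  have \<phi>_eq: "exp (K * (t - t0)) * \<phi> t = A + K * v t"
    by (simp add: \<phi>_def mult.assoc[symmetric] exp_add[symmetric])
  have "w t \<le> A + K * v t" using le[OF t] by (simp only: v)
  also have "\<dots> \<le> A * exp (K * (t - t0))" using \<phi>_le unfolding \<phi>_eq by (simp only: mult.commute)
  finally show ?thesis .
qed

section \<open>Uniqueness and bounds for the integral equation\<close>

text \<open>The Lipschitz constant depends on the horizon \<open>T\<close> because the coefficient
  \<open>b\<close> of the inertial system may grow without bound. Its positivity permits division by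
  it when the exponential weight is integrated.\<close>

locale lipschitz_drift =
  fixes t0 :: real and G :: "real \<Rightarrow> 'e \<Rightarrow> 'e::{banach, second_countable_topology}" and K :: "real \<Rightarrow> real"
  assumes G_cont: "continuous_on ({t0..} \<times> UNIV) (\<lambda>(s, u). G s u)"
    and G_lip: "t0 \<le> s \<Longrightarrow> s \<le> T \<Longrightarrow> norm (G s u - G s v) \<le> K T * norm (u - v)"
    and K_pos: "t0 \<le> T \<Longrightarrow> 0 < K T"
begin

lemma continuous_on_drift:
  assumes "continuous_on {t0..} u"
  shows "continuous_on {t0..} (\<lambda>s. G s (u s))"
proof -
  have "continuous_on {t0..} (\<lambda>s. (\<lambda>(s, u). G s u) (s, u s))"
    by (rule continuous_on_compose2[OF G_cont]) (auto intro!: continuous_intros assms)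
  then show ?thesis by simp
qed

lemma drift_integral_diff_le:
  assumes u: "continuous_on {t0..} u" and v: "continuous_on {t0..} v" and t: "t0 \<le> t" "t \<le> T"
  shows "norm ((LINT s:{t0..t}|lborel. G s (u s)) - (LINT s:{t0..t}|lborel. G s (v s))) \<le>
    K T * (LINT s:{t0..t}|lborel. norm (u s - v s))"
proof -
  note ints = continuous_set_integrable[OF continuous_on_drift]
  have "norm ((LINT s:{t0..t}|lborel. G s (u s)) - (LINT s:{t0..t}|lborel. G s (v s))) =
    norm (LINT s:{t0..t}|lborel. G s (u s) - G s (v s))"
    by (simp add: set_integral_diff(2)[OF ints[OF u] ints[OF v]])
  also have "\<dots> \<le> (LINT s:{t0..t}|lborel. K T * norm (u s - v s))"
    using t by (intro set_integral_norm_le set_integral_diff(1) ints u v continuous_set_integrable continuous_intros G_lip) auto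
  finally show ?thesis by simp
qed

definition solves :: "'e \<Rightarrow> (real \<Rightarrow> 'e) \<Rightarrow> (real \<Rightarrow> 'e) \<Rightarrow> bool" where
  "solves u0 N u \<longleftrightarrow> continuous_on {t0..} u \<and>
     (\<forall>t\<ge>t0. u t = u0 + (LINT s:{t0..t}|lborel. G s (u s)) + N t)"

lemma solves_unique:
  assumes u: "solves u0 N u" and v: "solves u0 N v" and "t0 \<le> t"
  shows "u t = v t"
proof -
  have cont: "continuous_on {t0..} u" "continuous_on {t0..} v" using u v by (auto simp: solves_def)
  have "norm (u t - v t) \<le> 0 * exp (K t * (t - t0))"
  proof (rule gronwall[where T=t and w="\<lambda>t. norm (u t - v t)"])
    show "continuous_on {t0..} (\<lambda>t. norm (u t - v t))" by (intro continuous_intros cont)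
    fix s assume s: "t0 \<le> s" "s \<le> t"
    have "norm (u s - v s) = norm ((LINT r:{t0..s}|lborel. G r (u r)) - (LINT r:{t0..s}|lborel. G r (v r)))"
      using u v s by (simp add: solves_def)
    also have "\<dots> \<le> K t * (LINT r:{t0..s}|lborel. norm (u r - v r))"
      by (rule drift_integral_diff_le[OF cont s])
    finally show "norm (u s - v s) \<le> 0 + K t * (LINT r:{t0..s}|lborel. norm (u r - v r))" by simp
  qed (use K_pos[of t] assms in auto)
  then show ?thesis by simp
qed

text \<open>The constants are chosen before \<open>N\<close>, \<open>u\<close> and \<open>S\<close>,
  so one pair serves all sample points, and the linear dependence on \<open>S\<close> carries
  moments of the noise over to the solution.\<close>

lemma solves_bound:
  shows "\<exists>c\<ge>0. \<exists>d\<ge>0. \<forall>N u S. solves u0 N u \<longrightarrow> (\<forall>t\<in>{t0..T}. norm (N t) \<le> S) \<longrightarrow>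
    (\<forall>t\<in>{t0..T}. norm (u t) \<le> c + d * S)"
proof (cases "t0 \<le> T")
  case T: True
  have G0: "continuous_on {t0..} (\<lambda>s. G s 0)"
    using continuous_on_drift[of "\<lambda>_. 0"] by simp
  define E where "E = exp (K T * (T - t0))"
  obtain B where B: "0 \<le> B" "\<And>s. s \<in> {t0..T} \<Longrightarrow> norm (G s 0) \<le> B"
    using continuous_norm_bound[OF G0] by blast
  have main: "norm (u t) \<le> (norm u0 + B * (T - t0)) * E + E * S"
    if u: "solves u0 N u" and S: "\<forall>t\<in>{t0..T}. norm (N t) \<le> S" and t: "t \<in> {t0..T}" for N u S t
  proof -
    have cont: "continuous_on {t0..} u" using u by (simp add: solves_def)
    have "norm (N t0) \<le> S" using S T by auto
    then have S0: "0 \<le> S" by (rule order_trans[OF norm_ge_zero])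
    let ?A = "norm u0 + B * (T - t0) + S"
    have A0: "0 \<le> ?A" using B(1) T S0 by simp
    have "norm (u t) \<le> ?A * exp (K T * (t - t0))"
    proof (rule gronwall[where w="\<lambda>t. norm (u t)" and T=T])
      show "continuous_on {t0..} (\<lambda>t. norm (u t))" by (intro continuous_intros cont)
      fix s assume s: "t0 \<le> s" "s \<le> T"
      \<comment> \<open>Comparison with the drift along the zero path: what remains is controlled by
        the Lipschitz bound and fits Gronwall's inequality.\<close>
      have "u s = u0 + (LINT r:{t0..s}|lborel. G r 0) +
        ((LINT r:{t0..s}|lborel. G r (u r)) - (LINT r:{t0..s}|lborel. G r 0)) + N s"
        using u s by (simp add: solves_def)
      also have "norm \<dots> \<le> norm u0 + norm (LINT r:{t0..s}|lborel. G r 0) +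
        norm ((LINT r:{t0..s}|lborel. G r (u r)) - (LINT r:{t0..s}|lborel. G r 0)) + norm (N s)"
        by (intro norm_triangle_le add_mono order_refl)
      also have "norm (LINT r:{t0..s}|lborel. G r 0) \<le> B * (T - t0)"
      proof -
        have "norm (LINT r:{t0..s}|lborel. G r 0) \<le> (LINT r:{t0..s}|lborel. B)"
          using s B(2) by (intro set_integral_norm_le continuous_set_integrable G0 continuous_intros) auto
        also have "\<dots> = (s - t0) * B" using s by (intro set_integral_const_Icc)
        also have "\<dots> \<le> (T - t0) * B" using s B(1) by (intro mult_right_mono) auto
        finally show ?thesis by (simp add: mult.commute)
      qed
      also have "norm ((LINT r:{t0..s}|lborel. G r (u r)) - (LINT r:{t0..s}|lborel. G r 0)) \<le>
        K T * (LINT r:{t0..s}|lborel. norm (u r))"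
        using drift_integral_diff_le[OF cont continuous_on_const[of "{t0..}" 0] s] by simp
      also have "norm (N s) \<le> S" using S s by simp
      finally show "norm (u s) \<le> ?A + K T * (LINT r:{t0..s}|lborel. norm (u r))" by simp
    qed (use K_pos[OF T] t in auto)
    also have "\<dots> \<le> ?A * E"
      unfolding E_def using t A0 K_pos[OF T] by (intro mult_left_mono) auto
    finally show ?thesis by (simp add: algebra_simps)
  qed
  have "0 \<le> (norm u0 + B * (T - t0)) * E" "0 \<le> E" using B(1) T by (auto simp: E_def)
  then show ?thesis using main by blast
qed auto

section \<open>Picard iteration\<close>

fun picard :: "'e \<Rightarrow> (real \<Rightarrow> 'e) \<Rightarrow> nat \<Rightarrow> real \<Rightarrow> 'e" where
  "picard u0 N 0 t = u0"
| "picard u0 N (Suc k) t = u0 + (LINT s:{t0..t}|lborel. G s (picard u0 N k s)) + N t"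

lemma continuous_on_picard:
  assumes "continuous_on {t0..} N"
  shows "continuous_on {t0..} (picard u0 N k)"
proof (induction k)
  case 0
  show ?case by simp
next
  case (Suc k)
  have "continuous_on {t0..} (\<lambda>t. u0 + (LINT s:{t0..t}|lborel. G s (picard u0 N k s)) + N t)"
    by (intro continuous_intros continuous_on_indefinite_integral continuous_on_drift Suc assms)
  then show ?case by simp
qed

lemma integral_exp_le:
  assumes "0 < c" "t0 \<le> t"
  shows "(LINT s:{t0..t}|lborel. exp (c * (s - t0))) \<le> exp (c * (t - t0)) / c"
proof -
  have "(LINT s:{t0..t}|lborel. exp (c * (s - t0))) = (\<integral>s. exp (c * (s - t0)) * indicator {t0..t} s \<partial>lborel)"
    by (simp add: set_lebesgue_integral_def mult.commute)
  also have "\<dots> = exp (c * (t - t0)) / c - exp (c * (t0 - t0)) / c"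
  proof (rule integral_FTC_Icc_real[OF assms(2)])
    show "((\<lambda>s. exp (c * (s - t0)) / c) has_real_derivative exp (c * (x - t0))) (at x)" for x
      using assms(1) by (auto intro!: derivative_eq_intros)
    show "isCont (\<lambda>s. exp (c * (s - t0))) x" for x by (intro continuous_intros)
  qed
  finally show ?thesis using assms(1) by simp
qed

text \<open>In the norm weighted by \<open>exp (- 2 K (t - t0))\<close> the Picard map contracts with factor one half.\<close>

lemma picard_step:
  assumes N: "continuous_on {t0..} N" and T: "t0 \<le> T"
    and B: "0 \<le> B" "\<And>t. t \<in> {t0..T} \<Longrightarrow> norm (picard u0 N 1 t - picard u0 N 0 t) \<le> B"
    and t: "t0 \<le> t" "t \<le> T"
  shows "norm (picard u0 N (Suc k) t - picard u0 N k t) \<le> B * (1 / 2) ^ k * exp (2 * K T * (t - t0))"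
  using t
proof (induction k arbitrary: t)
  case 0
  have "norm (picard u0 N 1 t - picard u0 N 0 t) \<le> B * 1" using B(2)[of t] 0 by simp
  also have "\<dots> \<le> B * exp (2 * K T * (t - t0))"
    using B(1) K_pos[OF T] 0 by (intro mult_left_mono) auto
  finally show ?case by simp
next
  case (Suc k)
  note cont = continuous_on_picard[OF N]
  note K = K_pos[OF T]
  have "norm (picard u0 N (Suc (Suc k)) t - picard u0 N (Suc k) t) =
    norm ((LINT s:{t0..t}|lborel. G s (picard u0 N (Suc k) s)) - (LINT s:{t0..t}|lborel. G s (picard u0 N k s)))"
    by simp
  also have "\<dots> \<le> K T * (LINT s:{t0..t}|lborel. norm (picard u0 N (Suc k) s - picard u0 N k s))"
    by (rule drift_integral_diff_le[OF cont cont Suc.prems])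
  also have "\<dots> \<le> K T * (LINT s:{t0..t}|lborel. B * (1 / 2) ^ k * exp (2 * K T * (s - t0)))"
  proof (intro mult_left_mono set_integral_mono)
    show "set_integrable lborel {t0..t} (\<lambda>s. norm (picard u0 N (Suc k) s - picard u0 N k s))"
      by (intro continuous_set_integrable continuous_on_norm continuous_on_diff cont)
    show "set_integrable lborel {t0..t} (\<lambda>s. B * (1 / 2) ^ k * exp (2 * K T * (s - t0)))"
      by (intro continuous_set_integrable continuous_intros)
    show "norm (picard u0 N (Suc k) s - picard u0 N k s) \<le> B * (1 / 2) ^ k * exp (2 * K T * (s - t0))"
      if "s \<in> {t0..t}" for s
      using Suc.IH[of s] that Suc.prems by (simp del: picard.simps)
  qed (use K in auto)
  also have "\<dots> = K T * (B * (1 / 2) ^ k) * (LINT s:{t0..t}|lborel. exp (2 * K T * (s - t0)))"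
    by (simp only: set_integral_mult_right mult.assoc)
  \<comment> \<open>Integrating the weight divides by \<open>2 * K T\<close>, which cancels the
    Lipschitz constant and leaves the factor one half.\<close>
  also have "\<dots> \<le> K T * (B * (1 / 2) ^ k) * (exp (2 * K T * (t - t0)) / (2 * K T))"
    using K B(1) Suc.prems(1) by (intro mult_left_mono integral_exp_le) auto
  also have "\<dots> = B * (1 / 2) ^ Suc k * exp (2 * K T * (t - t0))" using K by simp
  finally show ?case .
qed

text \<open>The telescoping series of iterates is defined without reference to a horizon;
  \<open>picard_step\<close> gives its uniform convergence on every bounded interval, where the
  drift integral passes to the limit.\<close>

lemma picard_converges:
  assumes N: "continuous_on {t0..} N"
  shows "\<exists>u. solves u0 N u \<and> (\<forall>t\<ge>t0. (\<lambda>k. picard u0 N k t) \<longlonglongrightarrow> u t)"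
proof -
  have cont: "continuous_on {t0..} (picard u0 N k)" for k by (rule continuous_on_picard[OF N])
  define u where "u t = u0 + (\<Sum>i. picard u0 N (Suc i) t - picard u0 N i t)" for t
  have telescope: "(\<Sum>i<k. picard u0 N (Suc i) t - picard u0 N i t) = picard u0 N k t - u0" for k t
    by (subst sum_lessThan_telescope) simp
  have unif: "uniform_limit {t0..T} (picard u0 N) u sequentially" if T: "t0 \<le> T" for T
  proof -
    obtain B where B: "0 \<le> B" "\<And>t. t \<in> {t0..T} \<Longrightarrow> norm (picard u0 N 1 t - picard u0 N 0 t) \<le> B"
      using continuous_norm_bound[OF continuous_on_diff[OF cont[of 1] cont[of 0]], of T] by blast
    let ?M = "B * exp (2 * K T * (T - t0))"
    have "uniform_limit {t0..T} (\<lambda>k t. \<Sum>i<k. picard u0 N (Suc i) t - picard u0 N i t)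
      (\<lambda>t. \<Sum>i. picard u0 N (Suc i) t - picard u0 N i t) sequentially"
    proof (rule Weierstrass_m_test)
      show "norm (picard u0 N (Suc i) t - picard u0 N i t) \<le> ?M * (1 / 2) ^ i" if t: "t \<in> {t0..T}" for i t
      proof -
        have "norm (picard u0 N (Suc i) t - picard u0 N i t) \<le> B * (1 / 2) ^ i * exp (2 * K T * (t - t0))"
          using t by (intro picard_step[OF N T B]) auto
        also have "\<dots> \<le> B * (1 / 2) ^ i * exp (2 * K T * (T - t0))"
          using t B(1) K_pos[OF T] by (intro mult_left_mono) auto
        finally show ?thesis by (simp only: mult_ac)
      qed
      show "summable (\<lambda>i. ?M * (1 / 2) ^ i)" by (intro summable_mult) simp
    qed
    moreover have "uniform_limit {t0..T} (\<lambda>k t. u0) (\<lambda>t. u0) sequentially"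
      by (simp add: uniform_limit_iff)
    ultimately have "uniform_limit {t0..T} (\<lambda>k t. u0 + (\<Sum>i<k. picard u0 N (Suc i) t - picard u0 N i t))
      (\<lambda>t. u0 + (\<Sum>i. picard u0 N (Suc i) t - picard u0 N i t)) sequentially"
      by (intro uniform_limit_add)
    then show ?thesis unfolding telescope u_def by simp
  qed
  have conv: "(\<lambda>k. picard u0 N k t) \<longlonglongrightarrow> u t" if "t0 \<le> t" for t
    using tendsto_uniform_limitI[OF unif[OF that], of t] that by simp
  have cont_T: "continuous_on {t0..T} u" for T
  proof (cases "t0 \<le> T")
    case True
    show ?thesis
      by (rule uniform_limit_theorem[OF _ unif[OF True]])
        (auto intro!: always_eventually continuous_on_subset[OF cont])
  qed auto
  have cont_u: "continuous_on {t0..} u" by (rule continuous_on_atLeastI[OF cont_T])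
  have "u t = u0 + (LINT s:{t0..t}|lborel. G s (u s)) + N t" if t: "t0 \<le> t" for t
  proof -
    have "(\<lambda>k. (LINT s:{t0..t}|lborel. G s (picard u0 N k s)) - (LINT s:{t0..t}|lborel. G s (u s))) \<longlonglongrightarrow> 0"
    proof (rule LIMSEQ_I)
      fix r :: real assume "0 < r"
      \<comment> \<open>The added 1 keeps the denominator positive also when \<open>t = t0\<close>;
        the drift integrals then differ by at most \<open>r / 2\<close>.\<close>
      define e where "e = r / (2 * (K t * (t - t0) + 1))"
      have pos: "0 < K t * (t - t0) + 1" using K_pos[OF t] t by (intro add_nonneg_pos mult_nonneg_nonneg) auto
      have e: "0 < e" using \<open>0 < r\<close> pos by (simp add: e_def)
      have "\<forall>\<^sub>F k in sequentially. \<forall>s\<in>{t0..t}. dist (picard u0 N k s) (u s) < e"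
        using unif[OF t] e unfolding uniform_limit_iff by blast
      then obtain k0 where k0: "\<And>k s. k0 \<le> k \<Longrightarrow> s \<in> {t0..t} \<Longrightarrow> dist (picard u0 N k s) (u s) < e"
        unfolding eventually_sequentially by blast
      have "norm ((LINT s:{t0..t}|lborel. G s (picard u0 N k s)) - (LINT s:{t0..t}|lborel. G s (u s))) < r"
        if "k0 \<le> k" for k
      proof -
        have "norm ((LINT s:{t0..t}|lborel. G s (picard u0 N k s)) - (LINT s:{t0..t}|lborel. G s (u s))) \<le>
          K t * (LINT s:{t0..t}|lborel. norm (picard u0 N k s - u s))"
          by (rule drift_integral_diff_le[OF cont cont_u t order_refl])
        also have "(LINT s:{t0..t}|lborel. norm (picard u0 N k s - u s)) \<le> (LINT s:{t0..t}|lborel. e)"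
        proof (rule set_integral_mono)
          show "set_integrable lborel {t0..t} (\<lambda>s. norm (picard u0 N k s - u s))"
            by (intro continuous_set_integrable continuous_on_norm continuous_on_diff cont cont_u)
          show "set_integrable lborel {t0..t} (\<lambda>s. e)"
            by (intro continuous_set_integrable continuous_on_const)
          show "norm (picard u0 N k s - u s) \<le> e" if "s \<in> {t0..t}" for s
            using k0[OF \<open>k0 \<le> k\<close> that] by (simp add: dist_norm)
        qed
        also have "(LINT s:{t0..t}|lborel. e) = (t - t0) * e" using t by (rule set_integral_const_Icc)
        also have "K t * ((t - t0) * e) \<le> (K t * (t - t0) + 1) * e" using e by (simp add: algebra_simps)
        also have "\<dots> = r / 2"
        proof -
          have "a * (r / (2 * a)) = r / 2" if "0 < a" for a using that by simp
          from this[OF pos] show ?thesis unfolding e_def .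
        qed
        also have "\<dots> < r" using \<open>0 < r\<close> by simp
        finally show ?thesis using K_pos[OF t] by (simp add: mult_left_mono)
      qed
      then show "\<exists>no. \<forall>k\<ge>no. norm ((LINT s:{t0..t}|lborel. G s (picard u0 N k s)) -
          (LINT s:{t0..t}|lborel. G s (u s)) - 0) < r" by auto
    qed
    then have "(\<lambda>k. LINT s:{t0..t}|lborel. G s (picard u0 N k s)) \<longlonglongrightarrow> (LINT s:{t0..t}|lborel. G s (u s))"
      by (rule LIM_zero_cancel)
    then have "(\<lambda>k. picard u0 N (Suc k) t) \<longlonglongrightarrow> u0 + (LINT s:{t0..t}|lborel. G s (u s)) + N t"
      unfolding picard.simps by (intro tendsto_intros)
    moreover have "(\<lambda>k. picard u0 N (Suc k) t) \<longlonglongrightarrow> u t" using conv[OF t] by (rule LIMSEQ_Suc)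
    ultimately show ?thesis using LIMSEQ_unique by blast
  qed
  then show ?thesis using cont_u conv unfolding solves_def by blast
qed

end

section \<open>Stochastic equations with additive noise\<close>

context lipschitz_drift
begin

lemma solves_cong:
  assumes "solves u0 N u" "\<And>t. t0 \<le> t \<Longrightarrow> v t = u t"
  shows "solves u0 N v"
proof -
  have "continuous_on {t0..} v \<longleftrightarrow> continuous_on {t0..} u"
    by (intro continuous_on_cong) (auto simp: assms(2))
  moreover have "(LINT s:{t0..t}|lborel. G s (v s)) = (LINT s:{t0..t}|lborel. G s (u s))" for t
    by (intro set_lebesgue_integral_cong) (auto simp: assms(2))
  ultimately show ?thesis using assms by (simp add: solves_def)
qed

text \<open>The variable upper limit is moved into the integrand as an indicator; measurability in
  the pair of time and sample point is then part of Fubini's theorem.\<close>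

lemma progressively_measurable_drift_integral:
  assumes X: "progressively_measurable F t0 X"
  shows "progressively_measurable F t0 (\<lambda>t \<omega>. LINT s:{t0..t}|lborel. G s (X s \<omega>))"
  unfolding progressively_measurable_def
proof (intro allI impI)
  fix T assume T: "t0 \<le> T"
  let ?R = "restrict_space borel {t0..T} \<Otimes>\<^sub>M F T"
  have fst_R: "(\<lambda>x. fst x) \<in> borel_measurable ?R"
    by (rule measurable_compose[OF measurable_fst]) (simp add: measurable_restrict_space1)
  have X_R: "(\<lambda>x. X (fst x) (snd x)) \<in> borel_measurable ?R"
    using X T by (simp add: progressively_measurable_def case_prod_beta')
  have "(\<lambda>x. (fst x, X (fst x) (snd x))) \<in> measurable ?R (restrict_space borel ({t0..} \<times> UNIV))"
  proof (rule measurable_restrict_space2)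
    show "(\<lambda>x. (fst x, X (fst x) (snd x))) \<in> borel_measurable ?R"
      by (intro borel_measurable_Pair fst_R X_R)
  qed (auto simp: space_pair_measure)
  from measurable_compose[OF this borel_measurable_continuous_on_restrict[OF G_cont]]
  have G_R: "(\<lambda>x. G (fst x) (X (fst x) (snd x))) \<in> borel_measurable ?R" by simp
  \<comment> \<open>Clamping to \<open>{t0..T}\<close> makes the integrand jointly measurable for
    all real \<open>s\<close> without leaving \<open>F T\<close>; the indicator removes the clamped
    values.\<close>
  define c where "c s = max t0 (min T s)" for s
  have c: "c \<in> measurable borel (restrict_space borel {t0..T})"
  proof (rule measurable_restrict_space2)
    show "c \<in> borel_measurable borel" unfolding c_def by measurable
  qed (use T in \<open>auto simp: c_def\<close>)
  have "(\<lambda>y. (c (snd y), snd (fst y))) \<in> measurable (?R \<Otimes>\<^sub>M lborel) ?R"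
  proof (rule measurable_Pair)
    have "snd \<in> measurable (?R \<Otimes>\<^sub>M lborel) borel" by measurable
    from measurable_compose[OF this c]
    show "(\<lambda>y. c (snd y)) \<in> measurable (?R \<Otimes>\<^sub>M lborel) (restrict_space borel {t0..T})" .
    show "(\<lambda>y. snd (fst y)) \<in> measurable (?R \<Otimes>\<^sub>M lborel) (F T)" by measurable
  qed
  from measurable_compose[OF this G_R]
  have [measurable]: "(\<lambda>y. G (c (snd y)) (X (c (snd y)) (snd (fst y)))) \<in> borel_measurable (?R \<Otimes>\<^sub>M lborel)"
    by simp
  have [measurable]: "(\<lambda>y. fst (fst y)) \<in> borel_measurable (?R \<Otimes>\<^sub>M lborel)"
    by (rule measurable_compose[OF measurable_fst fst_R])
  have "(\<lambda>(x, s). (if t0 \<le> s \<and> s \<le> fst x then 1 else 0 :: real) *\<^sub>R G (c s) (X (c s) (snd x)))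
    \<in> borel_measurable (?R \<Otimes>\<^sub>M lborel)"
    unfolding case_prod_beta' by measurable
  then have "(\<lambda>x. \<integral>s. (if t0 \<le> s \<and> s \<le> fst x then 1 else 0 :: real) *\<^sub>R G (c s) (X (c s) (snd x)) \<partial>lborel)
    \<in> borel_measurable ?R"
    by (rule lborel.borel_measurable_lebesgue_integral)
  moreover have "(\<lambda>x. \<integral>s. (if t0 \<le> s \<and> s \<le> fst x then 1 else 0 :: real) *\<^sub>R G (c s) (X (c s) (snd x)) \<partial>lborel)
      \<in> borel_measurable ?R \<longleftrightarrow> (\<lambda>(t, \<omega>). LINT s:{t0..t}|lborel. G s (X s \<omega>)) \<in> borel_measurable ?R"
  proof (rule measurable_cong)
    fix x assume "x \<in> space ?R"
    then have x: "fst x \<le> T" by (auto simp: space_pair_measure)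
    show "(\<integral>s. (if t0 \<le> s \<and> s \<le> fst x then 1 else 0 :: real) *\<^sub>R G (c s) (X (c s) (snd x)) \<partial>lborel) =
      (case x of (t, \<omega>) \<Rightarrow> LINT s:{t0..t}|lborel. G s (X s \<omega>))"
      unfolding set_lebesgue_integral_def case_prod_beta'
      by (intro Bochner_Integration.integral_cong refl) (use x in \<open>auto simp: c_def indicator_def\<close>)
  qed
  ultimately show "(\<lambda>(t, \<omega>). LINT s:{t0..t}|lborel. G s (X s \<omega>)) \<in> borel_measurable ?R"
    by blast
qed

text \<open>This concerns all sample points, including those where the path of \<open>N\<close> is
  not continuous and the integrals may take their default value.\<close>

lemma progressively_measurable_picard:
  assumes N: "progressively_measurable F t0 N"
  shows "progressively_measurable F t0 (\<lambda>t \<omega>. picard u0 (\<lambda>t. N t \<omega>) k t)"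
proof (induction k)
  case 0
  show ?case by (simp add: progressively_measurable_def)
next
  case (Suc k)
  from progressively_measurable_drift_integral[OF this] N show ?case
    unfolding progressively_measurable_def case_prod_beta' picard.simps
    by (intro allI impI borel_measurable_add borel_measurable_const) auto
qed

end

lemma powr_add_le:
  fixes a b \<nu> :: real
  assumes "0 \<le> a" "0 \<le> b" "0 < \<nu>"
  shows "(a + b) powr \<nu> \<le> (2 * a) powr \<nu> + (2 * b) powr \<nu>"
proof (cases "a \<le> b")
  case True
  then have "(a + b) powr \<nu> \<le> (2 * b) powr \<nu>" using assms by (intro powr_mono2) auto
  then show ?thesis by (simp add: add_increasing)
next
  case False
  then have "(a + b) powr \<nu> \<le> (2 * a) powr \<nu>" using assms by (intro powr_mono2) auto
  then show ?thesis by (simp add: add_increasing2)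
qed

context brownian_motion
begin

text \<open>\<open>X\<close> is defined at every sample point as \<open>lim\<close> of the Picard
  iterates, which gives progressive measurability, and solves the path equation wherever
  \<open>N\<close> is continuous. In any other strong solution the Ito integral agrees with
  \<open>N t\<close> almost surely, so almost every path solves the same equation.\<close>

lemma additive_noise_solution:
  fixes \<Phi> :: "real \<Rightarrow> ('u \<Rightarrow>\<^sub>L 'k::{real_inner, banach, second_countable_topology})" and C :: real
    and G :: "real \<Rightarrow> 'k \<Rightarrow> 'k" and x0 :: 'k
  assumes \<Phi>: "\<And>u. (\<lambda>s. \<Phi> s u) \<in> borel_measurable (restrict_space borel {t0..})"
      "\<And>s. t0 \<le> s \<Longrightarrow> hs_norm (\<Phi> s) \<le> ennreal C"
    and G: "lipschitz_drift t0 G K" and g: "\<And>s x. g s x = \<Phi> s"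
  shows "\<exists>X. strong_solution M F t0 W G g x0 X \<and>
    (\<forall>X'. strong_solution M F t0 W G g x0 X' \<longrightarrow> (AE \<omega> in M. \<forall>t\<ge>t0. X' t \<omega> = X t \<omega>)) \<and>
    (\<forall>\<nu>>0. X \<in> S_class M F t0 \<nu>)"
proof -
  interpret lipschitz_drift t0 G K by fact
  define N where "N = wiener_integral \<Phi>"
  have N_prog: "progressively_measurable F t0 N"
    and N_start: "N t0 \<omega> = 0" and N_meas: "t0 \<le> t \<Longrightarrow> N t \<in> borel_measurable M"
    and N_ito: "t0 \<le> t \<Longrightarrow> has_ito_integral M F t0 W t (\<lambda>s \<omega>. \<Phi> s) (N t)" for t \<omega>
    unfolding N_def
    by (rule wiener_integral_progressive[OF \<Phi>] wiener_integral_start[OF \<Phi>] wiener_integral_measurable[OF \<Phi>]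
        wiener_integral_has_ito_integral[OF \<Phi>]; assumption)+
  have "AE \<omega> in M. continuous_on {t0..} (\<lambda>t. N t \<omega>) \<and>
      (\<forall>t\<ge>t0. (\<lambda>n. elementary_integral W (ito_approx \<Phi> n) t \<omega>) \<longlonglongrightarrow> N t \<omega>)"
    unfolding N_def by (rule wiener_integral_limit[OF \<Phi>])
  then have N_cont: "AE \<omega> in M. continuous_on {t0..} (\<lambda>t. N t \<omega>)"
    by eventually_elim simp
  define X where "X t \<omega> = lim (\<lambda>k. picard x0 (\<lambda>t. N t \<omega>) k t)" for t \<omega>
  have X_prog: "progressively_measurable F t0 X"
    unfolding progressively_measurable_def
  proof (intro allI impI)
    fix T assume "t0 \<le> T"
    then have "(\<lambda>x. picard x0 (\<lambda>t. N t (snd x)) k (fst x)) \<in> borel_measurable (restrict_space borel {t0..T} \<Otimes>\<^sub>M F T)" for k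
      using progressively_measurable_picard[OF N_prog, of x0 k]
      by (simp add: progressively_measurable_def case_prod_beta')
    then have "(\<lambda>x. lim (\<lambda>k. picard x0 (\<lambda>t. N t (snd x)) k (fst x))) \<in> borel_measurable (restrict_space borel {t0..T} \<Otimes>\<^sub>M F T)"
      by (rule borel_measurable_lim_metric)
    then show "(\<lambda>(s, \<omega>). X s \<omega>) \<in> borel_measurable (restrict_space borel {t0..T} \<Otimes>\<^sub>M F T)"
      by (simp add: X_def case_prod_beta')
  qed
  have X_meas: "X t \<in> borel_measurable M" if t: "t0 \<le> t" for t
  proof -
    have "(\<lambda>\<omega>. (t, \<omega>)) \<in> measurable (F t) (restrict_space borel {t0..t} \<Otimes>\<^sub>M F t)"
      using t by (intro measurable_Pair1') simp
    moreover have "(\<lambda>(s, \<omega>). X s \<omega>) \<in> borel_measurable (restrict_space borel {t0..t} \<Otimes>\<^sub>M F t)"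
      using X_prog t by (simp add: progressively_measurable_def)
    ultimately have "(\<lambda>\<omega>. (\<lambda>(s, \<omega>). X s \<omega>) (t, \<omega>)) \<in> borel_measurable (F t)"
      by (rule measurable_compose)
    then show ?thesis using measurable_F_M[OF _ t] by simp
  qed
  have X_solves: "AE \<omega> in M. solves x0 (\<lambda>t. N t \<omega>) (\<lambda>t. X t \<omega>)"
    using N_cont
  proof eventually_elim
    case (elim \<omega>)
    obtain u where u: "solves x0 (\<lambda>t. N t \<omega>) u"
      "\<And>t. t0 \<le> t \<Longrightarrow> (\<lambda>k. picard x0 (\<lambda>t. N t \<omega>) k t) \<longlonglongrightarrow> u t"
      using picard_converges[OF elim, of x0] by blast
    show ?case
    proof (rule solves_cong[OF u(1)])
      show "X t \<omega> = u t" if "t0 \<le> t" for t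
        unfolding X_def by (rule limI) (rule u(2)[OF that])
    qed
  qed
  have LINT_start: "(LINT s:{t0}|lborel. f s) = 0" for f :: "real \<Rightarrow> 'k"
    unfolding set_lebesgue_integral_def
  proof (rule integral_eq_zero_AE)
    show "AE s in lborel. indicat_real {t0} s *\<^sub>R f s = 0"
      using AE_lborel_singleton[of t0] by eventually_elim simp
  qed
  have X_start: "AE \<omega> in M. X t0 \<omega> = x0"
    using X_solves by eventually_elim (simp add: solves_def LINT_start N_start)
  have X_cont: "AE \<omega> in M. continuous_on {t0..} (\<lambda>t. X t \<omega>)"
    using X_solves by eventually_elim (simp add: solves_def)
  have "strong_solution M F t0 W G g x0 X"
    unfolding strong_solution_def g
  proof (intro conjI allI impI X_meas X_start X_cont)
    fix t assume t: "t0 \<le> t"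
    show "AE \<omega> in M. set_borel_measurable lborel {t0..t} (\<lambda>s. G s (X s \<omega>)) \<and>
      (\<integral>\<^sup>+s\<in>{t0..t}. (ennreal (norm (G s (X s \<omega>))) + (hs_norm (\<Phi> s))\<^sup>2) \<partial>lborel) < \<infinity>"
      using X_cont
    proof eventually_elim
      case (elim \<omega>)
      note cont = continuous_on_drift[OF elim]
      have meas: "set_borel_measurable lborel {t0..t} (\<lambda>s. G s (X s \<omega>))"
        using continuous_set_integrable[OF cont] unfolding set_integrable_def set_borel_measurable_def
        by (rule borel_measurable_integrable)
      obtain B where B: "\<And>s. s \<in> {t0..t} \<Longrightarrow> norm (G s (X s \<omega>)) \<le> B"
        using continuous_norm_bound[OF cont] by blast
      have "(\<integral>\<^sup>+s\<in>{t0..t}. (ennreal (norm (G s (X s \<omega>))) + (hs_norm (\<Phi> s))\<^sup>2) \<partial>lborel) \<le>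
        (\<integral>\<^sup>+s. (ennreal B + (ennreal C)\<^sup>2) * indicator {t0..t} s \<partial>lborel)"
      proof (intro nn_integral_mono)
        fix s
        show "(ennreal (norm (G s (X s \<omega>))) + (hs_norm (\<Phi> s))\<^sup>2) * indicator {t0..t} s \<le>
          (ennreal B + (ennreal C)\<^sup>2) * indicator {t0..t} s"
        proof (cases "s \<in> {t0..t}")
          case True
          have "ennreal (norm (G s (X s \<omega>))) + (hs_norm (\<Phi> s))\<^sup>2 \<le> ennreal B + (ennreal C)\<^sup>2"
            using True B[OF True] \<Phi>(2)[of s] by (intro add_mono ennreal_leI power_mono) auto
          then show ?thesis using True by simp
        qed simp
      qed
      also have "\<dots> < \<infinity>"
        by (subst nn_integral_cmult_indicator) (auto simp: ennreal_mult_less_top emeasure_lborel_Icc_eq power_less_top_ennreal)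
      finally show ?case using meas by blast
    qed
    show "\<exists>I. has_ito_integral M F t0 W t (\<lambda>s \<omega>. \<Phi> s) I \<and>
      (AE \<omega> in M. X t \<omega> = X t0 \<omega> + (LINT s:{t0..t}|lborel. G s (X s \<omega>)) + I \<omega>)"
    proof (intro exI conjI)
      show "has_ito_integral M F t0 W t (\<lambda>s \<omega>. \<Phi> s) (N t)" by (rule N_ito[OF t])
      show "AE \<omega> in M. X t \<omega> = X t0 \<omega> + (LINT s:{t0..t}|lborel. G s (X s \<omega>)) + N t \<omega>"
        using X_solves X_start by eventually_elim (use t in \<open>simp add: solves_def\<close>)
    qed
  qed
  moreover have "AE \<omega> in M. \<forall>t\<ge>t0. X' t \<omega> = X t \<omega>" if X': "strong_solution M F t0 W G g x0 X'" for X'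
  proof -
    have start: "AE \<omega> in M. X' t0 \<omega> = x0" and cont: "AE \<omega> in M. continuous_on {t0..} (\<lambda>t. X' t \<omega>)"
      using X' by (auto simp: strong_solution_def)
    have eq: "AE \<omega> in M. X' t \<omega> = X' t0 \<omega> + (LINT s:{t0..t}|lborel. G s (X' s \<omega>)) + N t \<omega>" if t: "t0 \<le> t" for t
    proof -
      obtain I where I: "has_ito_integral M F t0 W t (\<lambda>s \<omega>. \<Phi> s) I"
        "AE \<omega> in M. X' t \<omega> = X' t0 \<omega> + (LINT s:{t0..t}|lborel. G s (X' s \<omega>)) + I \<omega>"
        using X' t unfolding strong_solution_def g by blast
      have "AE \<omega> in M. I \<omega> = N t \<omega>"
        by (rule has_ito_integral_unique[OF \<Phi> I(1) N_ito[OF t] t])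
      with I(2) show ?thesis by eventually_elim simp
    qed
    \<comment> \<open>The exceptional null set of \<open>eq\<close> depends on \<open>t\<close>.
      Countably many times share one null set, and continuity along \<open>left_grid\<close>
      recovers the equation at all times.\<close>
    have "AE \<omega> in M. \<forall>n. \<forall>t\<in>rat_times t0 (t0 + real n).
        X' t \<omega> = X' t0 \<omega> + (LINT s:{t0..t}|lborel. G s (X' s \<omega>)) + N t \<omega>"
      using eq by (subst AE_all_countable, intro allI AE_ball_countable[OF countable_rat_times, THEN iffD2] ballI)
        (simp add: rat_times_def)
    then show ?thesis
      using start cont N_cont X_solves
    proof eventually_elim
      case (elim \<omega>)
      have "solves x0 (\<lambda>t. N t \<omega>) (\<lambda>t. X' t \<omega>)"
        unfolding solves_def
      proof (intro conjI allI impI)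
        show "continuous_on {t0..} (\<lambda>t. X' t \<omega>)" by (rule elim(3))
        fix t assume t: "t0 \<le> t"
        define rhs where "rhs t = x0 + (LINT s:{t0..t}|lborel. G s (X' s \<omega>)) + N t \<omega>" for t
        have rhs: "continuous_on {t0..} rhs"
          unfolding rhs_def
          by (intro continuous_intros continuous_on_indefinite_integral continuous_on_drift elim)
        obtain n where n: "t - t0 \<le> real n" using real_arch_simple by blast
        have "X' (left_grid t0 k t) \<omega> = rhs (left_grid t0 k t)" for k
          using elim(1,2) left_grid_rat_times[OF t, of "t0 + real n" k] n unfolding rhs_def by auto
        moreover have "(\<lambda>k. X' (left_grid t0 k t) \<omega>) \<longlonglongrightarrow> X' t \<omega>"
          using t by (intro continuous_on_tendsto_compose[OF elim(3)] left_grid_tendsto) (auto simp: left_grid_ge)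
        moreover have "(\<lambda>k. rhs (left_grid t0 k t)) \<longlonglongrightarrow> rhs t"
          using t by (intro continuous_on_tendsto_compose[OF rhs] left_grid_tendsto) (auto simp: left_grid_ge)
        ultimately have "X' t \<omega> = rhs t" using LIMSEQ_unique by simp
        then show "X' t \<omega> = x0 + (LINT s:{t0..t}|lborel. G s (X' s \<omega>)) + N t \<omega>" by (simp add: rhs_def)
      qed
      then show ?case using solves_unique[OF _ elim(5)] by blast
    qed
  qed
  moreover have "X \<in> S_class M F t0 \<nu>" if "0 < \<nu>" for \<nu>
    unfolding S_class_def
  proof (intro CollectI conjI allI impI X_prog X_cont)
    fix T assume T: "t0 \<le> T"
    have "\<exists>S\<in>borel_measurable M. (AE \<omega> in M. \<forall>t\<in>{t0..T}. ennreal (norm (N t \<omega>) powr \<nu>) \<le> S \<omega>) \<and>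
        (\<integral>\<^sup>+\<omega>. S \<omega> \<partial>M) < \<infinity>"
      unfolding N_def by (rule wiener_integral_sup_moment[OF \<Phi> T \<open>0 < \<nu>\<close>])
    then obtain S where S: "S \<in> borel_measurable M"
      "AE \<omega> in M. \<forall>t\<in>{t0..T}. ennreal (norm (N t \<omega>) powr \<nu>) \<le> S \<omega>" "(\<integral>\<^sup>+\<omega>. S \<omega> \<partial>M) < \<infinity>"
      by blast
    obtain c d where cd: "0 \<le> c" "0 \<le> d" "\<And>N u S t. solves x0 N u \<Longrightarrow> (\<forall>t\<in>{t0..T}. norm (N t) \<le> S) \<Longrightarrow>
        t \<in> {t0..T} \<Longrightarrow> norm (u t) \<le> c + d * S"
      using solves_bound[of x0 T] by blast
    have "AE \<omega> in M. (SUP t\<in>{t0..T}. ennreal (norm (X t \<omega>) powr \<nu>)) \<le>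
        ennreal ((2 * c) powr \<nu>) + ennreal ((2 * d) powr \<nu>) * S \<omega>"
      using X_solves N_cont S(2)
    proof eventually_elim
      case (elim \<omega>)
      have "continuous_on {t0..T} (\<lambda>t. norm (N t \<omega>))"
        by (intro continuous_on_norm continuous_on_subset[OF elim(2)]) auto
      \<comment> \<open>The maximum of the noise is attained at a time \<open>s\<close>, so the
        bound of \<open>norm (N s \<omega>) powr \<nu>\<close> by \<open>S \<omega>\<close> controls
        the whole supremum.\<close>
      then obtain s where s: "s \<in> {t0..T}" "\<forall>t\<in>{t0..T}. norm (N t \<omega>) \<le> norm (N s \<omega>)"
        using continuous_attains_sup[of "{t0..T}" "\<lambda>t. norm (N t \<omega>)"] T by auto
      show ?case
      proof (rule SUP_least)
        fix t assume t: "t \<in> {t0..T}"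
        have "norm (X t \<omega>) powr \<nu> \<le> (c + d * norm (N s \<omega>)) powr \<nu>"
          using cd(3)[OF elim(1) s(2) t] \<open>0 < \<nu>\<close> by (intro powr_mono2) auto
        also have "\<dots> \<le> (2 * c) powr \<nu> + (2 * (d * norm (N s \<omega>))) powr \<nu>"
          using cd \<open>0 < \<nu>\<close> by (intro powr_add_le) auto
        also have "(2 * (d * norm (N s \<omega>))) powr \<nu> = (2 * d) powr \<nu> * norm (N s \<omega>) powr \<nu>"
          using cd by (simp add: powr_mult mult.assoc[symmetric])
        finally have "ennreal (norm (X t \<omega>) powr \<nu>) \<le> ennreal ((2 * c) powr \<nu> + (2 * d) powr \<nu> * norm (N s \<omega>) powr \<nu>)"
          by (rule ennreal_leI)
        also have "\<dots> = ennreal ((2 * c) powr \<nu>) + ennreal ((2 * d) powr \<nu>) * ennreal (norm (N s \<omega>) powr \<nu>)"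
          by (subst ennreal_plus) (simp_all add: ennreal_mult)
        also have "\<dots> \<le> ennreal ((2 * c) powr \<nu>) + ennreal ((2 * d) powr \<nu>) * S \<omega>"
          using elim(3) s(1) by (intro add_left_mono mult_left_mono) auto
        finally show "ennreal (norm (X t \<omega>) powr \<nu>) \<le> ennreal ((2 * c) powr \<nu>) + ennreal ((2 * d) powr \<nu>) * S \<omega>" .
      qed
    qed
    then have "(\<integral>\<^sup>+\<omega>. (SUP t\<in>{t0..T}. ennreal (norm (X t \<omega>) powr \<nu>)) \<partial>M) \<le>
      (\<integral>\<^sup>+\<omega>. ennreal ((2 * c) powr \<nu>) + ennreal ((2 * d) powr \<nu>) * S \<omega> \<partial>M)"
      by (rule nn_integral_mono_AE)
    also have "\<dots> = ennreal ((2 * c) powr \<nu>) + ennreal ((2 * d) powr \<nu>) * (\<integral>\<^sup>+\<omega>. S \<omega> \<partial>M)"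
      using S(1) by (simp add: nn_integral_add nn_integral_cmult emeasure_space_1)
    also have "\<dots> < \<infinity>" using S(3) by (simp add: ennreal_mult_less_top)
    finally show "(\<integral>\<^sup>+\<omega>. (SUP t\<in>{t0..T}. ennreal (norm (X t \<omega>) powr \<nu>)) \<partial>M) < \<infinity>" .
  qed
  ultimately show ?thesis by blast
qed

end

section \<open>The inertial system\<close>

text \<open>Monotonicity gives \<open>b s \<le> b T\<close> up to the horizon. The three summands of
  the constant come from the velocity in the first component, the damping and the gradient.\<close>

lemma inertial_lipschitz_drift:
  fixes gradf :: "'h::{real_inner, banach, second_countable_topology} \<Rightarrow> 'h"
  assumes L: "L-lipschitz_on UNIV gradf" and "0 < lam"
    and b: "\<And>t. t0 \<le> t \<Longrightarrow> 0 < b t" "continuous_on {t0..} b" "mono_on {t0..} b"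
  shows "lipschitz_drift t0 (inertial_drift lam b gradf) (\<lambda>T. 1 + lam + b T * L)"
proof
  have L0: "0 \<le> L" using L by (rule lipschitz_on_nonneg)
  have gradf: "continuous_on UNIV gradf" using L by (rule lipschitz_on_continuous_on)
  show "continuous_on ({t0..} \<times> UNIV) (\<lambda>(s, u). inertial_drift lam b gradf s u)"
    unfolding inertial_drift_def case_prod_beta'
    by (intro continuous_intros continuous_on_compose2[OF b(2)] continuous_on_compose2[OF gradf]) auto
  show "norm (inertial_drift lam b gradf s u - inertial_drift lam b gradf s v) \<le> (1 + lam + b T * L) * norm (u - v)"
    if s: "t0 \<le> s" "s \<le> T" for s T u v
  proof -
    obtain y x y' x' where uv: "u = (y, x)" "v = (y', x')" by (metis prod.exhaust)
    have "inertial_drift lam b gradf s u - inertial_drift lam b gradf s v =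
      (x - x', - (lam *\<^sub>R (x - x')) - b s *\<^sub>R (gradf y - gradf y'))"
      by (simp add: uv inertial_drift_def algebra_simps)
    also have "norm \<dots> \<le> norm (x - x') + norm (- (lam *\<^sub>R (x - x')) - b s *\<^sub>R (gradf y - gradf y'))"
      by (rule norm_Pair_le)
    also have "norm (- (lam *\<^sub>R (x - x')) - b s *\<^sub>R (gradf y - gradf y')) \<le>
      norm (- (lam *\<^sub>R (x - x'))) + norm (b s *\<^sub>R (gradf y - gradf y'))"
      by (rule norm_triangle_ineq4)
    also have "norm (b s *\<^sub>R (gradf y - gradf y')) \<le> b T * (L * norm (y - y'))"
    proof -
      have "norm (gradf y - gradf y') \<le> L * norm (y - y')"
        using lipschitz_onD[OF L, of y y'] by (simp add: dist_norm)
      moreover have "b s \<le> b T" using b(3) s by (auto intro: mono_onD)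
      ultimately show ?thesis using b(1)[OF s(1)] by (auto intro!: mult_mono)
    qed
    also have "norm (- (lam *\<^sub>R (x - x'))) = lam * norm (x - x')" using \<open>0 < lam\<close> by simp
    also have "norm (x - x') + (lam * norm (x - x') + b T * (L * norm (y - y'))) \<le>
      norm (u - v) + (lam * norm (u - v) + b T * (L * norm (u - v)))"
    proof -
      have "norm (x - x') \<le> norm (u - v)" "norm (y - y') \<le> norm (u - v)"
        by (simp_all add: uv norm_fst_le norm_snd_le)
      then show ?thesis
        using \<open>0 < lam\<close> L0 b(1)[of T] s by (intro add_mono mult_left_mono) auto
    qed
    finally show ?thesis by (simp add: algebra_simps)
  qed
  show "0 < 1 + lam + b T * L" if "t0 \<le> T" for T
    using b(1)[OF that] L0 \<open>0 < lam\<close> by (intro add_pos_nonneg) auto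
qed

text \<open>\<open>A\<close> and \<open>B\<close> may have different codomains, since the chosen
  basis depends only on the common domain. This carries the bound on \<open>\<sigma>Y\<close> over
  to the pair-valued diffusion, whose first component is zero.\<close>

lemma hs_norm_cong:
  assumes "\<And>x. norm (blinfun_apply A x) = norm (blinfun_apply B x)"
  shows "hs_norm A = hs_norm B"
  unfolding hs_norm_def by (simp add: assms)

theorem theorem2p1:
  fixes M :: "'w measure" and F :: "real \<Rightarrow> 'w measure" and t0 :: real
    and W :: "real \<Rightarrow> 'h::{real_inner, banach, second_countable_topology} \<Rightarrow> 'w \<Rightarrow> real"
    and f :: "'h \<Rightarrow> real" and gradf :: "'h \<Rightarrow> 'h" and L lam :: real
    and b b' :: "real \<Rightarrow> real" and \<sigma>Y :: "real \<Rightarrow> ('h \<Rightarrow>\<^sub>L 'h)" and \<sigma>star :: real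
    and Y0 X0 :: 'h
  assumes "brownian_motion M F t0 W"
    and "convex_on UNIV f"
    and "\<And>x. GDERIV f x :> gradf x"
    and "L-lipschitz_on UNIV gradf"
    and "{x. is_arg_min f (\<lambda>_. True) x} \<noteq> {}"
    and "t0 \<ge> 0" and "lam > 0"
    and "\<And>t. t \<ge> t0 \<Longrightarrow> b t > 0"
    and "\<And>t. t \<ge> t0 \<Longrightarrow> (b has_real_derivative b' t) (at t within {t0..})"
    and "continuous_on {t0..} b'"
    and "mono_on {t0..} b"
    and "\<sigma>Y \<in> borel_measurable (restrict_space borel {t0..})"
    and "\<And>t. t \<ge> t0 \<Longrightarrow> hs_norm (\<sigma>Y t) \<le> ennreal \<sigma>star"
  shows "\<exists>Y X.
    strong_solution M F t0 W (inertial_drift lam b gradf) (inertial_diffusion \<sigma>Y) (Y0, X0)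
      (\<lambda>t \<omega>. (Y t \<omega>, X t \<omega>)) \<and>
    (\<forall>Y' X'.
      strong_solution M F t0 W (inertial_drift lam b gradf) (inertial_diffusion \<sigma>Y) (Y0, X0)
        (\<lambda>t \<omega>. (Y' t \<omega>, X' t \<omega>)) \<longrightarrow>
      (AE \<omega> in M. \<forall>t\<ge>t0. Y' t \<omega> = Y t \<omega> \<and> X' t \<omega> = X t \<omega>)) \<and>
    (\<forall>\<nu>\<ge>2. (\<lambda>t \<omega>. (Y t \<omega>, X t \<omega>)) \<in> S_class M F t0 \<nu>)"
proof -
  interpret brownian_motion M F t0 W by fact
  have b_cont: "continuous_on {t0..} b"
    by (rule DERIV_continuous_on[where D=b']) (use assms(9) in auto)
  define \<Phi> :: "real \<Rightarrow> ('h \<Rightarrow>\<^sub>L ('h \<times> 'h))" where "\<Phi> s = Blinfun (\<lambda>h. (0, \<sigma>Y s h))" for s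
  have \<Phi>_apply: "\<Phi> s h = (0, \<sigma>Y s h)" for s h
    unfolding \<Phi>_def
    by (subst bounded_linear_Blinfun_apply)
      (auto intro!: bounded_linear_Pair bounded_linear_zero blinfun.bounded_linear_right)
  have \<Phi>_meas: "(\<lambda>s. \<Phi> s u) \<in> borel_measurable (restrict_space borel {t0..})" for u
  proof -
    \<comment> \<open>Evaluation at \<open>u\<close> is continuous in operator norm, so Borel
      measurability of \<open>\<sigma>Y\<close> gives measurability in the strong operator
      sense.\<close>
    have "(\<lambda>A. blinfun_apply A u) \<in> borel_measurable (borel :: ('h \<Rightarrow>\<^sub>L 'h) measure)"
      by (intro borel_measurable_continuous_onI continuous_intros)
    from measurable_compose[OF assms(12) this] show ?thesis
      unfolding \<Phi>_apply by (intro borel_measurable_Pair) simp_all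
  qed
  have \<Phi>_hs: "hs_norm (\<Phi> s) \<le> ennreal \<sigma>star" if "t0 \<le> s" for s
  proof -
    have "hs_norm (\<Phi> s) = hs_norm (\<sigma>Y s)" by (rule hs_norm_cong) (simp add: \<Phi>_apply)
    then show ?thesis using assms(13)[OF that] by simp
  qed
  have diffusion: "inertial_diffusion \<sigma>Y s x = \<Phi> s" for s x
    by (simp add: inertial_diffusion_def \<Phi>_def case_prod_beta')
  have "\<exists>Z. strong_solution M F t0 W (inertial_drift lam b gradf) (inertial_diffusion \<sigma>Y) (Y0, X0) Z \<and>
    (\<forall>Z'. strong_solution M F t0 W (inertial_drift lam b gradf) (inertial_diffusion \<sigma>Y) (Y0, X0) Z' \<longrightarrow>
      (AE \<omega> in M. \<forall>t\<ge>t0. Z' t \<omega> = Z t \<omega>)) \<and>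
    (\<forall>\<nu>>0. Z \<in> S_class M F t0 \<nu>)"
    by (rule additive_noise_solution[OF \<Phi>_meas \<Phi>_hs
        inertial_lipschitz_drift[OF assms(4,7,8) b_cont assms(11)] diffusion])
  then obtain Z where Z: "strong_solution M F t0 W (inertial_drift lam b gradf) (inertial_diffusion \<sigma>Y) (Y0, X0) Z"
    "\<And>Z'. strong_solution M F t0 W (inertial_drift lam b gradf) (inertial_diffusion \<sigma>Y) (Y0, X0) Z' \<Longrightarrow>
      AE \<omega> in M. \<forall>t\<ge>t0. Z' t \<omega> = Z t \<omega>"
    "\<And>\<nu>. 0 < \<nu> \<Longrightarrow> Z \<in> S_class M F t0 \<nu>"
    by blast
  show ?thesis
  proof (intro exI conjI allI impI)
    show "strong_solution M F t0 W (inertial_drift lam b gradf) (inertial_diffusion \<sigma>Y) (Y0, X0)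
      (\<lambda>t \<omega>. (fst (Z t \<omega>), snd (Z t \<omega>)))"
      using Z(1) by simp
    show "AE \<omega> in M. \<forall>t\<ge>t0. Y' t \<omega> = fst (Z t \<omega>) \<and> X' t \<omega> = snd (Z t \<omega>)"
      if "strong_solution M F t0 W (inertial_drift lam b gradf) (inertial_diffusion \<sigma>Y) (Y0, X0)
        (\<lambda>t \<omega>. (Y' t \<omega>, X' t \<omega>))" for Y' X'
      using Z(2)[OF that] by eventually_elim (metis fst_conv snd_conv)
    show "(\<lambda>t \<omega>. (fst (Z t \<omega>), snd (Z t \<omega>))) \<in> S_class M F t0 \<nu>" if "2 \<le> \<nu>" for \<nu>
      using Z(3)[of \<nu>] that by simp
  qed
qed

end
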